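(* The covering number of the symmetric group $S_9$ is $256$, i.e. $\sigma(S_9)=256$.
   Context: For a group $G$, a cover of $G$ is a finite collection $\{A_1,\dots,A_n\}$ of proper subgroups of $G$ with $G=\bigcup_{i=1}^n A_i$. The covering number $\sigma(G)$ is the smallest number of members in a cover of $G$. $S_n$ denotes the symmetric group of degree $n$. *)

theory Defs
  imports "HOL-Algebra.Sym_Groups" "HOL-Library.Extended_Nat"
begin

definition group_cover :: "('a, 'b) monoid_scheme \<Rightarrow> 'a set set \<Rightarrow> bool" where
  "group_cover G \<A> \<longleftrightarrow>
     finite \<A> \<and> (\<forall>H\<in>\<A>. subgroup H G \<and> H \<noteq> carrier G) \<and> \<Union>\<A> = carrier G"

text \<open>The infimum is taken in \<^typ>\<open>enat\<close>: a group without a cover (for instance a cyclic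
  group) has covering number \<open>\<infinity>\<close>, and a finite value is attained by some cover.\<close>

definition covering_number :: "('a, 'b) monoid_scheme \<Rightarrow> enat" where
  "covering_number G = (INF \<A>\<in>{\<A>. group_cover G \<A>}. enat (card \<A>))"

end

theory Submission
  imports Defs "HOL-Computational_Algebra.Primes" "HOL-Combinatorics.Multiset_Permutations"
begin

text \<open>The alternating group and the stabilisers of the sets of 1, 2, 3 or 4 points form a cover, because
  an odd permutation of 9 points is not a 9-cycle.

  Conversely, the members of a cover fix a set of at most 4 points, preserve a partition into three
  triples (a balanced 3-colouring), are primitive with an odd element, or consist of even permutations.
  The elements of type \<open>(2,7)\<close> and \<open>(4,5)\<close> lie only in set stabilisers, which accounts for all sets of 2
  and 4 points; those of type \<open>(1,8)\<close> lie in no stabiliser of a partition. The heart of the matter are the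
  elements of type \<open>(3,6)\<close>: each preserves one triple and four partitions. If \<open>k\<close> of these partitions are
  used, \<open>x\<close> tells whether the triple is used and \<open>c\<close> counts the primitive members containing the element,
  then \<open>(4 - k) * (k + x + c - 1) \<ge> 0\<close>. Summing this and bounding the sum of the \<open>k\<^sup>2\<close> from below by a
  constant and sums of squares gives a quadratic inequality between the numbers of members of each kind.
  It needs a bound for the number of elements of type \<open>(3,6)\<close> in a primitive group, which follows from the
  theorems of Jordan and Bochert.\<close>

section \<open>Jordan sets in primitive permutation groups\<close>

text \<open>The cover has 1 + 9 + 36 + 84 + 126 members. The 36 + 126 sets of 2 and 4 points are
  forced; singletons and triples are not, since 8-cycles may also lie in primitive members and
  elements of type (3,6) also in stabilisers of partitions. The second exchange is the obstacle: a
  partition accounts for 5184 of the 9! labellings and a triple for only 4320, so mere counting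
  would admit 70 partitions in place of 84 triples. The product with 4 - k bounds the sum of the k^2
  from above; it vanishes for elements covered exactly once and for those with all four partitions
  in use. That sum counts the common elements of pairs of partitions, and as a kernel on partitions
  it dominates Gram forms, which bounds it from below. The outcome is an equality for 84 triples
  without partitions, and also for 84 partitions without triples (no primitive members in either
  case), so it cannot exclude 255 members by itself. The 9-cycles do: they force a member of even
  permutations or so many primitive members that few partitions and triples are left.\<close>

locale perm_group =
  fixes \<Omega> :: "'a set" and H :: "('a \<Rightarrow> 'a) set"
  assumes finite_points: "finite \<Omega>"
    and permutes: "h \<in> H \<Longrightarrow> h permutes \<Omega>"
    and id_mem: "id \<in> H"
    and comp_mem: "g \<in> H \<Longrightarrow> h \<in> H \<Longrightarrow> g \<circ> h \<in> H"
    and inv_mem: "h \<in> H \<Longrightarrow> inv' h \<in> H"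
begin

lemma inj_mem: "h \<in> H \<Longrightarrow> inj h"
  using permutes permutes_inj by blast

lemma inv_apply [simp]: "h \<in> H \<Longrightarrow> inv' h (h x) = x" "h \<in> H \<Longrightarrow> h (inv' h x) = x"
  using permutes permutes_inverses by metis+

lemma inv_eq_iff: "h \<in> H \<Longrightarrow> inv' h x = y \<longleftrightarrow> x = h y"
  by (metis inv_apply)

lemma mem_image_iff: "h \<in> H \<Longrightarrow> h x \<in> h ` A \<longleftrightarrow> x \<in> A"
  using inj_mem by (simp add: inj_image_mem_iff)

lemma card_image_mem: "h \<in> H \<Longrightarrow> card (h ` A) = card A"
  by (meson card_image inj_mem inj_on_subset subset_UNIV)

lemma funpow_mem: "h \<in> H \<Longrightarrow> (h ^^ n) \<in> H"
  by (induction n) (auto simp: id_mem comp_mem)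

lemma finite_group: "finite H"
  by (rule finite_subset[of _ "{p. p permutes \<Omega>}"]) (auto simp: permutes finite_permutations finite_points)

lemma image_points: "h \<in> H \<Longrightarrow> h ` \<Omega> = \<Omega>"
  using permutes permutes_image by blast

lemma apply_mem: "h \<in> H \<Longrightarrow> h x \<in> \<Omega> \<longleftrightarrow> x \<in> \<Omega>"
  using permutes permutes_in_image by metis

definition supported :: "'a set \<Rightarrow> ('a \<Rightarrow> 'a) set" where
  "supported \<Gamma> = {h \<in> H. \<forall>x. x \<notin> \<Gamma> \<longrightarrow> h x = x}"

text \<open>In Jordan's terminology a primitive Jordan set: the group fixing every point outside
  \<Gamma> acts primitively on \<Gamma>. For \<Gamma> = \<Omega> this is primitivity of
  \<open>H\<close>, by \<open>supported_all\<close>.\<close>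

definition primitive_on :: "'a set \<Rightarrow> bool" where
  "primitive_on \<Gamma> \<longleftrightarrow> (\<forall>a\<in>\<Gamma>. \<forall>b\<in>\<Gamma>. \<exists>h\<in>supported \<Gamma>. h a = b) \<and>
     (\<forall>\<Delta>\<subseteq>\<Gamma>. 2 \<le> card \<Delta> \<longrightarrow> \<Delta> \<noteq> \<Gamma> \<longrightarrow> (\<exists>h\<in>supported \<Gamma>. h ` \<Delta> \<inter> \<Delta> \<noteq> {} \<and> h ` \<Delta> \<noteq> \<Delta>))"

lemma primitive_onD:
  assumes "primitive_on \<Gamma>"
  shows "a \<in> \<Gamma> \<Longrightarrow> b \<in> \<Gamma> \<Longrightarrow> \<exists>h\<in>supported \<Gamma>. h a = b"
    and "\<Delta> \<subseteq> \<Gamma> \<Longrightarrow> 2 \<le> card \<Delta> \<Longrightarrow> \<Delta> \<noteq> \<Gamma> \<Longrightarrow>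
      \<exists>h\<in>supported \<Gamma>. h ` \<Delta> \<inter> \<Delta> \<noteq> {} \<and> h ` \<Delta> \<noteq> \<Delta>"
  using assms unfolding primitive_on_def by blast+

lemma supported_mem: "h \<in> supported \<Gamma> \<Longrightarrow> h \<in> H"
  and supported_fix: "h \<in> supported \<Gamma> \<Longrightarrow> x \<notin> \<Gamma> \<Longrightarrow> h x = x"
  and supported_mono: "\<Gamma> \<subseteq> \<Gamma>' \<Longrightarrow> supported \<Gamma> \<subseteq> supported \<Gamma>'"
  by (auto simp: supported_def)

lemma supported_all: "supported \<Omega> = H"
  using permutes by (auto simp: supported_def permutes_def)

lemma supported_comp: "g \<in> supported \<Gamma> \<Longrightarrow> h \<in> supported \<Gamma> \<Longrightarrow> g \<circ> h \<in> supported \<Gamma>"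
  and supported_inv: "h \<in> supported \<Gamma> \<Longrightarrow> inv' h \<in> supported \<Gamma>"
  by (auto simp: supported_def comp_mem inv_mem inv_eq_iff)

lemma supported_in: 
  assumes "h \<in> supported \<Gamma>" shows "h x \<in> \<Gamma> \<longleftrightarrow> x \<in> \<Gamma>"
  using assms by (metis supported_fix supported_mem inv_apply(1))

lemma supported_image: 
  assumes "h \<in> supported \<Gamma>" shows "h ` \<Gamma> = \<Gamma>"
proof
  show "h ` \<Gamma> \<subseteq> \<Gamma>" using supported_in[OF assms] by blast
  show "\<Gamma> \<subseteq> h ` \<Gamma>"
  proof
    fix x assume "x \<in> \<Gamma>"
    then have "inv' h x \<in> \<Gamma>" using supported_in[OF supported_inv[OF assms]] by blast
    then show "x \<in> h ` \<Gamma>" using inv_apply(2)[OF supported_mem[OF assms]] by (metis imageI)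
  qed
qed

lemma supported_conj:
  assumes "g \<in> H" "k \<in> supported \<Gamma>" shows "g \<circ> k \<circ> inv' g \<in> supported (g ` \<Gamma>)"
  unfolding supported_def
proof (intro CollectI conjI allI impI)
  show "g \<circ> k \<circ> inv' g \<in> H"
    using assms by (simp add: comp_mem inv_mem supported_mem)
  fix x assume "x \<notin> g ` \<Gamma>"
  then have "inv' g x \<notin> \<Gamma>" using imageI[of "inv' g x" \<Gamma> g] assms(1) by auto
  then show "(g \<circ> k \<circ> inv' g) x = x" using assms by (simp add: supported_fix)
qed

lemma primitive_on_image:
  assumes g: "g \<in> H" and prim: "primitive_on \<Gamma>" shows "primitive_on (g ` \<Gamma>)"
  unfolding primitive_on_def
proof (intro conjI ballI allI impI)
  fix a b assume "a \<in> g ` \<Gamma>" "b \<in> g ` \<Gamma>"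
  then obtain a' b' where ab: "a = g a'" "b = g b'" "a' \<in> \<Gamma>" "b' \<in> \<Gamma>" by blast
  then obtain k where "k \<in> supported \<Gamma>" "k a' = b'" using primitive_onD(1)[OF prim] by blast
  then show "\<exists>h\<in>supported (g ` \<Gamma>). h a = b"
    using ab g by (intro bexI[OF _ supported_conj[OF g]]) auto
next
  fix \<Delta> assume \<Delta>: "\<Delta> \<subseteq> g ` \<Gamma>" "2 \<le> card \<Delta>" "\<Delta> \<noteq> g ` \<Gamma>"
  then obtain \<Delta>' where \<Delta>': "\<Delta> = g ` \<Delta>'" "\<Delta>' \<subseteq> \<Gamma>" by (meson subset_imageE)
  have "2 \<le> card \<Delta>'" using \<Delta>(2) \<Delta>' card_image_mem[OF g] by simp
  then obtain k where k: "k \<in> supported \<Gamma>" "k ` \<Delta>' \<inter> \<Delta>' \<noteq> {}" "k ` \<Delta>' \<noteq> \<Delta>'"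
    using primitive_onD(2)[OF prim \<Delta>'(2)] \<Delta>(3) \<Delta>'(1) by blast
  have eq: "(g \<circ> k \<circ> inv' g) ` \<Delta> = g ` k ` \<Delta>'"
    unfolding \<Delta>'(1) image_comp using g by (intro image_cong) auto
  have "(g \<circ> k \<circ> inv' g) ` \<Delta> \<inter> \<Delta> \<noteq> {}"
    using k(2) by (subst eq, subst \<Delta>'(1)) blast
  moreover have "(g \<circ> k \<circ> inv' g) ` \<Delta> \<noteq> \<Delta>"
    using k(3) inj_mem[OF g] by (subst eq, subst \<Delta>'(1)) (simp add: inj_image_eq_iff)
  ultimately show "\<exists>h\<in>supported (g ` \<Gamma>). h ` \<Delta> \<inter> \<Delta> \<noteq> {} \<and> h ` \<Delta> \<noteq> \<Delta>"
    using supported_conj[OF g k(1)] by blast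
qed

text \<open>The group on the enlarged set is even doubly transitive:
  \<open>supported \<Gamma>\<close> fixes \<open>x\<close> and is transitive on all other points, so
  a block containing \<open>x\<close> and one more point is everything.\<close>

lemma primitive_on_insert:
  assumes prim: "primitive_on \<Gamma>" and x: "x \<notin> \<Gamma>" and \<Gamma>': "primitive_on \<Gamma>'"
    and eq: "\<Gamma> \<union> \<Gamma>' = insert x \<Gamma>" "\<Gamma> \<inter> \<Gamma>' \<noteq> {}" "x \<in> \<Gamma>'"
  shows "primitive_on (insert x \<Gamma>)"
proof -
  let ?U = "insert x \<Gamma>"
  have sub: "supported \<Gamma> \<subseteq> supported ?U" "supported \<Gamma>' \<subseteq> supported ?U"
    using eq by (auto intro!: supported_mono)
  obtain y where y: "y \<in> \<Gamma>" "y \<in> \<Gamma>'" using eq by blast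
  have to_y: "\<exists>h\<in>supported ?U. h a = y" if "a \<in> ?U" for a
    using that primitive_onD(1)[OF prim _ y(1)] primitive_onD(1)[OF \<Gamma>' _ y(2)] sub eq(3) by blast
  have trans: "\<exists>h\<in>supported ?U. h a = b" if ab: "a \<in> ?U" "b \<in> ?U" for a b
  proof -
    obtain h k where "h \<in> supported ?U" "h a = y" "k \<in> supported ?U" "k b = y"
      using to_y ab by meson
    then have "inv' k \<circ> h \<in> supported ?U" "(inv' k \<circ> h) a = b"
      using supported_comp supported_inv supported_mem inv_apply by (auto simp: inv_eq_iff)
    then show ?thesis by blast
  qed
  show ?thesis
    unfolding primitive_on_def
  proof (intro conjI ballI allI impI)
    fix a b assume "a \<in> ?U" "b \<in> ?U" then show "\<exists>h\<in>supported ?U. h a = b" by (rule trans)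
  next
    fix \<Delta> assume \<Delta>: "\<Delta> \<subseteq> ?U" "2 \<le> card \<Delta>" "\<Delta> \<noteq> ?U"
    obtain a where a: "a \<in> \<Delta>" using \<Delta>(2) by fastforce
    \<comment> \<open>The block is translated over \<open>x\<close>; the element that breaks it
      there is conjugated back.\<close>
    obtain g where g: "g \<in> supported ?U" "g a = x" using trans[of a x] a \<Delta>(1) by blast
    have gH: "g \<in> H" using g supported_mem by blast
    let ?D = "g ` \<Delta>"
    have D: "?D \<subseteq> ?U" "2 \<le> card ?D" "x \<in> ?D"
      using image_mono[OF \<Delta>(1), of g] supported_image[OF g(1)] \<Delta>(2) card_image_mem[OF gH] a g(2) by auto
    have "?D \<noteq> ?U"
      using supported_image[OF g(1)] \<Delta>(3) inj_mem[OF gH] by (metis inj_image_eq_iff)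
    then obtain z where z: "z \<in> \<Gamma>" "z \<notin> ?D" using D by blast
    have "?D \<noteq> {x}" using D(2) by auto
    then obtain u where u: "u \<in> ?D" "u \<in> \<Gamma>" using D by blast
    obtain h where h: "h \<in> supported \<Gamma>" "h u = z" using primitive_onD(1)[OF prim u(2) z(1)] by blast
    have hx: "h x = x" using supported_fix[OF h(1) x] .
    have hH: "h \<in> H" "h \<in> supported ?U" using h supported_mem sub by auto
    let ?k = "inv' g \<circ> h \<circ> g"
    have k: "?k \<in> supported ?U" using supported_comp supported_inv g hH by metis
    have "?k a = a" using g(2) hx gH by (simp add: inv_eq_iff)
    then have "?k ` \<Delta> \<inter> \<Delta> \<noteq> {}" using a by (metis disjoint_iff imageI)
    moreover have "?k ` \<Delta> \<noteq> \<Delta>"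
    proof
      assume "?k ` \<Delta> = \<Delta>"
      then have "g ` (?k ` \<Delta>) = ?D" by simp
      moreover have "g ` (?k ` \<Delta>) = h ` ?D" unfolding image_comp using gH by (intro image_cong) auto
      ultimately show False using u h(2) z(2) by blast
    qed
    ultimately show "\<exists>h\<in>supported ?U. h ` \<Delta> \<inter> \<Delta> \<noteq> {} \<and> h ` \<Delta> \<noteq> \<Delta>" using k by blast
  qed
qed

text \<open>Jordan's argument: among the translates of \<open>\<Gamma>\<close> that overlap \<open>\<Gamma>\<close>, one that sticks out
  least sticks out by a single point, since otherwise the part that sticks out would be a block.\<close>

lemma jordan_step:
  assumes \<Omega>: "primitive_on \<Omega>" and prim: "primitive_on \<Gamma>" and \<Gamma>: "\<Gamma> \<subset> \<Omega>" "2 \<le> card \<Gamma>"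
  shows "\<exists>x\<in>\<Omega> - \<Gamma>. primitive_on (insert x \<Gamma>)"
proof -
  have fin: "finite \<Gamma>" using \<Gamma> finite_points finite_subset by blast
  define P where "P g \<longleftrightarrow> g \<in> H \<and> g ` \<Gamma> \<inter> \<Gamma> \<noteq> {} \<and> g ` \<Gamma> \<noteq> \<Gamma>" for g
  obtain g0 where "P g0"
    using primitive_onD(2)[OF \<Omega> _ \<Gamma>(2)] \<Gamma>(1) unfolding P_def supported_all by blast
  then obtain g where g: "P g" and least: "\<And>h. P h \<Longrightarrow> card (g ` \<Gamma> - \<Gamma>) \<le> card (h ` \<Gamma> - \<Gamma>)"
    using ex_has_least_nat[of P g0 "\<lambda>g. card (g ` \<Gamma> - \<Gamma>)"] by blast
  have gH: "g \<in> H" and meet: "g ` \<Gamma> \<inter> \<Gamma> \<noteq> {}" and neq: "g ` \<Gamma> \<noteq> \<Gamma>" using g by (auto simp: P_def)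
  let ?D = "g ` \<Gamma> - \<Gamma>"
  have "?D \<noteq> {}"
    using neq card_subset_eq[OF fin, of "g ` \<Gamma>"] card_image_mem[OF gH] by blast
  moreover have "\<not> 2 \<le> card ?D"
  proof
    assume two: "2 \<le> card ?D"
    obtain c where c: "c \<in> supported (g ` \<Gamma>)" "c ` ?D \<inter> ?D \<noteq> {}" "c ` ?D \<noteq> ?D"
      using primitive_onD(2)[OF primitive_on_image[OF gH prim], of ?D] two meet by blast
    have cH: "c \<in> H" using c supported_mem by blast
    \<comment> \<open>\<open>c\<close> permutes the translate of \<Gamma> under \<open>g\<close> and
      fixes all other points, so what sticks out of \<Gamma> under \<open>c\<close> is the part of
      \<open>?D\<close> outside its own image. As \<open>?D\<close> meets its image, this is less
      than \<open>?D\<close>.\<close>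
    have diff: "c ` \<Gamma> - \<Gamma> = ?D - c ` ?D"
    proof (intro equalityI subsetI)
      fix x assume "x \<in> c ` \<Gamma> - \<Gamma>"
      then obtain y where y: "x = c y" "y \<in> \<Gamma>" "x \<notin> \<Gamma>" by blast
      then have "y \<in> g ` \<Gamma>" using supported_fix[OF c(1)] by metis
      then have "x \<in> g ` \<Gamma>" using supported_in[OF c(1)] y by blast
      then show "x \<in> ?D - c ` ?D" using y mem_image_iff[OF cH] by blast
    next
      fix x assume x: "x \<in> ?D - c ` ?D"
      then obtain y where y: "x = c y" "y \<in> g ` \<Gamma>" using supported_image[OF c(1)] by blast
      then have "y \<in> \<Gamma>" using x by blast
      then show "x \<in> c ` \<Gamma> - \<Gamma>" using x y by blast
    qed
    have finD: "finite ?D" using fin by simp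
    have "card (c ` \<Gamma> - \<Gamma>) < card ?D"
      unfolding diff using c(2) finD by (intro psubset_card_mono) auto
    moreover have "P c"
      unfolding P_def
    proof (intro conjI)
      show "c ` \<Gamma> \<noteq> \<Gamma>"
      proof
        assume "c ` \<Gamma> = \<Gamma>"
        then have "?D - c ` ?D = {}" using diff by simp
        then have "?D = c ` ?D"
          using finD card_image_mem[OF cH, of ?D] by (intro card_subset_eq) auto
        then show False using c(3) by simp
      qed
      show "c ` \<Gamma> \<inter> \<Gamma> \<noteq> {}"
      proof
        assume "c ` \<Gamma> \<inter> \<Gamma> = {}"
        then have "c ` \<Gamma> - \<Gamma> = c ` \<Gamma>" by (rule Diff_triv)
        then have "card \<Gamma> = card (?D - c ` ?D)" using diff card_image_mem[OF cH] by metis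
        also have "\<dots> \<le> card ?D" using finD by (intro card_mono) auto
        also have "\<dots> < card (g ` \<Gamma>)" using meet fin by (intro psubset_card_mono) auto
        finally show False using card_image_mem[OF gH] by simp
      qed
    qed (rule cH)
    ultimately show False using least[of c] by simp
  qed
  ultimately have "card ?D = 1"
    using fin by (metis One_nat_def card_0_eq finite_Diff finite_imageI less_2_cases not_le)
  then obtain x where x: "?D = {x}" by (auto simp: card_1_singleton_iff)
  have "primitive_on (insert x \<Gamma>)"
    using x meet by (intro primitive_on_insert[OF prim _ primitive_on_image[OF gH prim]]) auto
  moreover have "x \<in> \<Omega> - \<Gamma>" using x \<Gamma> image_points[OF gH] by blast
  ultimately show ?thesis by blast
qed

text \<open>Orbit-stabiliser: \<open>supported \<Gamma>\<close> fixes \<open>x\<close>, whose orbit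
  has \<open>Suc (card \<Gamma>)\<close> points, and its translates by a transversal
  \<open>r\<close> are disjoint.\<close>

lemma card_supported_insert:
  assumes "primitive_on (insert x \<Gamma>)" "x \<notin> \<Gamma>" "finite \<Gamma>"
  shows "Suc (card \<Gamma>) * card (supported \<Gamma>) \<le> card (supported (insert x \<Gamma>))"
proof -
  define r where "r y = (SOME h. h \<in> supported (insert x \<Gamma>) \<and> h x = y)" for y
  have r: "r y \<in> supported (insert x \<Gamma>) \<and> r y x = y" if "y \<in> insert x \<Gamma>" for y
    unfolding r_def
    by (rule someI_ex[of "\<lambda>h. h \<in> supported (insert x \<Gamma>) \<and> h x = y"])
      (use primitive_onD(1)[OF assms(1), of x y] that in blast)
  have inj: "inj_on (\<lambda>(y, h). r y \<circ> h) (insert x \<Gamma> \<times> supported \<Gamma>)"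
  proof (rule inj_onI, clarify)
    fix y h z k
    assume A: "y \<in> insert x \<Gamma>" "z \<in> insert x \<Gamma>" "h \<in> supported \<Gamma>" "k \<in> supported \<Gamma>" "r y \<circ> h = r z \<circ> k"
    have "y = z"
      using fun_cong[OF A(5), of x] r[OF A(1)] r[OF A(2)] A(3,4) assms(2) by (simp add: supported_fix)
    moreover from this have "h = k"
      using A(5) inj_mem[OF supported_mem[OF conjunct1[OF r[OF A(1)]]]] by (metis fun.inj_map injD)
    ultimately show "y = z \<and> h = k" by simp
  qed
  have fin: "finite (supported (insert x \<Gamma>))" using finite_group by (simp add: supported_def)
  have "(\<lambda>(y, h). r y \<circ> h) ` (insert x \<Gamma> \<times> supported \<Gamma>) \<subseteq> supported (insert x \<Gamma>)"
    using r supported_comp supported_mono[of \<Gamma> "insert x \<Gamma>"] by fastforce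
  then have "card (insert x \<Gamma> \<times> supported \<Gamma>) \<le> card (supported (insert x \<Gamma>))"
    using inj fin by (metis card_inj_on_le)
  then show ?thesis using assms by (simp add: card_cartesian_product)
qed

text \<open>Each point adjoined by \<open>jordan_step\<close> multiplies the order at least by the
  new number of points. The index bound is multiplied out to avoid division.\<close>

lemma jordan_card:
  assumes \<Omega>: "primitive_on \<Omega>" and "primitive_on \<Gamma>" "\<Gamma> \<subseteq> \<Omega>" "2 \<le> card \<Gamma>"
  shows "card (supported \<Gamma>) * fact (card \<Omega>) \<le> card H * fact (card \<Gamma>)"
  using assms(2-)
proof (induction "card (\<Omega> - \<Gamma>)" arbitrary: \<Gamma>)
  case 0
  then have "\<Gamma> = \<Omega>" using finite_points by auto
  then show ?case by (simp add: supported_all)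
next
  case (Suc n)
  then have "\<Gamma> \<subset> \<Omega>" by auto
  then obtain x where x: "x \<in> \<Omega> - \<Gamma>" "primitive_on (insert x \<Gamma>)"
    using jordan_step[OF \<Omega> Suc.prems(1)] Suc.prems(3) by blast
  have fin: "finite \<Gamma>" using Suc.prems finite_points finite_subset by blast
  have "n = card (\<Omega> - insert x \<Gamma>)"
    using Suc.hyps(2) x finite_points by (simp add: Diff_insert[of \<Omega> x])
  then have "card (supported (insert x \<Gamma>)) * fact (card \<Omega>) \<le> card H * fact (card (insert x \<Gamma>))"
    using Suc.hyps(1)[of "insert x \<Gamma>"] x Suc.prems fin by auto
  moreover have "Suc (card \<Gamma>) * card (supported \<Gamma>) * fact (card \<Omega>) \<le> card (supported (insert x \<Gamma>)) * fact (card \<Omega>)"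
    using card_supported_insert[OF x(2)] x fin by simp
  ultimately have "Suc (card \<Gamma>) * (card (supported \<Gamma>) * fact (card \<Omega>)) \<le> Suc (card \<Gamma>) * (card H * fact (card \<Gamma>))"
    using x fin by (simp add: algebra_simps)
  then show ?case by (simp only: mult_le_cancel1)
qed

lemma card_le_supported:
  assumes "primitive_on \<Gamma>" "finite \<Gamma>" shows "card \<Gamma> \<le> card (supported \<Gamma>)"
proof (cases "\<Gamma> = {}")
  case False
  then obtain x where x: "x \<in> \<Gamma>" by blast
  have "\<Gamma> \<subseteq> (\<lambda>h. h x) ` supported \<Gamma>" using primitive_onD(1)[OF assms(1) x] by blast
  moreover have "finite (supported \<Gamma>)" using finite_group by (simp add: supported_def)
  ultimately show ?thesis by (meson card_image_le card_mono finite_imageI le_trans)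
qed simp

end

section \<open>Points moved by elements of prime order\<close>

definition moved :: "('a \<Rightarrow> 'a) \<Rightarrow> 'a set" where
  "moved h = {x. h x \<noteq> x}"

lemma moved_iff: "x \<in> moved h \<longleftrightarrow> h x \<noteq> x"
  by (simp add: moved_def)

lemma funpow_period_mult:
  fixes h :: "'a \<Rightarrow> 'a" assumes "h ^^ p = id" shows "h ^^ (p * n) = id"
  by (metis assms funpow_mult id_funpow)

lemma funpow_coprime_root:
  fixes h :: "'a \<Rightarrow> 'a"
  assumes "h ^^ p = id" "coprime k p" "k \<noteq> 0"
  obtains m where "(h ^^ k) ^^ m = h"
proof -
  obtain m n where "k * m = p * n + 1" using bezout_nat[OF assms(3), of p] assms(2) by auto
  then have "(h ^^ k) ^^ m = h \<circ> h ^^ (p * n)"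
    by (simp add: funpow_mult)
  then show ?thesis using that funpow_period_mult[OF assms(1)] by simp
qed

lemma funpow_fixed: "h x = x \<Longrightarrow> (h ^^ n) x = x"
  by (induction n) auto

lemma funpow_image_eq: "f ` A = A \<Longrightarrow> (f ^^ n) ` A = A"
  by (induction n) (simp, metis funpow.simps(2) image_comp)

lemma funpow_inj_on_moved:
  assumes "h ^^ p = id" "prime p" "inj h" "h a \<noteq> a"
  shows "inj_on (\<lambda>i. (h ^^ i) a) {..<p}"
proof (rule linorder_inj_onI')
  fix i j assume ij: "i \<in> {..<p}" "j \<in> {..<p}" "i < j"
  show "(h ^^ i) a \<noteq> (h ^^ j) a"
  proof
    assume "(h ^^ i) a = (h ^^ j) a"
    then have "(h ^^ i) a = (h ^^ i) ((h ^^ (j - i)) a)"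
      using ij by (simp flip: comp_apply[of "h ^^ i"] funpow_add)
    then have fixed: "(h ^^ (j - i)) a = a" using assms(3) by (metis inj_fn injD)
    have "coprime (j - i) p"
      using ij assms(2) by (intro prime_imp_coprime_nat[THEN coprime_commute[THEN iffD1]]) (auto dest: dvd_imp_le)
    moreover have "j - i \<noteq> 0" using ij by simp
    ultimately obtain m where "(h ^^ (j - i)) ^^ m = h" by (rule funpow_coprime_root[OF assms(1)])
    then show False using funpow_fixed[of "h ^^ (j - i)" a m] fixed assms(4) by simp
  qed
qed

lemma funpow_mod_period:
  fixes h :: "'a \<Rightarrow> 'a" assumes "h ^^ p = id" shows "h ^^ (i mod p) = h ^^ i"
proof -
  have "h ^^ i = h ^^ (p * (i div p) + i mod p)" by simp
  also have "\<dots> = h ^^ (i mod p)" using funpow_period_mult[OF assms] by (simp only: funpow_add) simp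
  finally show ?thesis by simp
qed

lemma funpow_moved: "inj h \<Longrightarrow> h a \<noteq> a \<Longrightarrow> h ((h ^^ i) a) \<noteq> (h ^^ i) a"
  by (metis funpow_swap1 inj_fn injD)

text \<open>All nontrivial orbits have length \<open>p\<close>, by
  \<open>funpow_inj_on_moved\<close>.\<close>

lemma prime_order_dvd_moved:
  assumes "h ^^ p = id" "prime p" "inj h" "finite (moved h)"
  shows "p dvd card (moved h)"
proof -
  define O' where "O' a = (\<lambda>i. (h ^^ i) a) ` {..<p}" for a
  have p: "p > 0" using assms(2) by (simp add: prime_gt_0_nat)
  have self: "a \<in> O' a" for a unfolding O'_def using p by (intro image_eqI[of _ _ 0]) auto
  have sub: "O' a \<subseteq> moved h" if "a \<in> moved h" for a
    using that funpow_moved[OF assms(3)] by (auto simp: O'_def moved_def)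
  have range: "O' a = range (\<lambda>i. (h ^^ i) a)" for a
  proof -
    have "(h ^^ i) a \<in> O' a" for i
      unfolding O'_def using p by (intro image_eqI[of _ _ "i mod p"]) (simp_all add: funpow_mod_period[OF assms(1)])
    then show ?thesis by (auto simp: O'_def)
  qed
  have comb: "(h ^^ j) ((h ^^ i) a) = (h ^^ (j + i)) a" for i j a by (simp add: funpow_add)
  have shift: "O' ((h ^^ i) a) = O' a" for i a
  proof
    show "O' ((h ^^ i) a) \<subseteq> O' a" unfolding range by (simp only: comb) blast
    have "(h ^^ j) a = (h ^^ (j + (p * i - i))) ((h ^^ i) a)" for j
    proof -
      have eq: "j + (p * i - i) + i = j + p * i" using p by (cases p) auto
      show ?thesis unfolding comb eq by (simp add: funpow_add funpow_period_mult[OF assms(1)])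
    qed
    then show "O' a \<subseteq> O' ((h ^^ i) a)" unfolding range by blast
  qed
  have "\<Union> (O' ` moved h) = moved h" using self sub by blast
  moreover have "p dvd card (\<Union> (O' ` moved h))"
  proof (rule dvd_partition)
    show "finite (\<Union> (O' ` moved h))" using assms(4) calculation by simp
    show "\<forall>c\<in>O' ` moved h. p dvd card c"
      using funpow_inj_on_moved[OF assms(1-3)] by (auto simp: O'_def card_image moved_def)
    show "\<forall>c1\<in>O' ` moved h. \<forall>c2\<in>O' ` moved h. c1 \<noteq> c2 \<longrightarrow> c1 \<inter> c2 = {}"
    proof (intro ballI impI, rule ccontr)
      fix c1 c2 assume "c1 \<in> O' ` moved h" "c2 \<in> O' ` moved h" and c: "c1 \<noteq> c2" "c1 \<inter> c2 \<noteq> {}"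
      then obtain a b x where "c1 = O' a" "c2 = O' b" "x \<in> O' a" "x \<in> O' b" by blast
      then show False using c shift unfolding range[of a] range[of b] by (metis rangeE range)
    qed
  qed
  ultimately show ?thesis by simp
qed

text \<open>If n is the order of \<open>h\<close> and q a prime divisor of n, the power with
  exponent n / q has order q.\<close>

lemma prime_order_power:
  fixes h :: "'a \<Rightarrow> 'a"
  assumes "permutation h" "h \<noteq> id"
  obtains m q where "prime q" "(h ^^ m) ^^ q = id" "h ^^ m \<noteq> id"
proof -
  define P where "P n \<longleftrightarrow> n > 0 \<and> h ^^ n = id" for n
  obtain n0 where "P n0" using permutation_is_nilpotent[OF assms(1)] by (metis P_def)
  define n where "n = (LEAST n. P n)"
  have n: "P n" unfolding n_def using \<open>P n0\<close> by (rule LeastI)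
  have least: "\<not> P m" if "m < n" for m using that not_less_Least unfolding n_def by blast
  have "n \<noteq> 1" using n assms(2) by (auto simp: P_def)
  then obtain q where q: "prime q" "q dvd n" using prime_factor_nat by blast
  then obtain m where m: "n = m * q" by (metis dvd_def mult.commute)
  have "m > 0" "m < n" using n m prime_gt_1_nat[OF q(1)] by (auto simp: P_def)
  then have "h ^^ m \<noteq> id" using least[of m] by (auto simp: P_def)
  moreover have "(h ^^ m) ^^ q = id" using n m by (simp add: P_def funpow_mult)
  ultimately show ?thesis using that q(1) by blast
qed

section \<open>Cycles of prime length, index two, and Bochert's bound\<close>

context perm_group
begin

lemma moved_subset: "h \<in> H \<Longrightarrow> moved h \<subseteq> \<Omega>"
  using permutes by (auto simp: moved_def permutes_def)

lemma finite_moved: "h \<in> H \<Longrightarrow> finite (moved h)"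
  using moved_subset finite_points finite_subset by blast

lemma supported_iff: "h \<in> supported \<Gamma> \<longleftrightarrow> h \<in> H \<and> moved h \<subseteq> \<Gamma>"
  by (auto simp: supported_def moved_def)

text \<open>A power of \<open>h\<close> that carries one point of a block to another would preserve
  the block; since \<open>p\<close> is prime, \<open>h\<close> is a power of that power, so the
  block would contain the whole cycle.\<close>

lemma prime_cycle_primitive:
  assumes h: "h \<in> H" "h ^^ p = id" "prime p" "card (moved h) = p"
  shows "primitive_on (moved h)"
proof -
  have inj: "inj h" using h inj_mem by blast
  have orbit: "(\<lambda>i. (h ^^ i) a) ` {..<p} = moved h" if a: "a \<in> moved h" for a
  proof (rule card_subset_eq[OF finite_moved[OF h(1)]])
    show "(\<lambda>i. (h ^^ i) a) ` {..<p} \<subseteq> moved h" using a funpow_moved[OF inj] by (auto simp: moved_def)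
    show "card ((\<lambda>i. (h ^^ i) a) ` {..<p}) = card (moved h)"
      using funpow_inj_on_moved[OF h(2,3) inj] a h(4) by (simp add: card_image moved_def)
  qed
  have pow: "h ^^ i \<in> supported (moved h)" for i
    by (auto simp: supported_iff moved_def funpow_mem[OF h(1)] intro: ccontr dest: funpow_fixed[of h])
  show ?thesis unfolding primitive_on_def
  proof (intro conjI ballI allI impI)
    fix a b assume "a \<in> moved h" "b \<in> moved h"
    then show "\<exists>k\<in>supported (moved h). k a = b" using orbit[of a] pow by (metis (no_types, lifting) imageE)
  next
    fix \<Delta> assume \<Delta>: "\<Delta> \<subseteq> moved h" "2 \<le> card \<Delta>" "\<Delta> \<noteq> moved h"
    obtain a b where ab: "a \<in> \<Delta>" "b \<in> \<Delta>" "a \<noteq> b"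
      using \<Delta>(2) by (metis card_2_iff' card_le_Suc0_iff_eq not_less_eq_eq numeral_2_eq_2 card.infinite zero_le)
    then obtain i where i: "b = (h ^^ i) a" "i < p" using orbit[of a] \<Delta>(1) by blast
    have i0: "i \<noteq> 0" using i ab by (metis funpow_0)
    have "coprime i p"
      using i i0 h(3) by (intro prime_imp_coprime_nat[THEN coprime_commute[THEN iffD1]]) (auto dest: dvd_imp_le)
    then obtain m where m: "(h ^^ i) ^^ m = h" using funpow_coprime_root[OF h(2) _ i0] by metis
    have "(h ^^ i) ` \<Delta> \<noteq> \<Delta>"
    proof
      assume "(h ^^ i) ` \<Delta> = \<Delta>"
      then have "h ` \<Delta> = \<Delta>" using m funpow_image_eq[of "h ^^ i" \<Delta> m] by simp
      then have "(h ^^ n) ` \<Delta> = \<Delta>" for n by (rule funpow_image_eq)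
      then have "moved h \<subseteq> \<Delta>" using orbit[of a] ab \<Delta>(1) by blast
      then show False using \<Delta> by blast
    qed
    moreover have "(h ^^ i) ` \<Delta> \<inter> \<Delta> \<noteq> {}" using i(1) ab by blast
    ultimately show "\<exists>k\<in>supported (moved h). k ` \<Delta> \<inter> \<Delta> \<noteq> {} \<and> k ` \<Delta> \<noteq> \<Delta>" using pow by blast
  qed
qed

text \<open>Jordan's theorem on cycles of prime length in quantitative form: \<open>p = 2\<close>
  gives the symmetric group and \<open>p = 3\<close> index at most 2; for larger \<open>p\<close> it
  is combined with an upper bound for \<open>card H\<close>.\<close>

lemma prime_cycle_card:
  assumes \<Omega>: "primitive_on \<Omega>" and h: "h \<in> H" "h ^^ p = id" "prime p" "card (moved h) = p"
  shows "fact (card \<Omega>) \<le> card H * fact (p - 1)"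
proof -
  have prim: "primitive_on (moved h)" by (rule prime_cycle_primitive[OF h])
  have "p * fact (card \<Omega>) \<le> card (supported (moved h)) * fact (card \<Omega>)"
    using card_le_supported[OF prim finite_moved[OF h(1)]] h(4) by simp
  also have "\<dots> \<le> card H * fact p"
    using jordan_card[OF \<Omega> prim moved_subset[OF h(1)]] h(3,4) prime_ge_2_nat by simp
  also have "\<dots> = p * (card H * fact (p - 1))"
    using prime_gt_0_nat[OF h(3)] fact_reduce[of p, where 'a = nat] by simp
  finally show ?thesis using prime_gt_0_nat[OF h(3)] by simp
qed

lemma eq_all_if_card:
  assumes "fact (card \<Omega>) \<le> card H" shows "H = {p. p permutes \<Omega>}"
proof (rule card_subset_eq)
  show fin: "finite {p. p permutes \<Omega>}" using finite_points by (simp add: finite_permutations)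
  show sub: "H \<subseteq> {p. p permutes \<Omega>}" using permutes by blast
  show "card H = card {p. p permutes \<Omega>}"
    using card_mono[OF fin sub] assms finite_points by (simp add: card_permutations)
qed

text \<open>A transposition in \<open>H\<close> would give everything by
  \<open>prime_cycle_card\<close>. Otherwise \<open>H\<close> and its translate by any transposition
  exhaust the symmetric group, so a transposition toggles membership in \<open>H\<close> just as it
  toggles parity, and \<open>H\<close> has only even elements.\<close>

lemma index_two_odd_imp_all:
  assumes \<Omega>: "primitive_on \<Omega>" and card: "fact (card \<Omega>) \<le> 2 * card H" and odd: "h \<in> H" "\<not> evenperm h"
  shows "H = {p. p permutes \<Omega>}"
proof (cases "\<exists>a\<in>\<Omega>. \<exists>b\<in>\<Omega>. a \<noteq> b \<and> transpose a b \<in> H")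
  case True
  then obtain a b where ab: "a \<in> \<Omega>" "b \<in> \<Omega>" "a \<noteq> b" "transpose a b \<in> H" by blast
  have "moved (transpose a b) = {a, b}" using ab(3) by (auto simp: moved_def transpose_def)
  moreover have "transpose a b ^^ 2 = id" by (simp add: numeral_2_eq_2)
  ultimately have "fact (card \<Omega>) \<le> card H * fact (2 - 1)"
    using ab by (intro prime_cycle_card[OF \<Omega>, of "transpose a b"]) auto
  then show ?thesis using eq_all_if_card by simp
next
  case False
  have coset: "H \<union> (\<lambda>h. transpose a b \<circ> h) ` H = {p. p permutes \<Omega>}" if ab: "a \<in> \<Omega>" "b \<in> \<Omega>" "a \<noteq> b" for a b
  proof (rule card_subset_eq)
    let ?t = "transpose a b"
    have t: "?t permutes \<Omega>" using ab by (simp add: permutes_swap_id)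
    show "finite {p. p permutes \<Omega>}" using finite_points by (simp add: finite_permutations)
    show sub: "H \<union> (\<lambda>h. ?t \<circ> h) ` H \<subseteq> {p. p permutes \<Omega>}"
      using permutes t by (auto intro: permutes_compose)
    have "inj_on (\<lambda>h. ?t \<circ> h) H"
      by (rule inj_onI) (metis comp_assoc id_comp transpose_comp_involutory)
    then have "card ((\<lambda>h. ?t \<circ> h) ` H) = card H" by (rule card_image)
    moreover have "H \<inter> (\<lambda>h. ?t \<circ> h) ` H = {}"
    proof (rule ccontr)
      assume "H \<inter> (\<lambda>h. ?t \<circ> h) ` H \<noteq> {}"
      then obtain g where g: "g \<in> H" "?t \<circ> g \<in> H" by blast
      then have "?t \<circ> g \<circ> inv' g \<in> H" using comp_mem[OF _ inv_mem] by blast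
      moreover have "?t \<circ> g \<circ> inv' g = ?t" using g by (auto simp: fun_eq_iff)
      ultimately show False using False ab by auto
    qed
    ultimately have "card (H \<union> (\<lambda>h. ?t \<circ> h) ` H) = 2 * card H"
      using finite_group by (simp add: card_Un_disjoint)
    then show "card (H \<union> (\<lambda>h. ?t \<circ> h) ` H) = card {p. p permutes \<Omega>}"
      using card card_mono[OF _ sub] finite_points by (simp add: finite_permutations card_permutations)
  qed
  have "p \<in> H \<longleftrightarrow> evenperm p" if "p permutes \<Omega>" for p
    using that finite_points
  proof (induction rule: permutes_induct)
    case id then show ?case by (simp only: id_mem evenperm_id)
  next
    case (swap a b p)
    have "transpose a b \<circ> p \<in> H \<longleftrightarrow> p \<notin> H"
    proof
      assume A: "transpose a b \<circ> p \<in> H"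
      show "p \<notin> H"
      proof
        assume p: "p \<in> H"
        have "transpose a b \<circ> p \<circ> inv' p = transpose a b" using p by (auto simp: fun_eq_iff)
        then show False using False swap A comp_mem[OF A inv_mem[OF p]] by auto
      qed
    next
      assume "p \<notin> H"
      then obtain g where "g \<in> H" "p = transpose a b \<circ> g" using coset[of a b] swap by blast
      then show "transpose a b \<circ> p \<in> H"
        by (metis comp_assoc id_comp transpose_comp_involutory)
    qed
    moreover have "evenperm (transpose a b \<circ> p) \<longleftrightarrow> \<not> evenperm p"
    proof -
      have "permutation p" using swap finite_points permutation_permutes by blast
      then show ?thesis using swap(3) by (simp add: evenperm_comp permutation_swap_id evenperm_swap)
    qed
    ultimately show ?case using swap by blast
  qed
  then show ?thesis using odd permutes by blast
qed

lemma commutator_three_cycle: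
  assumes g: "g \<in> H" and h: "h \<in> H" and d: "moved g \<inter> moved h = {d}"
  obtains k where "k \<in> H" "k ^^ 3 = id" "card (moved k) = 3"
proof -
  \<comment> \<open>The commutator is the 3-cycle h d -> d -> g d -> h d. Every point other than
    \<open>d\<close> is fixed by \<open>g\<close> or by \<open>h\<close>; in particular
    \<open>h\<close> fixes \<open>g d\<close> and \<open>g\<close> fixes \<open>h d\<close>.\<close>
  define k where "k = g \<circ> (h \<circ> (inv' g \<circ> inv' h))"
  have only: "g x = x \<or> h x = x" if "x \<noteq> d" for x using d that by (auto simp: moved_def)
  have gd: "g d \<noteq> d" and hd: "h d \<noteq> d" using d by (auto simp: moved_def)
  have ginj: "g x = g y \<longleftrightarrow> x = y" and hinj: "h x = h y \<longleftrightarrow> x = y" for x y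
    using inj_mem g h by (auto dest: injD)
  have hgd: "h (g d) = g d" using only[OF gd] ginj gd by auto
  have ghd: "g (h d) = h d" using only[OF hd] hinj hd by auto
  have neq: "g d \<noteq> h d" using hgd hinj hd gd by metis
  have k1: "k (h d) = d"
  proof -
    have "h (inv' g d) = inv' g d"
      using only[of "inv' g d"] g gd by (metis inv_apply(1,2))
    then show ?thesis using g h by (simp add: k_def)
  qed
  have k2: "k d = g d"
  proof -
    have "inv' g (inv' h d) = inv' h d"
      using only[of "inv' h d"] g h hd by (metis inv_apply(1,2))
    then show ?thesis using g h by (simp add: k_def)
  qed
  have k3: "k (g d) = h d"
  proof -
    have "inv' h (g d) = g d" using hgd h by (metis inv_apply(1))
    then show ?thesis using g h ghd by (simp add: k_def)
  qed
  have kx: "k x = x" if x: "x \<noteq> d" "x \<noteq> g d" "x \<noteq> h d" for x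
  proof -
    define y where "y = inv' h x"
    have y: "x = h y" using h by (simp add: y_def)
    have yd: "y \<noteq> d" using x y by blast
    show ?thesis
    proof (cases "h y = y")
      case True
      define z where "z = inv' g y"
      have z: "y = g z" using g by (simp add: z_def)
      have "z \<noteq> d" using x y True z by auto
      then have "h z = z" using only[of z] z True by auto
      then have "inv' h y = y" "inv' g y = z" using z True g h inv_apply(1) by metis+
      then show ?thesis using True y z \<open>h z = z\<close> by (simp add: k_def)
    next
      case False
      then have gy: "g y = y" using only yd by blast
      have "g x = x" using only[OF x(1)] False y hinj by auto
      then show ?thesis using y gy g h unfolding k_def by (metis comp_apply inv_apply(1))
    qed
  qed
  have "k \<in> H" unfolding k_def using g h by (intro comp_mem inv_mem)
  moreover have "k ^^ 3 = id"
  proof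
    fix x show "(k ^^ 3) x = id x"
      using k1 k2 k3 kx[of x] by (cases "x = d \<or> x = g d \<or> x = h d") (auto simp: numeral_3_eq_3)
  qed
  moreover have "moved k = {d, g d, h d}"
    using k1 k2 k3 kx gd hd neq by (auto simp: moved_def)
  ultimately show ?thesis using that gd hd neq by auto
qed

text \<open>Bochert's argument: two elements whose supports lie in a minimal base and its complement
  and meet in one point have a 3-cycle as commutator.\<close>

lemma card_le_if_no_three_cycle:
  assumes card: "card \<Omega> = 9"
    and no3: "\<And>k. k \<in> H \<Longrightarrow> k ^^ 3 = id \<Longrightarrow> card (moved k) \<noteq> 3"
  shows "card H \<le> 3024"
proof -
  define base where "base D \<longleftrightarrow> D \<subseteq> \<Omega> \<and> (\<forall>h\<in>H. moved h \<inter> D = {} \<longrightarrow> h = id)" for D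
  have "base \<Omega>"
    unfolding base_def using moved_subset by (auto simp: moved_def fun_eq_iff)
  then obtain D where D: "base D" and least: "\<And>E. base E \<Longrightarrow> card D \<le> card E"
    using ex_has_least_nat[of base \<Omega> card] by blast
  have finD: "finite D" using D finite_points finite_subset by (auto simp: base_def)
  have "card D \<le> 4"
  proof (rule ccontr)
    assume big: "\<not> card D \<le> 4"
    \<comment> \<open>With more than half of the points in \<open>D\<close>, neither its complement
      nor \<open>D - {d}\<close> can be a base. This yields \<open>g\<close> supported in
      \<open>D\<close>, and \<open>h\<close> whose support meets \<open>D\<close> in
      \<open>d\<close> only.\<close>
    have "card (\<Omega> - D) < card D"
      using big D card finD by (simp add: base_def card_Diff_subset)
    then have "\<not> base (\<Omega> - D)" using least by force
    then obtain g where g: "g \<in> H" "moved g \<inter> (\<Omega> - D) = {}" "g \<noteq> id" by (auto simp: base_def)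
    obtain d where d: "d \<in> moved g" using g(3) by (auto simp: moved_def fun_eq_iff)
    then have dD: "d \<in> D" using g moved_subset by blast
    have "card (D - {d}) < card D" using dD finD by (meson card_Diff1_less)
    then have "\<not> base (D - {d})" using least by force
    then obtain h where h: "h \<in> H" "moved h \<inter> (D - {d}) = {}" "h \<noteq> id" using D by (auto simp: base_def)
    have "d \<in> moved h" using D h by (auto simp: base_def)
    then have "moved g \<inter> moved h = {d}" using d g h moved_subset by blast
    then show False using commutator_three_cycle[OF g(1) h(1)] no3 by metis
  qed
  \<comment> \<open>A base of exactly four points turns group elements into lists of 4 distinct
    points, of which there are 9 * 8 * 7 * 6 = 3024.\<close>
  then obtain E where E: "D \<subseteq> E" "E \<subseteq> \<Omega>" "card E = 4"
    using exists_subset_between[of D 4 \<Omega>] D card finite_points by (auto simp: base_def)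
  obtain es where es: "distinct es" "set es = E" using finite_distinct_list E finite_points finite_subset by metis
  have len: "length es = 4" using es E distinct_card by metis
  have "inj_on (\<lambda>h. map h es) H"
  proof (rule inj_onI)
    fix g h assume gh: "g \<in> H" "h \<in> H" "map g es = map h es"
    have "moved (inv' h \<circ> g) \<inter> D = {}"
      using gh E es by (auto simp: moved_def inv_eq_iff)
    then have "inv' h \<circ> g = id" using D gh by (simp add: base_def comp_mem inv_mem)
    then show "g = h" using gh by (metis comp_apply id_apply inv_apply(2) ext)
  qed
  moreover have "(\<lambda>h. map h es) ` H \<subseteq> {xs. length xs = 4 \<and> distinct xs \<and> set xs \<subseteq> \<Omega>}"
  proof (clarify, intro conjI)
    fix h assume h: "h \<in> H"
    show "length (map h es) = 4" using len by simp
    show "distinct (map h es)"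
      using es inj_on_subset[OF inj_mem[OF h] subset_UNIV] by (simp add: distinct_map)
    show "set (map h es) \<subseteq> \<Omega>" using es E apply_mem[OF h] by auto
  qed
  moreover have "finite {xs. length xs = 4 \<and> distinct xs \<and> set xs \<subseteq> \<Omega>}"
    by (rule finite_subset[OF _ finite_lists_length_eq[OF finite_points, of 4]]) auto
  ultimately have "card H \<le> card {xs. length xs = 4 \<and> distinct xs \<and> set xs \<subseteq> \<Omega>}"
    by (rule card_inj_on_le)
  also have "\<dots> = \<Prod>{6..9}" using card_lists_distinct_length_eq[OF finite_points, of 4] card by simp
  also have "\<dots> = 3024" by (simp add: numeral_eq_Suc prod.atLeast_Suc_atMost)
  finally show ?thesis .
qed

end

section \<open>Primitive groups of degree 9 with odd elements\<close>

lemma card_sym_diff: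
  assumes "finite A" "finite B"
  shows "card ((A - B) \<union> (B - A)) + 2 * card (A \<inter> B) = card A + card B"
proof -
  have "card ((A - B) \<union> (B - A)) = card (A - B) + card (B - A)"
    using assms by (intro card_Un_disjoint) auto
  moreover have "card A = card (A \<inter> B) + card (A - B)" "card B = card (A \<inter> B) + card (B - A)"
    using card_Int_Diff[OF assms(1), of B] card_Int_Diff[OF assms(2), of A] by (simp_all add: Int_commute)
  ultimately show ?thesis by simp
qed

lemma prime_three: "prime (3::nat)"
proof (rule prime_nat_iff[THEN iffD2], intro conjI allI impI)
  fix m :: nat assume m: "m dvd 3"
  then have "m \<le> 3" by (simp add: dvd_imp_le)
  then have "m \<in> {0, 1, 2, 3}" by auto
  then show "m = 1 \<or> m = 3" using m by auto
qed simp

lemma prime_five: "prime (5::nat)"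
proof (rule prime_nat_iff[THEN iffD2], intro conjI allI impI)
  fix m :: nat assume m: "m dvd 5"
  then have "m \<le> 5" by (simp add: dvd_imp_le)
  then have "m \<in> {0, 1, 2, 3, 4, 5}" by auto
  then show "m = 1 \<or> m = 5" using m by auto
qed simp

lemma prime_seven: "prime (7::nat)"
proof (rule prime_nat_iff[THEN iffD2], intro conjI allI impI)
  fix m :: nat assume m: "m dvd 7"
  then have "m \<le> 7" by (simp add: dvd_imp_le)
  then have "m \<in> {0, 1, 2, 3, 4, 5, 6, 7}" by auto
  then show "m = 1 \<or> m = 7" using m by auto
qed simp

text \<open>For an involution \<open>d\<close> the relation \<open>y d y = d\<close> says that
  \<open>d\<close> inverts \<open>y\<close>, as either factor of a product \<open>y\<close> of two
  involutions does; this form avoids inverses.\<close>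

lemma dihedral_funpow:
  assumes "\<And>x. y (d (y x)) = d x"
  shows "(y ^^ m) (d ((y ^^ m) x)) = d x"
proof (induction m arbitrary: x)
  case (Suc m)
  have "(y ^^ Suc m) (d ((y ^^ Suc m) x)) = (y ^^ m) (y (d (y ((y ^^ m) x))))"
    by (simp add: funpow_swap1)
  then show ?case using assms Suc by simp
qed simp

locale primitive_nine = perm_group +
  assumes card_nine: "card \<Omega> = 9"
    and primitive: "primitive_on \<Omega>"
    and odd: "\<exists>h\<in>H. \<not> evenperm h"
    and proper: "H \<noteq> {p. p permutes \<Omega>}"
begin

lemma card_small: "2 * card H < fact 9"
  using index_two_odd_imp_all[OF primitive] odd proper card_nine by (metis not_le)

lemma no_three_cycle: "k \<in> H \<Longrightarrow> k ^^ 3 = id \<Longrightarrow> card (moved k) \<noteq> 3"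
  using prime_cycle_card[OF primitive, of k 3] card_small card_nine prime_three
  by (auto simp: fact_numeral)

lemma card_le: "card H \<le> 3024"
  using card_le_if_no_three_cycle[OF card_nine no_three_cycle] by blast

text \<open>A cycle of length 2, 3 or 5 would give
  \<open>fact 9 \<le> card H * fact 4 \<le> 72576\<close> by
  \<open>prime_cycle_card\<close>.\<close>

lemma no_short_cycle:
  assumes "k \<in> H" "k ^^ p = id" "prime p" "card (moved k) = p" shows "7 \<le> p"
proof (rule ccontr)
  assume "\<not> 7 \<le> p"
  then have "p \<le> 6" by simp
  then have "p - 1 \<le> 4 \<or> p = 6" by linarith
  moreover have "p \<noteq> 6" using assms(3) prime_nat_not_dvd[of 6 2] by auto
  ultimately have "fact (p - 1) \<le> (fact 4 :: nat)" by (intro fact_mono_nat) auto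
  then have "card H * fact (p - 1) \<le> 3024 * fact 4" using card_le by (intro mult_le_mono)
  then show False using prime_cycle_card[OF primitive assms] card_nine by (simp add: fact_numeral)
qed

text \<open>The number of moved points is a positive multiple of \<open>q\<close> other than
  \<open>q\<close> itself, and up to 5 only 4 = 2 * 2 qualifies.\<close>

lemma small_prime_order:
  assumes "z \<in> H" "z ^^ q = id" "prime q" "z \<noteq> id" "card (moved z) \<le> 5"
  shows "q = 2 \<and> card (moved z) = 4"
proof -
  have dvd: "q dvd card (moved z)"
    by (rule prime_order_dvd_moved[OF assms(2,3) inj_mem[OF assms(1)] finite_moved[OF assms(1)]])
  have pos: "card (moved z) > 0"
    using assms(4) finite_moved[OF assms(1)] by (auto simp: card_gt_0_iff moved_def fun_eq_iff)
  have ne: "card (moved z) \<noteq> q"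
    using no_short_cycle[OF assms(1-3)] assms(5) by auto
  obtain k where k: "card (moved z) = q * k" using dvd by blast
  have "k \<noteq> 0" "k \<noteq> 1" using k pos ne by auto
  then have "k \<ge> 2" by simp
  have q2: "q \<ge> 2" using assms(3) prime_ge_2_nat by blast
  have "q * 2 \<le> q * k" using \<open>k \<ge> 2\<close> by (rule mult_le_mono2)
  then have "q = 2" using k assms(5) q2 by linarith
  then show ?thesis using k assms(5) \<open>k \<ge> 2\<close> by auto
qed

lemma mem_permutation: "h \<in> H \<Longrightarrow> permutation h"
  using permutes finite_points permutation_permutes by blast

lemma prime_power_mem:
  assumes "h \<in> H" "h \<noteq> id"
  obtains m q where "prime q" "h ^^ m \<in> H" "(h ^^ m) ^^ q = id" "h ^^ m \<noteq> id" "moved (h ^^ m) \<subseteq> moved h"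
proof -
  obtain m q where "prime q" "(h ^^ m) ^^ q = id" "h ^^ m \<noteq> id"
    using prime_order_power[OF mem_permutation[OF assms(1)] assms(2)] by blast
  moreover have "moved (h ^^ m) \<subseteq> moved h" using funpow_fixed[of h] by (auto simp: moved_def)
  ultimately show ?thesis using that funpow_mem[OF assms(1)] by blast
qed

section \<open>Excluding double transpositions by a binary code\<close>

definition doubles :: "('a \<Rightarrow> 'a) set" where
  "doubles = {h \<in> H. h ^^ 2 = id \<and> card (moved h) = 4}"

text \<open>One common point gives a 3-cycle as commutator. With three common points,
  \<open>d\<close> and \<open>e\<close> act on five points, and a power of
  \<open>d \<circ> e\<close> of prime order moves four of them. As \<open>d\<close> and
  \<open>e\<close> preserve its fixed points, both would fix the fifth point, which lies in one of
  the supports.\<close>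

lemma doubles_meet_evenly:
  assumes d: "d \<in> doubles" and e: "e \<in> doubles"
  shows "even (card (moved d \<inter> moved e))"
proof (rule ccontr)
  assume odd: "odd (card (moved d \<inter> moved e))"
  have dH: "d \<in> H" "card (moved d) = 4" and eH: "e \<in> H" "card (moved e) = 4"
    using d e by (auto simp: doubles_def)
  have dd: "d (d x) = x" and ee: "e (e x) = x" for x
    using d e by (auto simp: doubles_def numeral_2_eq_2 fun_eq_iff)
  have fin: "finite (moved d)" "finite (moved e)" using finite_moved dH eH by auto
  have "card (moved d \<inter> moved e) \<le> 4" using card_mono[OF fin(1), of "moved d \<inter> moved e"] dH by auto
  then have "card (moved d \<inter> moved e) = 1 \<or> card (moved d \<inter> moved e) = 3"
  proof -
    have "n \<le> 4 \<Longrightarrow> odd n \<Longrightarrow> n = 1 \<or> n = 3" for n :: nat by presburger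
    then show ?thesis using \<open>card (moved d \<inter> moved e) \<le> 4\<close> odd by blast
  qed
  then consider "card (moved d \<inter> moved e) = 1" | "card (moved d \<inter> moved e) = 3" by blast
  then show False
  proof cases
    case 1
    then obtain x where "moved d \<inter> moved e = {x}" by (auto simp: card_1_singleton_iff)
    then show False using commutator_three_cycle[OF dH(1) eH(1)] no_three_cycle by metis
  next
    case 2
    have U: "card (moved d \<union> moved e) = 5" using card_Un_Int[OF fin] 2 dH eH by simp
    define y where "y = d \<circ> e"
    have "y \<noteq> id"
    proof
      assume "y = id"
      then have "d x = e x" for x using dd ee by (metis y_def comp_apply id_apply)
      then have "d = e" by blast
      then show False using 2 dH by simp
    qed
    moreover have yH: "y \<in> H" unfolding y_def using dH eH comp_mem by blast
    ultimately obtain m q where z: "prime q" "y ^^ m \<in> H" "(y ^^ m) ^^ q = id" "y ^^ m \<noteq> id" "moved (y ^^ m) \<subseteq> moved y"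
      using prime_power_mem by blast
    define z where "z = y ^^ m"
    have sub: "moved z \<subseteq> moved d \<union> moved e" using z(5) by (auto simp: z_def y_def moved_def)
    then have "card (moved z) \<le> 5" using U fin by (metis card_mono finite_UnI)
    then have "card (moved z) = 4" using small_prime_order[OF z(2,3,1,4)] by (simp add: z_def)
    then have "card (moved d \<union> moved e - moved z) = 1"
      using U sub card_Diff_subset[of "moved z" "moved d \<union> moved e"] finite_subset[OF sub] fin by simp
    then obtain w where w: "moved d \<union> moved e - moved z = {w}" by (auto simp: card_1_singleton_iff)
    have zw: "z w = w" using w by (auto simp: moved_def)
    have "z (d (z x)) = d x" "z (e (z x)) = e x" for x
      unfolding z_def by (intro dihedral_funpow; simp add: y_def dd ee)+
    from this[of w] have "d w \<notin> moved z" "e w \<notin> moved z" using zw by (auto simp: moved_def)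
    moreover have "d w = w \<or> d w \<in> moved d" "e w = w \<or> e w \<in> moved e" using dd ee by (auto simp: moved_def)
    ultimately have "d w = w" "e w = w" using w by blast+
    then show False using w by (auto simp: moved_def)
  qed
qed

inductive_set code :: "'a set set" where
  empty: "{} \<in> code"
| step: "B \<in> code \<Longrightarrow> d \<in> doubles \<Longrightarrow> (moved d - B) \<union> (B - moved d) \<in> code"

lemma code_subset: "B \<in> code \<Longrightarrow> B \<subseteq> \<Omega>"
  by (induction rule: code.induct) (use moved_subset in \<open>auto simp: doubles_def\<close>)

lemma code_finite: "B \<in> code \<Longrightarrow> finite B"
  using code_subset finite_points finite_subset by blast

lemma code_even:
  assumes "B \<in> code" "d \<in> doubles" shows "even (card (moved d \<inter> B))"
  using assms(1)
proof (induction rule: code.induct)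
  case (step B e)
  have "finite (moved d)" "finite (moved e)" using assms(2) step finite_moved by (auto simp: doubles_def)
  then have "card ((moved d \<inter> moved e - moved d \<inter> B) \<union> (moved d \<inter> B - moved d \<inter> moved e)) +
      2 * card ((moved d \<inter> moved e) \<inter> (moved d \<inter> B)) = card (moved d \<inter> moved e) + card (moved d \<inter> B)"
    by (intro card_sym_diff) auto
  moreover have "(moved d \<inter> moved e - moved d \<inter> B) \<union> (moved d \<inter> B - moved d \<inter> moved e) =
      moved d \<inter> (moved e - B \<union> (B - moved e))" by blast
  ultimately have "card (moved d \<inter> (moved e - B \<union> (B - moved e))) + 2 * card ((moved d \<inter> moved e) \<inter> (moved d \<inter> B))
      = card (moved d \<inter> moved e) + card (moved d \<inter> B)" by simp
  moreover have "even (card (moved d \<inter> moved e) + card (moved d \<inter> B))"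
    using step doubles_meet_evenly[OF assms(2)] by simp
  ultimately show ?case by (metis even_add even_mult_iff even_numeral)
qed simp

text \<open>Adding a generator of weight 4 that meets the word in 2k points changes the weight by 4
  - 4k.\<close>

lemma code_doubly_even: "B \<in> code \<Longrightarrow> 4 dvd card B"
proof (induction rule: code.induct)
  case (step B e)
  have fin: "finite (moved e)" "card (moved e) = 4" using step finite_moved by (auto simp: doubles_def)
  obtain k where k: "card (moved e \<inter> B) = 2 * k" using code_even step by blast
  have "card (moved e - B \<union> (B - moved e)) + 4 * k = 4 + card B"
    using card_sym_diff[OF fin(1) code_finite[OF step(1)]] fin(2) k by simp
  then show ?case using step.IH by presburger
qed simp

lemma code_sym_diff: "B \<in> code \<Longrightarrow> C \<in> code \<Longrightarrow> (B - C) \<union> (C - B) \<in> code"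
proof (induction rule: code.induct)
  case (step B d)
  have "(moved d - ((B - C) \<union> (C - B))) \<union> (((B - C) \<union> (C - B)) - moved d) \<in> code"
    using step by (intro code.step) auto
  moreover have "(moved d - ((B - C) \<union> (C - B))) \<union> (((B - C) \<union> (C - B)) - moved d) =
     ((moved d - B \<union> (B - moved d)) - C) \<union> (C - (moved d - B \<union> (B - moved d)))" by blast
  ultimately show ?case by simp
qed simp

text \<open>By transitivity, conjugation carries the support of a double transposition over any
  given point.\<close>

lemma doubles_cover:
  assumes "doubles \<noteq> {}" "x \<in> \<Omega>" obtains A where "A \<in> code" "x \<in> A"
proof -
  obtain d where d: "d \<in> doubles" using assms by blast
  then have dH: "d \<in> H" "d ^^ 2 = id" "card (moved d) = 4" by (auto simp: doubles_def)
  then have "moved d \<noteq> {}" by auto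
  then obtain a where a: "a \<in> moved d" by blast
  then have "a \<in> \<Omega>" using moved_subset dH by blast
  then obtain h where h: "h \<in> H" "h a = x"
    using primitive_onD(1)[OF primitive _ assms(2)] supported_all by blast
  define e where "e = h \<circ> d \<circ> inv' h"
  have mov: "moved e = h ` moved d"
  proof (rule Set.set_eqI)
    fix y
    have "y \<in> moved e \<longleftrightarrow> d (inv' h y) \<noteq> inv' h y"
      using inv_eq_iff[OF h(1), of y "d (inv' h y)"] by (auto simp: e_def moved_def)
    also have "\<dots> \<longleftrightarrow> h (inv' h y) \<in> h ` moved d"
      by (simp only: mem_image_iff[OF h(1)] moved_iff)
    finally show "y \<in> moved e \<longleftrightarrow> y \<in> h ` moved d" by (simp only: inv_apply(2)[OF h(1)])
  qed
  have "e \<in> doubles"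
    unfolding doubles_def
  proof (intro CollectI conjI)
    show "e \<in> H" unfolding e_def using h dH by (intro comp_mem inv_mem)
    show "card (moved e) = 4" using mov card_image_mem[OF h(1)] dH by simp
    show "e ^^ 2 = id" using dH h by (auto simp: e_def numeral_2_eq_2 fun_eq_iff)
  qed
  then have "moved e \<in> code" using code.step[OF code.empty, of e] by simp
  then show ?thesis using that mov a h by blast
qed

text \<open>The supports of double transpositions generate a doubly even binary code of length 9.
  Every coordinate is nonconstant, so the average weight is \<open>9/2\<close>; but all weights are 0, 4 or 8,
  and two words of weight 8 would differ by a word of weight 2.\<close>

lemma no_doubles: "doubles = {}"
proof (rule ccontr)
  assume ne: "doubles \<noteq> {}"
  have fin: "finite code"
    by (rule finite_subset[of _ "Pow \<Omega>"]) (use code_subset finite_points in auto)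
  have half: "2 * card {B \<in> code. x \<in> B} = card code" if x: "x \<in> \<Omega>" for x
  proof -
    obtain A where A: "A \<in> code" "x \<in> A" using doubles_cover[OF ne x] .
    \<comment> \<open>Adding a word that contains \<open>x\<close> exchanges the words with and
      without \<open>x\<close>.\<close>
    have "bij_betw (\<lambda>B. (B - A) \<union> (A - B)) {B \<in> code. x \<in> B} {B \<in> code. x \<notin> B}"
      by (rule bij_betwI[where g = "\<lambda>B. (B - A) \<union> (A - B)"]) (use A code_sym_diff in auto)
    then have "card {B \<in> code. x \<in> B} = card {B \<in> code. x \<notin> B}" by (rule bij_betw_same_card)
    moreover have "card code = card {B \<in> code. x \<in> B} + card {B \<in> code. x \<notin> B}"
      using fin by (subst card_Un_disjoint[symmetric]) (auto intro: arg_cong[of _ _ card])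
    ultimately show ?thesis by simp
  qed
  have "(\<Sum>B\<in>code. card B) = (\<Sum>B\<in>code. \<Sum>x\<in>\<Omega>. if x \<in> B then 1 else 0)"
    using code_subset finite_points by (intro sum.cong refl) (simp add: sum.If_cases Int_absorb1)
  also have "\<dots> = (\<Sum>x\<in>\<Omega>. card {B \<in> code. x \<in> B})"
    using fin by (subst sum.swap) (simp add: sum.If_cases Int_def)
  finally have "2 * (\<Sum>B\<in>code. card B) = (\<Sum>x\<in>\<Omega>. 2 * card {B \<in> code. x \<in> B})"
    by (simp add: sum_distrib_left)
  then have total: "2 * (\<Sum>B\<in>code. card B) = 9 * card code"
    using half card_nine by simp
  have weight: "card B = 0 \<or> card B = 4 \<or> card B = 8" if "B \<in> code" for B
  proof -
    have "card B \<le> 9" using card_mono[OF finite_points code_subset[OF that]] card_nine by simp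
    then show ?thesis using code_doubly_even[OF that] by presburger
  qed
  have small: "(\<Sum>B\<in>X. card B) \<le> 4 * card X" if "X \<subseteq> code" "\<And>B. B \<in> X \<Longrightarrow> card B \<noteq> 8" for X
    using that weight sum_bounded_above[of X card 4] by fastforce
  have pos: "card code > 0" using fin code.empty by (auto simp: card_gt_0_iff)
  show False
  proof (cases "\<exists>B\<in>code. card B = 8")
    case False
    then show False using small[of code] total pos by auto
  next
    case True
    then obtain B where B: "B \<in> code" "card B = 8" by blast
    have uniq: "C = B" if C: "C \<in> code" "card C = 8" for C
    proof (rule ccontr)
      assume "C \<noteq> B"
      have "card ((B - C) \<union> (C - B)) + 2 * card (B \<inter> C) = 16"
        using card_sym_diff[OF code_finite[OF B(1)] code_finite[OF C(1)]] B C by simp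
      moreover have "card (B \<union> C) \<le> 9"
        using card_mono[OF finite_points, of "B \<union> C"] code_subset B C card_nine by auto
      moreover have "card (B \<union> C) + card (B \<inter> C) = 16"
        using card_Un_Int[OF code_finite[OF B(1)] code_finite[OF C(1)]] B C by simp
      moreover have "card ((B - C) \<union> (C - B)) \<noteq> 0"
        using \<open>C \<noteq> B\<close> code_finite B C by (auto simp: card_eq_0_iff)
      moreover have "4 dvd card ((B - C) \<union> (C - B))"
        using code_doubly_even[OF code_sym_diff[OF B(1) C(1)]] .
      ultimately show False by presburger
    qed
    define X where "X = code - {{}} - {B}"
    have "B \<noteq> {}" using B by auto
    have X: "code = insert {} (insert B X)" "{} \<notin> insert B X" "B \<notin> X" "finite X"
      using B code.empty fin \<open>B \<noteq> {}\<close> by (auto simp: X_def)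
    \<comment> \<open>The empty word and the only word of weight 8 average to 4, so the mean weight
      is still at most 4, less than 9/2.\<close>
    have "(\<Sum>B\<in>code. card B) = 8 + (\<Sum>B\<in>X. card B)" using X B by simp
    moreover have "(\<Sum>B\<in>X. card B) \<le> 4 * card X" using uniq X by (intro small) auto
    moreover have "card code = card X + 2" using X by simp
    ultimately show False using total by simp
  qed
qed

text \<open>An element moving at most 5 points would have a double transposition among its
  powers.\<close>

lemma moved_ge_six: 
  assumes "h \<in> H" "h \<noteq> id" shows "6 \<le> card (moved h)"
proof (rule ccontr)
  assume A: "\<not> 6 \<le> card (moved h)"
  obtain m q where z: "prime q" "h ^^ m \<in> H" "(h ^^ m) ^^ q = id" "h ^^ m \<noteq> id" "moved (h ^^ m) \<subseteq> moved h"
    using prime_power_mem[OF assms] .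
  have "card (moved (h ^^ m)) \<le> card (moved h)" using card_mono[OF finite_moved[OF assms(1)] z(5)] .
  then have "q = 2 \<and> card (moved (h ^^ m)) = 4" using A by (intro small_prime_order[OF z(2,3,1,4)]) simp
  then have "h ^^ m \<in> doubles" using z by (simp add: doubles_def)
  then show False using no_doubles by simp
qed

lemma id_if_fixes_four:
  assumes "h \<in> H" "F \<subseteq> \<Omega>" "4 \<le> card F" "\<And>x. x \<in> F \<Longrightarrow> h x = x" shows "h = id"
proof (rule ccontr)
  assume "h \<noteq> id"
  have "card (moved h \<union> F) = card (moved h) + card F"
    using assms finite_moved finite_points finite_subset by (intro card_Un_disjoint) (auto simp: moved_def)
  moreover have "card (moved h \<union> F) \<le> 9"
    using card_mono[OF finite_points, of "moved h \<union> F"] assms moved_subset card_nine by auto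
  ultimately show False using moved_ge_six[OF assms(1) \<open>h \<noteq> id\<close>] assms(3) by simp
qed

end

section \<open>Swapping two points and normalising a cycle of prime length\<close>

context perm_group
begin

text \<open>By \<open>jordan_step\<close> the stabiliser of one of the two points, \<open>d\<close>,
  is transitive on the remaining points. An element carrying \<open>d\<close> to the other point
  \<open>c\<close> is therefore corrected, by an element fixing \<open>d\<close>, so that it also
  carries \<open>c\<close> to \<open>d\<close>.\<close>

lemma primitive_on_swap:
  assumes prim: "primitive_on \<Omega>" and "primitive_on (\<Omega> - {a, b})" and ab: "a \<in> \<Omega>" "b \<in> \<Omega>" "a \<noteq> b"
    and "4 \<le> card \<Omega>"
  obtains x where "x \<in> H" "x a = b" "x b = a"
proof -
  have "2 \<le> card (\<Omega> - {a, b})" using assms finite_points by (simp add: card_Diff_subset)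
  moreover have "\<Omega> - {a, b} \<subset> \<Omega>" using ab by blast
  ultimately obtain c where c: "c \<in> \<Omega> - (\<Omega> - {a, b})" "primitive_on (insert c (\<Omega> - {a, b}))"
    using jordan_step[OF prim assms(2)] by blast
  define d where "d = (if c = a then b else a)"
  have cd: "c \<noteq> d" "{c, d} = {a, b}" "c \<in> \<Omega>" "d \<in> \<Omega>" using c(1) ab by (auto simp: d_def)
  have eq: "insert c (\<Omega> - {a, b}) = \<Omega> - {d}" using cd by auto
  obtain h where h: "h \<in> H" "h d = c" using primitive_onD(1)[OF prim cd(4,3)] supported_all by blast
  have "inv' h d \<in> \<Omega> - {d}"
    using apply_mem[OF inv_mem[OF h(1)]] cd h by (auto simp: inv_eq_iff)
  then obtain k where k: "k \<in> supported (\<Omega> - {d})" "k c = inv' h d"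
    using primitive_onD(1)[OF c(2), of c "inv' h d"] unfolding eq using cd by auto
  have kH: "k \<in> H" "k d = d" using supported_mem supported_fix k(1) by auto
  have "h \<circ> k \<in> H" "(h \<circ> k) c = d" "(h \<circ> k) d = c"
    using h k kH comp_mem by auto
  moreover have "(c = a \<and> d = b) \<or> (c = b \<and> d = a)" using cd by (auto simp: doubleton_eq_iff)
  ultimately show ?thesis using that by blast
qed

text \<open>A group of order less than p^2 has room for only one subgroup of order \<open>p\<close>:
  otherwise the p^2 products of powers of \<open>z\<close> and of its conjugate \<open>y\<close>
  would be distinct. So \<open>y\<close> is a power of \<open>z\<close>.\<close>

lemma small_supported_normalises:
  assumes z: "z \<in> H" "z ^^ p = id" "prime p" "z \<noteq> id"
    and card: "card (supported (moved z)) < p * p"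
    and x: "x \<in> H" "x ` moved z = moved z"
  obtains e where "\<not> p dvd e" "\<And>u. x (z u) = (z ^^ e) (x u)"
proof -
  have p0: "p > 0" using z(3) prime_gt_0_nat by blast
  define y where "y = x \<circ> z \<circ> inv' x"
  have yH: "y \<in> H" unfolding y_def using x z by (intro comp_mem inv_mem)
  have ypow: "y ^^ n = x \<circ> (z ^^ n) \<circ> inv' x" for n
    by (induction n) (use x in \<open>auto simp: y_def fun_eq_iff\<close>)
  have yp: "y ^^ p = id" unfolding ypow z(2) using x by (auto simp: fun_eq_iff)
  have zS: "z \<in> supported (moved z)" using z(1) by (simp add: supported_iff)
  have "y \<in> supported (x ` moved z)" unfolding y_def by (rule supported_conj[OF x(1) zS])
  then have yS: "y \<in> supported (moved z)" using x(2) by simp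
  have powS: "g ^^ n \<in> supported (moved z)" if "g \<in> supported (moved z)" for g n
  proof (induction n)
    case 0 then show ?case using id_mem by (simp only: funpow.simps supported_iff) (simp add: moved_def)
  next
    case (Suc n) show ?case unfolding funpow.simps by (rule supported_comp[OF that Suc])
  qed
  have finS: "finite (supported (moved z))" using finite_group by (simp add: supported_def)
  let ?f = "\<lambda>(i, j). (z ^^ i) \<circ> (y ^^ j)"
  have "?f ` ({..<p} \<times> {..<p}) \<subseteq> supported (moved z)" using powS[OF zS] powS[OF yS] supported_comp by auto
  then have "\<not> inj_on ?f ({..<p} \<times> {..<p})"
    using card card_inj_on_le[of ?f "{..<p} \<times> {..<p}" "supported (moved z)"] finS by (auto simp: card_cartesian_product)
  then obtain i j i' j' where ij: "i < p" "j < p" "i' < p" "j' < p" "(i, j) \<noteq> (i', j')"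
      "(z ^^ i) \<circ> (y ^^ j) = (z ^^ i') \<circ> (y ^^ j')"
    unfolding inj_on_def by auto
  obtain a where a: "z a \<noteq> a" using z(4) by (auto simp: fun_eq_iff)
  have surj_y: "surj (y ^^ n)" for n
    using permutes[OF funpow_mem[OF yH]] permutes_surj by blast
  have "j \<noteq> j'"
  proof
    assume "j = j'"
    then have "z ^^ i = z ^^ i'" using ij(6) surj_y[of j] by (metis (no_types, lifting) comp_apply ext surjD)
    then have "i = i'" using funpow_inj_on_moved[OF z(2,3) inj_mem[OF z(1)] a] ij unfolding inj_on_def by auto
    then show False using \<open>j = j'\<close> ij by simp
  qed
  have main: "\<exists>m. y = z ^^ m"
    if A: "i < p" "j < j'" "j' < p" "i' < p" "(z ^^ i) \<circ> (y ^^ j) = (z ^^ i') \<circ> (y ^^ j')" for i j i' j'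
  proof -
    define r where "r = j' - j"
    have r: "r \<noteq> 0" "r < p" using A by (auto simp: r_def)
    have "y ^^ j' = (y ^^ r) \<circ> (y ^^ j)" using A by (simp add: r_def flip: funpow_add)
    then have "(z ^^ i) ((y ^^ j) u) = (z ^^ i') ((y ^^ r) ((y ^^ j) u))" for u using fun_cong[OF A(5), of u] by simp
    then have "(z ^^ i) u = (z ^^ i') ((y ^^ r) u)" for u using surj_y[of j] by (metis surjD)
    then have "(z ^^ (p - i')) ((z ^^ i) u) = (z ^^ (p - i')) ((z ^^ i') ((y ^^ r) u))" for u by simp
    moreover have "(z ^^ (p - i')) ((z ^^ i') v) = v" for v
    proof -
      have "(z ^^ (p - i')) ((z ^^ i') v) = (z ^^ (p - i' + i')) v" by (simp add: funpow_add)
      then show ?thesis using A z(2) by simp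
    qed
    ultimately have "(y ^^ r) u = (z ^^ (p - i' + i)) u" for u by (simp add: funpow_add)
    then have yr: "y ^^ r = z ^^ (p - i' + i)" by blast
    have "coprime r p"
      using r z(3) by (intro prime_imp_coprime_nat[THEN coprime_commute[THEN iffD1]]) (auto dest: dvd_imp_le)
    then obtain m where "(y ^^ r) ^^ m = y" using funpow_coprime_root[OF yp _ r(1)] by metis
    then show ?thesis unfolding yr funpow_mult by metis
  qed
  have "\<exists>m. y = z ^^ m"
  proof (cases "j < j'")
    case True then show ?thesis using main[of i j j' i'] ij by blast
  next
    case False then show ?thesis using main[of i' j' j i] ij \<open>j \<noteq> j'\<close> by simp
  qed
  then obtain m where m: "y = z ^^ m" by blast
  have "\<not> p dvd m"
  proof
    assume "p dvd m"
    then have "y = id" using m funpow_period_mult[OF z(2)] by (metis dvd_def)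
    then have "x (z (inv' x (x a))) = x a" by (simp add: y_def fun_eq_iff)
    then show False using a x inj_mem[OF x(1)] by (simp add: inj_eq)
  qed
  moreover have "x (z u) = (z ^^ m) (x u)" for u
    using x fun_cong[OF m, of "x u"] by (simp add: y_def)
  ultimately show ?thesis using that by blast
qed

end

context primitive_nine
begin

text \<open>Were \<open>c \<noteq> d\<close>, a power \<open>z\<close> of \<open>t \<circ> s\<close> would be a 7-cycle fixing \<open>a\<close> and \<open>b\<close>. Some element swaps
  \<open>a\<close> and \<open>b\<close> and normalises the group generated by \<open>z\<close>; its cube, times \<open>t\<close> if need be, centralises
  \<open>z\<close>, and the seventh power of that is the transposition of \<open>a\<close> and \<open>b\<close>.\<close>

lemma involution_fixed_points_eq:
  assumes t: "t \<in> H" "\<And>x. t (t x) = x" "{x \<in> \<Omega>. t x = x} = {a, b, c}"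
    and s: "s \<in> H" "\<And>x. s (s x) = x" "{x \<in> \<Omega>. s x = x} = {a, b, d}"
    and ab: "a \<noteq> b"
  shows "{a, b, c} = {a, b, d}"
proof (rule ccontr)
  assume neq: "{a, b, c} \<noteq> {a, b, d}"
  have tfix: "t x = x \<longleftrightarrow> x = a \<or> x = b \<or> x = c" and sfix: "s x = x \<longleftrightarrow> x = a \<or> x = b \<or> x = d" if "x \<in> \<Omega>" for x
    using t(3) s(3) that by blast+
  have pts: "a \<in> \<Omega>" "b \<in> \<Omega>" "c \<in> \<Omega>" "d \<in> \<Omega>" using t(3) s(3) by blast+
  have fixab: "t a = a" "t b = b" "s a = a" "s b = b" using tfix sfix pts by auto
  define y where "y = t \<circ> s"
  have yH: "y \<in> H" unfolding y_def using t s comp_mem by blast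
  have "y \<noteq> id"
  proof
    assume "y = id"
    then have "t x = s x" for x using t(2) s(2) by (metis y_def comp_apply id_apply)
    then show False using neq t(3) s(3) by simp
  qed
  then obtain m q where z: "prime q" "y ^^ m \<in> H" "(y ^^ m) ^^ q = id" "y ^^ m \<noteq> id" "moved (y ^^ m) \<subseteq> moved y"
    using prime_power_mem[OF yH] by metis
  define z where "z = y ^^ m"
  note z = z[folded z_def]
  have ztz: "z (t (z x)) = t x" and zsz: "z (s (z x)) = s x" for x
    unfolding z_def by (intro dihedral_funpow; simp add: y_def t s)+
  have zab: "z a = a" "z b = b" using z(5) fixab by (auto simp: moved_def y_def)
  \<comment> \<open>Every point other than \<open>a\<close> and \<open>b\<close> is moved by
    \<open>t\<close> or \<open>s\<close>, and both preserve the fixed points of \<open>z\<close>. A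
    third fixed point would thus bring a fourth, against \<open>id_if_fixes_four\<close>.\<close>
  have nofix: "z x \<noteq> x" if x: "x \<in> \<Omega> - {a, b}" for x
  proof
    assume zx: "z x = x"
    obtain r where r: "r = t \<or> r = s" "r x \<noteq> x"
      using tfix[of x] sfix[of x] x neq by auto
    have rr: "r (r x) = x" "r a = a" "r b = b" "r \<in> H" using r t s fixab by auto
    have "z (r x) = r x" using r(1) ztz[of x] zsz[of x] zx by auto
    moreover have "r x \<noteq> a" "r x \<noteq> b" using rr x by force+
    moreover have "r x \<in> \<Omega>" using apply_mem[OF rr(4)] x by simp
    ultimately have "z = id"
      using zx zab x ab r(2) pts by (intro id_if_fixes_four[OF z(2), of "{a, b, x, r x}"]) auto
    then show False using z by simp
  qed
  have moved: "moved z = \<Omega> - {a, b}" using nofix zab moved_subset[OF z(2)] by (auto simp: moved_def)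
  then have card7: "card (moved z) = 7" using pts ab finite_points card_nine by (simp add: card_Diff_subset)
  have "q dvd 7" using prime_order_dvd_moved[OF z(3,1) inj_mem[OF z(2)] finite_moved[OF z(2)]] card7 by simp
  then have q7: "q = 7" using z(1) prime_seven primes_dvd_imp_eq by blast
  have prim: "primitive_on (moved z)" using prime_cycle_primitive[OF z(2,3,1)] card7 q7 by simp
  \<comment> \<open>The order is at most 3024 * 7! / 9! = 42, which is below 7^2 = 49.\<close>
  have "card (supported (moved z)) * fact 9 \<le> card H * fact 7"
    using jordan_card[OF primitive prim moved_subset[OF z(2)]] card7 card_nine by simp
  also have "\<dots> \<le> 3024 * fact 7" using card_le by simp
  finally have small: "card (supported (moved z)) < 7 * 7" by (simp add: fact_numeral)
  obtain x where x: "x \<in> H" "x a = b" "x b = a"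
    using primitive_on_swap[OF primitive prim[unfolded moved] pts(1,2) ab] card_nine by auto
  have "x ` moved z = x ` \<Omega> - x ` {a, b}" unfolding moved by (rule image_set_diff[OF inj_mem[OF x(1)]])
  then have xim: "x ` moved z = moved z" using image_points[OF x(1)] x moved by (simp add: insert_commute)
  obtain e where e: "\<not> 7 dvd e" "\<And>u. x (z u) = (z ^^ e) (x u)"
    using small_supported_normalises[OF z(2,3,1,4) _ x(1) xim] small q7 by metis
  have xpow: "x ((z ^^ n) u) = (z ^^ (e * n)) (x u)" for n u
  proof (induction n)
    case (Suc n)
    have "x ((z ^^ Suc n) u) = (z ^^ e) (x ((z ^^ n) u))" using e by simp
    then show ?case using Suc by (simp add: funpow_add)
  qed simp
  have x3: "x (x (x (z u))) = (z ^^ (e * (e * e))) (x (x (x u)))" for u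
    by (simp add: e(2) xpow)
  have zmod: "z ^^ n = z ^^ (n mod 7)" for n using funpow_mod_period[OF z(3)] q7 by metis
  have tz: "t (z u) = (z ^^ 6) (t u)" for u
  proof -
    have "(z ^^ 6) (z (t (z u))) = (z ^^ 7) (t (z u))" by (simp add: numeral_eq_Suc funpow_swap1)
    then show ?thesis using ztz z(3) q7 by simp
  qed
  \<comment> \<open>The cube of a unit modulo 7 is 1 or -1, so the cube of \<open>x\<close>
    centralises or inverts \<open>z\<close>; in the second case it is corrected by \<open>t\<close>,
    which inverts \<open>z\<close> and fixes \<open>a\<close> and \<open>b\<close>.\<close>
  have "e mod 7 \<noteq> 0" using e(1) by (simp only: dvd_eq_mod_eq_0 not_False_eq_True)
  moreover have "e mod 7 < 7" by simp
  ultimately have "e mod 7 = 1 \<or> e mod 7 = 2 \<or> e mod 7 = 3 \<or> e mod 7 = 4 \<or> e mod 7 = 5 \<or> e mod 7 = 6" by arith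
  moreover have "e * (e * e) mod 7 = (e mod 7) * ((e mod 7) * (e mod 7)) mod 7"
    by (metis mod_mult_left_eq mod_mult_right_eq mod_mult_eq)
  ultimately have cube: "e * (e * e) mod 7 = 1 \<or> e * (e * e) mod 7 = 6" by auto
  obtain w where w: "w \<in> H" "w a = b" "w b = a" "\<And>u. w (z u) = z (w u)"
  proof (cases "e * (e * e) mod 7 = 1")
    case True
    show ?thesis
    proof (rule that[of "x \<circ> (x \<circ> x)"])
      show "x \<circ> (x \<circ> x) \<in> H" using x comp_mem by simp
      show "(x \<circ> (x \<circ> x)) (z u) = z ((x \<circ> (x \<circ> x)) u)" for u
        using x3[of u] zmod[of "e * (e * e)"] True by simp
    qed (use x in auto)
  next
    case False
    then have six: "e * (e * e) mod 7 = 6" using cube by simp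
    have "x (x (x ((z ^^ 6) u))) = z (x (x (x u)))" for u
    proof -
      have "x (x (x ((z ^^ 6) u))) = (z ^^ (e * (e * (e * 6)))) (x (x (x u)))" by (simp add: xpow)
      moreover have "e * (e * (e * 6)) mod 7 = 1"
        using six mod_mult_left_eq[of "e * (e * e)" 7 6] by (simp add: mult.assoc)
      ultimately show ?thesis using zmod[of "e * (e * (e * 6))"] by simp
    qed
    then show ?thesis
      using x t fixab tz by (intro that[of "x \<circ> (x \<circ> (x \<circ> t))"]) (auto intro!: comp_mem)
  qed
  have wpow: "w ((z ^^ n) u) = (z ^^ n) (w u)" for n u by (induction n) (simp_all add: w(4))
  obtain u where u: "u \<in> moved z" using card7 by fastforce
  have "w u \<in> \<Omega>" using u moved apply_mem[OF w(1)] by blast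
  moreover have "w u \<noteq> a" "w u \<noteq> b" using w(2,3) u moved inj_mem[OF w(1)] by (metis DiffE injD insertCI)+
  ultimately have wu: "w u \<in> moved z" using moved by blast
  have orbit: "\<exists>i. v = (z ^^ i) u" if "v \<in> moved z" for v
  proof -
    have "(\<lambda>i. (z ^^ i) u) ` {..<q} = moved z"
    proof (rule card_subset_eq[OF finite_moved[OF z(2)]])
      show "(\<lambda>i. (z ^^ i) u) ` {..<q} \<subseteq> moved z" using u funpow_moved[OF inj_mem[OF z(2)]] by (auto simp: moved_def)
      show "card ((\<lambda>i. (z ^^ i) u) ` {..<q}) = card (moved z)"
        using funpow_inj_on_moved[OF z(3,1) inj_mem[OF z(2)]] u card7 q7 by (simp add: card_image moved_def)
    qed
    then show ?thesis using that by blast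
  qed
  obtain k where k: "w u = (z ^^ k) u" using orbit[OF wu] by blast
  \<comment> \<open>A permutation of the points of the 7-cycle that commutes with it is one of its
    powers, so the seventh power of \<open>w\<close> is trivial there. As 7 is odd, it still swaps
    \<open>a\<close> and \<open>b\<close>.\<close>
  have wk: "w v = (z ^^ k) v" if v: "v \<in> moved z" for v
  proof -
    obtain i where i: "v = (z ^^ i) u" using orbit[OF v] by blast
    have "w v = (z ^^ i) ((z ^^ k) u)" using i wpow k by simp
    also have "\<dots> = (z ^^ k) ((z ^^ i) u)" by (metis add.commute comp_apply funpow_add)
    finally show ?thesis using i by simp
  qed
  have zin: "(z ^^ i) v \<in> moved z" if "v \<in> moved z" for i v
    using that funpow_moved[OF inj_mem[OF z(2)]] by (auto simp: moved_def)
  have wn: "(w ^^ n) v = (z ^^ (k * n)) v" if "v \<in> moved z" for n v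
  proof (induction n)
    case (Suc n) then show ?case using wk[OF zin[OF that]] by (simp add: funpow_add)
  qed simp
  have w7: "(w ^^ 7) v = v" if "v \<in> moved z" for v
    using wn[OF that, of 7] zmod[of "k * 7"] by simp
  have w7a: "(w ^^ 7) a = b" "(w ^^ 7) b = a" using w by (simp_all add: numeral_eq_Suc)
  have w7H: "w ^^ 7 \<in> H" using funpow_mem[OF w(1)] .
  have out: "(w ^^ 7) v = v" if "v \<notin> {a, b}" for v
    using w7 moved that moved_subset[OF w7H] by (cases "v \<in> \<Omega>") (auto simp: moved_def)
  have "moved (w ^^ 7) = {a, b}" using out w7a ab by (auto simp: moved_def)
  moreover have "(w ^^ 7) ^^ 2 = id"
  proof
    fix v
    have two: "(f ^^ 2) v = f (f v)" for f :: "'a \<Rightarrow> 'a" by (simp add: numeral_2_eq_2)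
    show "((w ^^ 7) ^^ 2) v = id v"
      unfolding two using out[of v] w7a by (cases "v = a \<or> v = b") auto
  qed
  ultimately show False using no_short_cycle[OF w7H, of 2] ab by simp
qed

end

section \<open>Permutations with two cycles\<close>

text \<open>For a labelling of nine points, an element of type (r, 9 - r); \<open>r = 0\<close>
  gives a 9-cycle and \<open>r = 1\<close> an 8-cycle. Elements are counted through labellings, so
  that every cycle type has the same total of 9!.\<close>

definition two_cycles :: "nat \<Rightarrow> 'a list \<Rightarrow> 'a \<Rightarrow> 'a" where
  "two_cycles r xs = cycle_of_list (take r xs) \<circ> cycle_of_list (drop r xs)"

lemma two_cycles_permutes: "two_cycles r xs permutes set xs"
  unfolding two_cycles_def
  by (intro permutes_compose permutes_subset[OF cycle_permutes]) (auto dest: in_set_takeD in_set_dropD)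

lemma cycle_of_list_nth:
  assumes "distinct cs" "i < length cs"
  shows "cycle_of_list cs (cs ! i) = cs ! (Suc i mod length cs)"
proof -
  have "map (cycle_of_list cs) cs ! i = rotate 1 cs ! i"
    using cyclic_rotation[OF assms(1), of 1] by simp
  then show ?thesis using assms by (simp add: nth_rotate1)
qed

text \<open>A closed form for all powers at once, which reduces facts about powers of
  \<open>two_cycles\<close> to arithmetic on nine positions.\<close>

definition two_cycles_index :: "nat \<Rightarrow> nat \<Rightarrow> nat \<Rightarrow> nat \<Rightarrow> nat" where
  "two_cycles_index r l n i = (if i < r then (i + n) mod r else r + (i - r + n) mod (l - r))"

lemma two_cycles_nth:
  assumes xs: "distinct xs" and "r \<le> length xs" "i < length xs"
  shows "two_cycles r xs (xs ! i) = xs ! two_cycles_index r (length xs) 1 i"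
proof (cases "i < r")
  case True
  have "xs ! i \<notin> set (drop r xs)"
    using xs assms True by (auto simp: in_set_conv_nth nth_eq_iff_index_eq)
  then have "two_cycles r xs (xs ! i) = cycle_of_list (take r xs) (take r xs ! i)"
    using True by (simp add: two_cycles_def id_outside_supp)
  also have "\<dots> = take r xs ! (Suc i mod r)"
    using cycle_of_list_nth[of "take r xs" i] xs assms True by simp
  finally show ?thesis using True by (simp add: two_cycles_index_def)
next
  case False
  then have i: "drop r xs ! (i - r) = xs ! i" using assms by simp
  have eq: "two_cycles r xs (xs ! i) = cycle_of_list (take r xs) (drop r xs ! (Suc (i - r) mod length (drop r xs)))"
    using cycle_of_list_nth[of "drop r xs" "i - r"] xs assms False i by (simp add: two_cycles_def)
  have "drop r xs ! (Suc (i - r) mod length (drop r xs)) \<in> set (drop r xs)"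
    using assms False by (intro nth_mem mod_less_divisor) simp
  moreover have "set (take r xs) \<inter> set (drop r xs) = {}"
    using xs by (rule set_take_disj_set_drop_if_distinct) simp
  ultimately have "cycle_of_list (take r xs) (drop r xs ! (Suc (i - r) mod length (drop r xs))) =
      drop r xs ! (Suc (i - r) mod length (drop r xs))"
    by (intro id_outside_supp) blast
  then show ?thesis
    using assms False eq by (simp add: two_cycles_index_def)
qed

lemma two_cycles_funpow_nth:
  assumes "distinct xs" "r \<le> length xs" "i < length xs"
  shows "(two_cycles r xs ^^ n) (xs ! i) = xs ! two_cycles_index r (length xs) n i"
proof (induction n)
  case 0 then show ?case using assms by (simp add: two_cycles_index_def)
next
  case (Suc n)
  have "two_cycles_index r (length xs) n i < length xs"
    using assms by (auto simp: two_cycles_index_def intro: less_le_trans[OF mod_less_divisor] )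
      (metis add.commute less_diff_conv mod_less_divisor zero_less_diff order_le_less_trans not_less)
  then have "(two_cycles r xs ^^ Suc n) (xs ! i) =
      xs ! two_cycles_index r (length xs) 1 (two_cycles_index r (length xs) n i)"
    using two_cycles_nth[OF assms(1,2)] Suc by simp
  also have "two_cycles_index r (length xs) 1 (two_cycles_index r (length xs) n i) =
      two_cycles_index r (length xs) (Suc n) i"
  proof (cases "i < r")
    case True
    then have "(i + n) mod r < r" by simp
    then show ?thesis using True by (simp add: two_cycles_index_def mod_Suc_eq)
  next
    case False
    then show ?thesis by (simp add: two_cycles_index_def mod_Suc_eq)
  qed
  finally show ?case .
qed

lemma two_cycles_funpow_outside: "x \<notin> set xs \<Longrightarrow> (two_cycles r xs ^^ n) x = x"
  by (rule funpow_fixed) (metis permutes_not_in two_cycles_permutes)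

lemma less_nine_iff: "i < (9::nat) \<longleftrightarrow> i \<in> {0,1,2,3,4,5,6,7,8}"
  by auto

lemma moved_two_cycles_funpow:
  assumes "distinct xs" "length xs = 9" "r \<le> 9"
  shows "moved (two_cycles r xs ^^ n) = (!) xs ` {i \<in> {..<9}. two_cycles_index r 9 n i \<noteq> i}"
proof (rule Set.set_eqI)
  fix x
  have lt: "two_cycles_index r 9 n i < 9" if "i < 9" for i
    using that assms(3) mod_less_divisor[of r "i + n"] mod_less_divisor[of "9 - r" "i - r + n"]
    by (auto simp: two_cycles_index_def simp del: mod_less_divisor)
  show "x \<in> moved (two_cycles r xs ^^ n) \<longleftrightarrow> x \<in> (!) xs ` {i \<in> {..<9}. two_cycles_index r 9 n i \<noteq> i}"
  proof (cases "x \<in> set xs")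
    case True
    then obtain i where i: "i < 9" "x = xs ! i" using assms by (metis in_set_conv_nth)
    have "(two_cycles r xs ^^ n) x = xs ! two_cycles_index r 9 n i"
      using two_cycles_funpow_nth[of xs r i n] assms i by simp
    then have "x \<in> moved (two_cycles r xs ^^ n) \<longleftrightarrow> two_cycles_index r 9 n i \<noteq> i"
      using lt[OF i(1)] assms i by (simp add: moved_def nth_eq_iff_index_eq)
    moreover have "x \<in> (!) xs ` {i \<in> {..<9}. two_cycles_index r 9 n i \<noteq> i} \<longleftrightarrow> two_cycles_index r 9 n i \<noteq> i"
      using assms i by (auto simp: nth_eq_iff_index_eq)
    ultimately show ?thesis by simp
  next
    case False
    then show ?thesis using assms two_cycles_funpow_outside[OF False] by (auto simp: moved_def)
  qed
qed

lemma card_moved_two_cycles_funpow: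
  assumes "distinct xs" "length xs = 9" "r \<le> 9"
  shows "card (moved (two_cycles r xs ^^ n)) = card {i \<in> {..<9}. two_cycles_index r 9 n i \<noteq> i}"
  unfolding moved_two_cycles_funpow[OF assms]
  using assms by (intro card_image inj_on_subset[OF inj_on_nth[of xs "{..<9}"]]) auto

lemma filter_lessThan_nine: "{i \<in> {..<9::nat}. P i} = set (filter P [0,1,2,3,4,5,6,7,8])"
proof -
  have "{..<9::nat} = set [0..<9]" by (rule lessThan_atLeast0[THEN trans]) simp
  also have "[0..<9] = [0,1,2,3,4,5,6,7,8]" by (simp add: upt_rec)
  finally show ?thesis by (simp only: set_filter)
qed

lemma two_cycles_funpow_id:
  assumes "distinct xs" "length xs = 9" "r \<le> 9" "\<forall>i\<in>set [0,1,2,3,4,5,6,7,8]. two_cycles_index r 9 n i = i"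
  shows "two_cycles r xs ^^ n = id"
proof -
  have "moved (two_cycles r xs ^^ n) = {}"
    unfolding moved_two_cycles_funpow[OF assms(1-3)] filter_lessThan_nine set_filter using assms(4) by blast
  then show ?thesis by (auto simp: moved_def)
qed

lemma card_off_diagonal:
  assumes "finite A" shows "card {(x, y). x \<in> A \<and> y \<in> A \<and> x \<noteq> y} = card A * (card A - 1)"
proof -
  have "{(x, y). x \<in> A \<and> y \<in> A \<and> x \<noteq> y} = (SIGMA x:A. A - {x})" by auto
  then show ?thesis using assms by (simp add: card_SigmaI)
qed

text \<open>Following the permutation from a known starting point in each cycle recovers the
  labelling. For \<open>r = 0\<close> there is only one cycle to start in.\<close>

lemma two_cycles_inj:
  assumes "distinct xs" "distinct ys" "length xs = 9" "length ys = 9" "r < 9"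
    and eq: "two_cycles r xs = two_cycles r ys" "r > 0 \<Longrightarrow> xs ! 0 = ys ! 0" "xs ! r = ys ! r"
  shows "xs = ys"
proof (rule nth_equalityI)
  fix i assume i: "i < length xs"
  show "xs ! i = ys ! i"
  proof (cases "i < r")
    case True
    have "xs ! i = (two_cycles r xs ^^ i) (xs ! 0)"
      using two_cycles_funpow_nth[of xs r 0 i] assms True by (simp add: two_cycles_index_def)
    also have "\<dots> = (two_cycles r ys ^^ i) (ys ! 0)" using eq True by simp
    also have "\<dots> = ys ! i"
      using two_cycles_funpow_nth[of ys r 0 i] assms True by (simp add: two_cycles_index_def)
    finally show ?thesis .
  next
    case False
    have "xs ! i = (two_cycles r xs ^^ (i - r)) (xs ! r)"
      using two_cycles_funpow_nth[of xs r r "i - r"] assms False i by (simp add: two_cycles_index_def)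
    also have "\<dots> = (two_cycles r ys ^^ (i - r)) (ys ! r)" using eq by simp
    also have "\<dots> = ys ! i"
      using two_cycles_funpow_nth[of ys r r "i - r"] assms False i by (simp add: two_cycles_index_def)
    finally show ?thesis .
  qed
qed (use assms in simp)

lemma length_labelling: "xs \<in> permutations_of_set A \<Longrightarrow> length xs = card A"
  by (metis distinct_card permutations_of_setD)

lemma labelling_nine:
  assumes "card A = 9" "xs \<in> permutations_of_set A"
  shows "distinct xs" "length xs = 9" "set xs = A"
  using assms length_labelling[OF assms(2)] by (auto dest: permutations_of_setD)

text \<open>A 9-cycle has nine labellings, one for each starting point.\<close>

lemma card_nine_cycles_le:
  assumes "card A = 9" "finite E"
  shows "card {xs \<in> permutations_of_set A. two_cycles 0 xs \<in> E} \<le> 9 * card E"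
proof -
  let ?S = "{xs \<in> permutations_of_set A. two_cycles 0 xs \<in> E}"
  have finA: "finite A" using assms(1) by (metis card.infinite zero_neq_numeral)
  have "inj_on (\<lambda>xs. (xs ! 0, two_cycles 0 xs)) ?S"
  proof (rule inj_onI)
    fix xs ys assume "xs \<in> ?S" "ys \<in> ?S" "(xs ! 0, two_cycles 0 xs) = (ys ! 0, two_cycles 0 ys)"
    then show "xs = ys"
      by (intro two_cycles_inj[of xs ys 0]) (auto simp: labelling_nine[OF assms(1)])
  qed
  moreover have "(\<lambda>xs. (xs ! 0, two_cycles 0 xs)) ` ?S \<subseteq> A \<times> E"
  proof (rule image_subsetI)
    fix xs assume "xs \<in> ?S"
    then have xs: "xs \<in> permutations_of_set A" "two_cycles 0 xs \<in> E" by auto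
    show "(xs ! 0, two_cycles 0 xs) \<in> A \<times> E"
      using xs(2) nth_mem[of 0 xs] labelling_nine[OF assms(1) xs(1)] by simp
  qed
  ultimately have "card ?S \<le> card (A \<times> E)" using assms finA by (intro card_inj_on_le) auto
  then show ?thesis using assms by (simp add: card_cartesian_product)
qed

text \<open>An 8-cycle has eight labellings: its fixed point comes first, and any moved point may
  come second.\<close>

lemma card_eight_cycles_le:
  assumes "card A = 9" "finite E"
  shows "card {xs \<in> permutations_of_set A. two_cycles 1 xs \<in> E} \<le> 8 * card E"
proof -
  let ?S = "{xs \<in> permutations_of_set A. two_cycles 1 xs \<in> E}"
  let ?E = "two_cycles 1 ` ?S"
  have finA: "finite A" using assms(1) by (metis card.infinite zero_neq_numeral)
  have finE: "finite ?E" using assms(2) by (rule finite_subset[rotated]) auto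
  have mov: "moved (two_cycles 1 xs) = A - {xs ! 0}" "xs ! 1 \<in> A - {xs ! 0}" "xs ! 0 \<in> A" if "xs \<in> ?S" for xs
  proof -
    have xs: "distinct xs" "length xs = 9" "set xs = A" using that by (auto simp: labelling_nine[OF assms(1)])
    show "xs ! 1 \<in> A - {xs ! 0}" "xs ! 0 \<in> A" using xs nth_mem[of 1 xs] nth_mem[of 0 xs] by (auto simp: nth_eq_iff_index_eq)
    have "moved (two_cycles 1 xs) = (!) xs ` ({..<9} - {0})"
    proof -
      have "{i \<in> {..<9}. two_cycles_index 1 9 1 i \<noteq> i} = {..<9} - {0}"
        unfolding filter_lessThan_nine by (auto simp: two_cycles_index_def less_nine_iff)
      then show ?thesis using moved_two_cycles_funpow[of xs 1 1] xs by simp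
    qed
    also have "\<dots> = (!) xs ` {..<9} - {xs ! 0}"
      using xs by (auto simp: nth_eq_iff_index_eq)
    also have "(!) xs ` {..<9} = A" using xs by (auto simp: set_conv_nth)
    finally show "moved (two_cycles 1 xs) = A - {xs ! 0}" .
  qed
  have "inj_on (\<lambda>xs. (two_cycles 1 xs, xs ! 1)) ?S"
  proof (rule inj_onI)
    fix xs ys assume S: "xs \<in> ?S" "ys \<in> ?S" and eq: "(two_cycles 1 xs, xs ! 1) = (two_cycles 1 ys, ys ! 1)"
    have "A - {xs ! 0} = A - {ys ! 0}" using mov(1)[OF S(1)] mov(1)[OF S(2)] eq by simp
    then have "xs ! 0 = ys ! 0" using mov(3)[OF S(1)] mov(3)[OF S(2)] by blast
    then show "xs = ys"
      using S eq by (intro two_cycles_inj[of xs ys 1]) (auto simp: labelling_nine[OF assms(1)])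
  qed
  moreover have "(\<lambda>xs. (two_cycles 1 xs, xs ! 1)) ` ?S \<subseteq> (SIGMA g:?E. moved g)"
    using mov by auto
  moreover have finS: "finite (SIGMA g:?E. moved g)" using finE mov(1) finA by (intro finite_SigmaI) auto
  ultimately have "card ?S \<le> card (SIGMA g:?E. moved g)" by (rule card_inj_on_le)
  also have "\<dots> = (\<Sum>g\<in>?E. card (moved g))" using finE mov(1) finA by (intro card_SigmaI) auto
  also have "\<dots> = (\<Sum>g\<in>?E. 8)"
  proof (rule sum.cong[OF refl])
    fix g assume "g \<in> ?E"
    then obtain xs where "xs \<in> ?S" "g = two_cycles 1 xs" by blast
    then show "card (moved g) = 8" using mov[of xs] finA assms(1) by simp
  qed
  also have "\<dots> \<le> 8 * card E" using card_mono[OF assms(2), of ?E] by auto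
  finally show ?thesis .
qed

section \<open>Cycle types in a primitive group with odd elements\<close>

context primitive_nine
begin

lemmas labelling = labelling_nine[OF card_nine]

text \<open>The seventh power would be a transposition.\<close>

lemma no_two_seven: 
  assumes "xs \<in> permutations_of_set \<Omega>" shows "two_cycles 2 xs \<notin> H"
proof
  assume g: "two_cycles 2 xs \<in> H"
  have c: "card (moved (two_cycles 2 xs ^^ 7)) = 2"
  proof -
    have "{i \<in> {..<9}. two_cycles_index 2 9 7 i \<noteq> i} = {0,1}"
      unfolding filter_lessThan_nine by (simp add: two_cycles_index_def)
    then show ?thesis using labelling[OF assms] by (simp add: card_moved_two_cycles_funpow)
  qed
  have "(two_cycles 2 xs ^^ 7) ^^ 2 = id"
    unfolding funpow_mult using labelling[OF assms] by (intro two_cycles_funpow_id) (auto simp: two_cycles_index_def)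
  then show False using no_short_cycle[OF funpow_mem[OF g], of 2] c by simp
qed

text \<open>The fourth power would be a 5-cycle.\<close>

lemma no_four_five:
  assumes "xs \<in> permutations_of_set \<Omega>" shows "two_cycles 4 xs \<notin> H"
proof
  assume g: "two_cycles 4 xs \<in> H"
  have c: "card (moved (two_cycles 4 xs ^^ 4)) = 5"
  proof -
    have "{i \<in> {..<9}. two_cycles_index 4 9 4 i \<noteq> i} = {4,5,6,7,8}"
      unfolding filter_lessThan_nine by (simp add: two_cycles_index_def)
    then show ?thesis using labelling[OF assms] by (simp add: card_moved_two_cycles_funpow)
  qed
  have "(two_cycles 4 xs ^^ 4) ^^ 5 = id"
    unfolding funpow_mult using labelling[OF assms] by (intro two_cycles_funpow_id) (auto simp: two_cycles_index_def)
  moreover have "prime (5::nat)" by (rule prime_five)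
  ultimately show False using no_short_cycle[OF funpow_mem[OF g], of 5] c by simp
qed

text \<open>Multiplication by an odd element exchanges even and odd elements, so each sort is half
  of at most 3024.\<close>

lemma card_parity: "card {h \<in> H. evenperm h} \<le> 1512" "card {h \<in> H. \<not> evenperm h} \<le> 1512"
proof -
  obtain k where k: "k \<in> H" "\<not> evenperm k" using odd by blast
  have ev: "evenperm (g \<circ> h) \<longleftrightarrow> evenperm g = evenperm h" "evenperm (inv' g) = evenperm g" if "g \<in> H" "h \<in> H" for g h
    using that by (simp_all add: evenperm_comp evenperm_inv mem_permutation)
  have "bij_betw (\<lambda>h. k \<circ> h) {h \<in> H. evenperm h} {h \<in> H. \<not> evenperm h}"
  proof (rule bij_betwI[where g = "\<lambda>h. inv' k \<circ> h"])
    show "(\<lambda>h. k \<circ> h) \<in> {h \<in> H. evenperm h} \<rightarrow> {h \<in> H. \<not> evenperm h}"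
      using k comp_mem ev by auto
    show "(\<lambda>h. inv' k \<circ> h) \<in> {h \<in> H. \<not> evenperm h} \<rightarrow> {h \<in> H. evenperm h}"
      using k comp_mem inv_mem ev(1)[OF inv_mem[OF k(1)]] ev(2)[OF k(1) k(1)] by auto
  qed (use k in \<open>auto simp: fun_eq_iff\<close>)
  then have "card {h \<in> H. evenperm h} = card {h \<in> H. \<not> evenperm h}" by (rule bij_betw_same_card)
  moreover have "card H = card {h \<in> H. evenperm h} + card {h \<in> H. \<not> evenperm h}"
    using finite_group by (subst card_Un_disjoint[symmetric]) (auto intro: arg_cong[of _ _ card])
  ultimately show "card {h \<in> H. evenperm h} \<le> 1512" "card {h \<in> H. \<not> evenperm h} \<le> 1512"
    using card_le by simp_all
qed

text \<open>The cube of such an element is an involution that fixes just the points of the 3-cycle,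
  so by \<open>involution_fixed_points_eq\<close> two of these determine the third. Elements
  agreeing on these and one further point are equal by \<open>id_if_fixes_four\<close>. Hence the
  first two points of either cycle determine the labelling, with at most 9 * 8 and 6 * 5
  choices.\<close>

lemma card_three_six: "card {xs \<in> permutations_of_set \<Omega>. two_cycles 3 xs \<in> H} \<le> 2160"
proof -
  let ?S = "{xs \<in> permutations_of_set \<Omega>. two_cycles 3 xs \<in> H}"
  have lab: "distinct xs" "length xs = 9" "set xs = \<Omega>" "two_cycles 3 xs \<in> H" if "xs \<in> ?S" for xs
    using that labelling by auto
  have cube: "{x \<in> \<Omega>. (two_cycles 3 xs ^^ 3) x = x} = {xs ! 0, xs ! 1, xs ! 2}"
    "(two_cycles 3 xs ^^ 3) ((two_cycles 3 xs ^^ 3) x) = x" if "xs \<in> ?S" for xs x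
  proof -
    note lab = lab[OF that]
    have "moved (two_cycles 3 xs ^^ 3) = (!) xs ` {3,4,5,6,7,8}"
    proof -
      have "{i \<in> {..<9}. two_cycles_index 3 9 3 i \<noteq> i} = {3,4,5,6,7,8}"
        unfolding filter_lessThan_nine by (simp add: two_cycles_index_def)
      then show ?thesis using lab by (simp only: moved_two_cycles_funpow)
    qed
    moreover have "{x \<in> \<Omega>. (two_cycles 3 xs ^^ 3) x = x} = (!) xs ` {0,1,2,3,4,5,6,7,8} - moved (two_cycles 3 xs ^^ 3)"
    proof -
      have "\<Omega> = (!) xs ` {0,1,2,3,4,5,6,7,8}"
        using lab by (auto simp: in_set_conv_nth less_nine_iff simp flip: lab(3))
      then show ?thesis by (auto simp: moved_def)
    qed
    moreover have "(!) xs ` {0,1,2,3,4,5,6,7,8} - (!) xs ` {3,4,5,6,7,8} = (!) xs ` ({0,1,2,3,4,5,6,7,8} - {3,4,5,6,7,8})"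
      using lab by (intro inj_on_image_set_diff[symmetric, OF inj_on_nth[of xs "{0,1,2,3,4,5,6,7,8}"]]) auto
    moreover have "{0,1,2,3,4,5,6,7,8} - {3,4,5,6,7,8} = {0,1,2::nat}" by auto
    ultimately show "{x \<in> \<Omega>. (two_cycles 3 xs ^^ 3) x = x} = {xs ! 0, xs ! 1, xs ! 2}" by simp
    have "two_cycles 3 xs ^^ (3 + 3) = id"
      using lab by (intro two_cycles_funpow_id) (auto simp: two_cycles_index_def)
    then show "(two_cycles 3 xs ^^ 3) ((two_cycles 3 xs ^^ 3) x) = x" by (metis funpow_add comp_apply id_apply)
  qed
  have neq: "xs ! i \<noteq> xs ! j" "xs ! i \<in> \<Omega>" if "xs \<in> ?S" "i < 9" "j < 9" "i \<noteq> j" for xs i j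
    using lab[OF that(1)] that(2-) nth_mem[of i xs] by (auto simp: nth_eq_iff_index_eq)
  have third: "xs ! 2 = ys ! 2" if S: "xs \<in> ?S" "ys \<in> ?S" and eq: "xs ! 0 = ys ! 0" "xs ! 1 = ys ! 1" for xs ys
  proof -
    have "{xs ! 0, xs ! 1, xs ! 2} = {xs ! 0, xs ! 1, ys ! 2}"
    proof (rule involution_fixed_points_eq)
      show "two_cycles 3 xs ^^ 3 \<in> H" "two_cycles 3 ys ^^ 3 \<in> H" using lab(4) S by (auto intro: funpow_mem)
      show "xs ! 0 \<noteq> xs ! 1" using neq[OF S(1), of 0 1] by simp
    qed (use cube[OF S(1)] cube[OF S(2)] eq in auto)
    then show ?thesis using neq[OF S(1), of 2 0] neq[OF S(1), of 2 1] by auto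
  qed
  have val: "two_cycles 3 xs (xs ! 0) = xs ! 1" "two_cycles 3 xs (xs ! 1) = xs ! 2" "two_cycles 3 xs (xs ! 2) = xs ! 0"
    "two_cycles 3 xs (xs ! 3) = xs ! 4" if "xs \<in> ?S" for xs
    using two_cycles_nth[of xs 3 0] two_cycles_nth[of xs 3 1] two_cycles_nth[of xs 3 2] two_cycles_nth[of xs 3 3]
      lab[OF that] by (simp_all add: two_cycles_index_def flip: numeral_2_eq_2)
  let ?f = "\<lambda>xs. ((xs ! 0, xs ! 1), (xs ! 3, xs ! 4))"
  have inj: "inj_on ?f ?S"
  proof (rule inj_onI)
    fix xs ys assume S: "xs \<in> ?S" "ys \<in> ?S" and f: "?f xs = ?f ys"
    have eq: "xs ! 0 = ys ! 0" "xs ! 1 = ys ! 1" "xs ! 3 = ys ! 3" "xs ! 4 = ys ! 4" using f by auto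
    have eq2: "xs ! 2 = ys ! 2" using third[OF S eq(1,2)] .
    let ?g = "two_cycles 3 xs" and ?h = "two_cycles 3 ys"
    have gh: "?g \<in> H" "?h \<in> H" using lab(4) S by auto
    have "inv' ?h \<circ> ?g = id"
    proof (rule id_if_fixes_four[of _ "{xs ! 0, xs ! 1, xs ! 2, xs ! 3}"])
      show "inv' ?h \<circ> ?g \<in> H" using gh comp_mem inv_mem by blast
      show "{xs ! 0, xs ! 1, xs ! 2, xs ! 3} \<subseteq> \<Omega>"
        using neq(2)[OF S(1), of 0 1] neq(2)[OF S(1), of 1 0] neq(2)[OF S(1), of 2 0] neq(2)[OF S(1), of 3 0] by simp
      show "4 \<le> card {xs ! 0, xs ! 1, xs ! 2, xs ! 3}"
        using neq(1)[OF S(1), of 0 1] neq(1)[OF S(1), of 0 2] neq(1)[OF S(1), of 0 3]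
          neq(1)[OF S(1), of 1 2] neq(1)[OF S(1), of 1 3] neq(1)[OF S(1), of 2 3] by simp
      fix x assume "x \<in> {xs ! 0, xs ! 1, xs ! 2, xs ! 3}"
      then have "?h x = ?g x" using val[OF S(1)] val[OF S(2)] eq eq2 by auto
      then show "(inv' ?h \<circ> ?g) x = x" using gh(2) by (simp add: inv_eq_iff)
    qed
    then have "?g = ?h" using gh by (metis comp_apply ext id_apply inv_apply(2))
    then show "xs = ys" using lab[OF S(1)] lab[OF S(2)] eq by (intro two_cycles_inj[of xs ys 3]) auto
  qed
  define P where "P = {(x, y). x \<in> \<Omega> \<and> y \<in> \<Omega> \<and> x \<noteq> y}"
  have cardP: "card P = 72" and finP: "finite P"
    using card_off_diagonal[OF finite_points] card_nine finite_subset[of P "\<Omega> \<times> \<Omega>"] finite_points by (auto simp: P_def)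
  \<comment> \<open>The six points left for the 6-cycle when the 3-cycle starts with the pair
    \<open>p\<close>; by \<open>third\<close> the choice of \<open>xs\<close> does not matter. It is
    empty if no labelling in question starts with \<open>p\<close>.\<close>
  define W where "W p = (if \<exists>xs\<in>?S. p = (xs ! 0, xs ! 1)
      then \<Omega> - {fst p, snd p, (SOME xs. xs \<in> ?S \<and> p = (xs ! 0, xs ! 1)) ! 2} else {})" for p
  have W: "W (xs ! 0, xs ! 1) = \<Omega> - {xs ! 0, xs ! 1, xs ! 2}" if S: "xs \<in> ?S" for xs
  proof -
    let ?ys = "SOME ys. ys \<in> ?S \<and> (xs ! 0, xs ! 1) = (ys ! 0, ys ! 1)"
    have "?ys \<in> ?S \<and> (xs ! 0, xs ! 1) = (?ys ! 0, ?ys ! 1)"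
      by (rule someI[of "\<lambda>ys. ys \<in> ?S \<and> (xs ! 0, xs ! 1) = (ys ! 0, ys ! 1)" xs]) (use S in simp)
    then have "?ys ! 2 = xs ! 2" using third[OF _ S] by simp
    then show ?thesis using S by (auto simp: W_def)
  qed
  have cardW: "card (W p) \<le> 6" and finW: "finite (W p)" for p
  proof -
    show "finite (W p)" using finite_points by (simp add: W_def)
    show "card (W p) \<le> 6"
    proof (cases "\<exists>xs\<in>?S. p = (xs ! 0, xs ! 1)")
      case True
      then obtain xs where xs: "xs \<in> ?S" "p = (xs ! 0, xs ! 1)" by blast
      have "card {xs ! 0, xs ! 1, xs ! 2} = 3"
        using neq(1)[OF xs(1), of 0 1] neq(1)[OF xs(1), of 0 2] neq(1)[OF xs(1), of 1 2] by simp
      moreover have "{xs ! 0, xs ! 1, xs ! 2} \<subseteq> \<Omega>"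
        using neq(2)[OF xs(1), of 0 1] neq(2)[OF xs(1), of 1 0] neq(2)[OF xs(1), of 2 0] by simp
      ultimately have "card (\<Omega> - {xs ! 0, xs ! 1, xs ! 2}) = 6"
        using card_nine by (subst card_Diff_subset) auto
      then show ?thesis using W[OF xs(1)] xs(2) by simp
    next
      case False
      then have "W p = {}" by (simp add: W_def)
      then show ?thesis by simp
    qed
  qed
  let ?Q = "\<lambda>p. {(x, y). x \<in> W p \<and> y \<in> W p \<and> x \<noteq> y}"
  have finQ: "finite (?Q p)" for p by (rule finite_subset[of _ "W p \<times> W p"]) (use finW in auto)
  have cardQ: "card (?Q p) \<le> 30" for p
  proof -
    have "card (W p) * (card (W p) - 1) \<le> 6 * 5" using cardW[of p] by (intro mult_le_mono) auto
    then show ?thesis using card_off_diagonal[OF finW] by simp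
  qed
  have "?f ` ?S \<subseteq> Sigma P ?Q"
  proof (rule image_subsetI)
    fix xs assume S: "xs \<in> ?S"
    show "((xs ! 0, xs ! 1), xs ! 3, xs ! 4) \<in> Sigma P ?Q"
      using W[OF S] neq(2)[OF S, of 0 1] neq(2)[OF S, of 1 0] neq(2)[OF S, of 3 0] neq(2)[OF S, of 4 0]
        neq(1)[OF S, of 0 1] neq(1)[OF S, of 3 0] neq(1)[OF S, of 3 1] neq(1)[OF S, of 3 2]
        neq(1)[OF S, of 4 0] neq(1)[OF S, of 4 1] neq(1)[OF S, of 4 2] neq(1)[OF S, of 3 4]
      by (simp add: P_def)
  qed
  then have "card ?S \<le> card (Sigma P ?Q)"
    using inj finP finQ by (intro card_inj_on_le[of ?f]) auto
  also have "\<dots> = (\<Sum>p\<in>P. card (?Q p))" using finP finQ by (intro card_SigmaI) auto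
  also have "\<dots> \<le> (\<Sum>p\<in>P. 30)" using cardQ by (intro sum_mono)
  finally show ?thesis using cardP by simp
qed

end

section \<open>Colourings and labellings\<close>

text \<open>Each colour class is ordered independently. Colours of \<open>S\<close> that do not
  occur contribute the factor \<open>fact 0\<close>.\<close>

lemma card_coloured_permutations:
  assumes "finite A" "finite S" "set p \<subseteq> S" "image_mset f (mset_set A) = mset p"
  shows "card {xs \<in> permutations_of_set A. map f xs = p} = (\<Prod>y\<in>S. fact (count (mset p) y))"
  using assms(1,3,4)
proof (induction p arbitrary: A)
  case Nil
  then have "A = {}"
    by (simp add: mset_set_empty_iff)
  then have "{xs \<in> permutations_of_set A. map f xs = []} = {[]}"
    by auto
  then show ?case by simp
next
  case (Cons y p)
  define B where "B = {x \<in> A. f x = y}"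
  have finB: "finite B" using Cons.prems by (simp add: B_def)
  have split: "{xs \<in> permutations_of_set A. map f xs = y # p} =
      (\<Union>x\<in>B. (#) x ` {ys \<in> permutations_of_set (A - {x}). map f ys = p})" (is "?L = ?R")
  proof (intro equalityI subsetI)
    fix xs assume "xs \<in> ?L"
    then obtain x ys where xs: "xs = x # ys" "f x = y" "map f ys = p" "set (x # ys) = A" "distinct (x # ys)"
      by (cases xs) (auto simp: permutations_of_set_def)
    then have "x \<in> B" "ys \<in> {ys \<in> permutations_of_set (A - {x}). map f ys = p}"
      by (auto simp: B_def permutations_of_set_def)
    then show "xs \<in> ?R" using xs by blast
  next
    fix xs assume "xs \<in> ?R"
    then obtain x ys where "x \<in> A" "f x = y" "xs = x # ys" "set ys = A - {x}" "distinct ys" "map f ys = p"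
      unfolding B_def permutations_of_set_def by blast
    then show "xs \<in> ?L" by (simp add: permutations_of_set_def insert_absorb)
  qed
  have step: "card {ys \<in> permutations_of_set (A - {x}). map f ys = p} = (\<Prod>y\<in>S. fact (count (mset p) y))"
    if "x \<in> B" for x
  proof (rule Cons.IH)
    have "mset_set A = add_mset x (mset_set (A - {x}))"
      using that Cons.prems(1) by (auto simp: B_def mset_set.remove)
    then show "image_mset f (mset_set (A - {x})) = mset p"
      using Cons.prems(3) that by (auto simp: B_def)
  qed (use Cons.prems in auto)
  have "card {xs \<in> permutations_of_set A. map f xs = y # p} =
      (\<Sum>x\<in>B. card ((#) x ` {ys \<in> permutations_of_set (A - {x}). map f ys = p}))"
    unfolding split using finB Cons.prems(1) by (subst card_UN_disjoint) auto
  also have "\<dots> = card B * (\<Prod>y\<in>S. fact (count (mset p) y))"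
    by (subst card_image) (auto simp: step)
  also have "card B = Suc (count (mset p) y)"
  proof -
    have "card B = count (image_mset f (mset_set A)) y"
      unfolding B_def count_image_mset using Cons.prems(1)
      by (simp, intro arg_cong[of _ _ card]) auto
    then show ?thesis using Cons.prems(3) by simp
  qed
  also have "Suc (count (mset p) y) * (\<Prod>y\<in>S. fact (count (mset p) y)) =
      (\<Prod>z\<in>S. fact (count (mset (y # p)) z))"
  proof -
    have y: "y \<in> S" using Cons.prems by simp
    have "(\<Prod>z\<in>S - {y}. fact (count (mset (y # p)) z)) = (\<Prod>z\<in>S - {y}. fact (count (mset p) z) :: nat)"
      by (intro prod.cong) auto
    then show ?thesis
      by (simp add: prod.remove[OF assms(2) y] algebra_simps)
  qed
  finally show ?case .
qed

text \<open>The number of such labellings is a product of factorials, hence positive.\<close>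

lemma ex_coloured_permutation:
  assumes "finite A" "image_mset f (mset_set A) = mset p"
  obtains xs where "xs \<in> permutations_of_set A" "map f xs = p"
proof -
  have "card {xs \<in> permutations_of_set A. map f xs = p} > 0"
    using card_coloured_permutations[OF assms(1) _ order_refl assms(2)] by (auto intro: prod_pos)
  then have "{xs \<in> permutations_of_set A. map f xs = p} \<noteq> {}"
    by (metis card.empty less_irrefl)
  then show ?thesis using that by blast
qed

lemma mset_map_permutation:
  "xs \<in> permutations_of_set A \<Longrightarrow> mset (map f xs) = image_mset f (mset_set A)"
  by (metis mset_map mset_set_set permutations_of_setD)

lemma sum_permutation:
  assumes "xs \<in> permutations_of_set A"
  shows "(\<Sum>a\<in>A. F a) = (\<Sum>i<card A. F (xs ! i))"
proof -
  have "bij_betw ((!) xs) {..<card A} A"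
    using assms bij_betw_nth[of xs "{..<card A}" A]
    by (metis distinct_card permutations_of_setD)
  then show ?thesis
    by (simp add: sum.reindex_bij_betw)
qed

text \<open>A partition into three triples with names for its parts, so that partitions can be
  compared by evaluating lists. Each partition has six such colourings;
  \<open>distinct_kernels\<close> later keeps one of them.\<close>

definition balanced :: "(nat \<Rightarrow> nat) \<Rightarrow> nat set \<Rightarrow> bool" where
  "balanced f A \<longleftrightarrow> finite A \<and> image_mset f (mset_set A) = mset [0,0,0,1,1,1,2,2,2]"

lemma balanced_card: "balanced f A \<Longrightarrow> card A = 9"
proof -
  assume "balanced f A"
  then have "size (image_mset f (mset_set A)) = size (mset [0,0,0,1,1,1,2,2,2::nat])"
    by (simp only: balanced_def)
  then show ?thesis by simp
qed

text \<open>The colourings with the points \<open>0, \<dots>, 8\<close> that the permutation \<open>(0 1 2)(3 4 5 6 7 8)\<close> preserves up to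
  renaming of the colours: four partitions, with six colourings each.\<close>

definition patterns :: "nat list list" where
  "patterns =
    [[0,0,0,1,2,1,2,1,2], [0,0,0,2,1,2,1,2,1], [1,1,1,0,2,0,2,0,2], [1,1,1,2,0,2,0,2,0],
     [2,2,2,0,1,0,1,0,1], [2,2,2,1,0,1,0,1,0],
     [0,1,2,0,1,2,0,1,2], [0,1,2,1,2,0,1,2,0], [0,1,2,2,0,1,2,0,1],
     [0,2,1,0,2,1,0,2,1], [0,2,1,2,1,0,2,1,0], [0,2,1,1,0,2,1,0,2],
     [1,0,2,1,0,2,1,0,2], [1,0,2,0,2,1,0,2,1], [1,0,2,2,1,0,2,1,0],
     [1,2,0,1,2,0,1,2,0], [1,2,0,2,0,1,2,0,1], [1,2,0,0,1,2,0,1,2],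
     [2,0,1,2,0,1,2,0,1], [2,0,1,0,1,2,0,1,2], [2,0,1,1,2,0,1,2,0],
     [2,1,0,2,1,0,2,1,0], [2,1,0,1,0,2,1,0,2], [2,1,0,0,2,1,0,2,1]]"

text \<open>The number of elements of type \<open>(3,6)\<close> that preserve a colouring and rotate a given triple, as a
  function of the colours of its points. The factor 3 in \<open>pattern_triples\<close>
  arises because half of these elements rotate the triple in the direction given by a labelling, and each
  of them has 6 starting points for its 6-cycle.\<close>

definition hcol :: "nat \<Rightarrow> nat \<Rightarrow> nat \<Rightarrow> int" where
  "hcol a b c = (if a = b then (if b = c then 24 else 0) else if b = c \<or> a = c then 0 else 8)"

definition cmp :: "nat \<Rightarrow> nat \<Rightarrow> int" where
  "cmp a b = (if a < b then 1 else if b < a then -1 else 0)"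

text \<open>The alternating function on colours: the sign of the arrangement if the three colours
  differ, and 0 otherwise.\<close>

definition esgn :: "nat \<Rightarrow> nat \<Rightarrow> nat \<Rightarrow> int" where
  "esgn a b c = cmp a b * cmp b c * cmp a c"

fun pairs :: "'a list \<Rightarrow> ('a \<times> 'a) list" where
  "pairs [] = []"
| "pairs (x # xs) = map (Pair x) xs @ pairs xs"

fun triples :: "'a list \<Rightarrow> ('a \<times> 'a \<times> 'a) list" where
  "triples [] = []"
| "triples (x # xs) = map (Pair x) (pairs xs) @ triples xs"

text \<open>The pairs of patterns whose joint colour multiset is that of the pair \<open>(000111222, q)\<close>. Only a lower
  bound for their number is needed, so \<open>partner\<close> may guess: if two of the three points of colour \<open>c\<close> agree
  in \<open>q\<close>, the 6-cycle gets that colour of \<open>q\<close> and the 3-cycle the remaining one. For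
  \<open>q = 012012012\<close>, where the pair of colours is injective, all pairs with exactly one pattern that is
  constant on the 3-cycle match.\<close>

definition joint :: "nat list \<Rightarrow> nat list \<Rightarrow> nat list" where
  "joint p q = map2 (\<lambda>a b. 3 * a + b) p q"

definition partner :: "nat list \<Rightarrow> nat list \<Rightarrow> nat list" where
  "partner q p = map (\<lambda>c. if q ! (3*c) = q ! (3*c+1) then q ! (3*c+2) else q ! (3*c)) (take 3 p) @
     map (\<lambda>c. q ! (3*c+1)) (drop 3 p)"

definition matches :: "nat list list \<Rightarrow> nat list \<Rightarrow> nat list \<Rightarrow> (nat list \<times> nat list) list" where
  "matches ps q0 w = filter (\<lambda>(p,q). List.member ps q \<and> sort (joint p q) = w)
     (if q0 = [0,1,2,0,1,2,0,1,2]
      then List.product (take 6 ps) (drop 6 ps) @ List.product (drop 6 ps) (take 6 ps)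
      else map (\<lambda>p. (p, partner q0 p)) ps)"

text \<open>By \<open>card_coloured_permutations\<close>, the number of labellings whose joint
  colours, numbers below 9, spell a given rearrangement of \<open>w\<close>.\<close>

definition fact_counts :: "nat list \<Rightarrow> nat" where
  "fact_counts w = prod_list (map (\<lambda>y. fact (length (filter ((=) y) w))) [0,1,2,3,4,5,6,7,8])"

definition hsum :: "((nat \<times> nat \<times> nat) \<times> (nat \<times> nat \<times> nat) \<times> (nat \<times> nat \<times> nat)) list \<Rightarrow> int" where
  "hsum ts = sum_list (map (\<lambda>((_,a,a'),(_,b,b'),(_,c,c')). hcol a b c * hcol a' b' c') ts)"

text \<open>Triples with value 0 are removed before the quadratic loop of \<open>wsum\<close>, which
  keeps the evaluation small.\<close>

definition signed :: "((nat \<times> nat \<times> nat) \<times> (nat \<times> nat \<times> nat) \<times> (nat \<times> nat \<times> nat)) list \<Rightarrow> (int \<times> nat \<times> nat \<times> nat) list" where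
  "signed ts = filter (\<lambda>(e,_). e \<noteq> 0) (map (\<lambda>((i,a,a'),(j,b,b'),(k,c,c')). (esgn a b c * esgn a' b' c', i, j, k)) ts)"

definition disj3 :: "nat \<times> nat \<times> nat \<Rightarrow> nat \<times> nat \<times> nat \<Rightarrow> bool" where
  "disj3 = (\<lambda>(i,j,k) (l,m,n). i \<noteq> l \<and> i \<noteq> m \<and> i \<noteq> n \<and> j \<noteq> l \<and> j \<noteq> m \<and> j \<noteq> n \<and> k \<noteq> l \<and> k \<noteq> m \<and> k \<noteq> n)"

fun wsum :: "(int \<times> nat \<times> nat \<times> nat) list \<Rightarrow> int" where
  "wsum [] = 0"
| "wsum ((e, t) # es) = e * sum_list (map (\<lambda>(e',t'). if disj3 t t' then e' else 0) es) + wsum es"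

definition sorted3 :: "nat list list" where
  "sorted3 = [[0,0,0],[0,0,1],[0,0,2],[0,1,1],[0,1,2],[0,2,2],[1,1,1],[1,1,2],[1,2,2],[2,2,2]]"

text \<open>The first six colours determine the multiset of the last three, which are listed in
  increasing order.\<close>

definition complete_row :: "nat list \<Rightarrow> nat list list" where
  "complete_row q = (let f = (\<lambda>y. length (filter ((=) y) q)) in 
     if f 0 \<le> 3 \<and> f 1 \<le> 3 \<and> f 2 \<le> 3 
     then [q @ replicate (3 - f 0) 0 @ replicate (3 - f 1) 1 @ replicate (3 - f 2) 2] else [])"

text \<open>The colourings that are sorted within each of the classes of \<open>000111222\<close>.\<close>

definition rows :: "nat list list" where
  "rows = concat (map (\<lambda>a. concat (map (\<lambda>b. complete_row (a @ b)) sorted3)) sorted3)"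

text \<open>The positions keep points with equal colours apart and allow triples to be tested for
  disjointness.\<close>

definition tagged :: "nat list \<Rightarrow> nat list \<Rightarrow> (nat \<times> nat \<times> nat) list" where
  "tagged p q = zip [0,1,2,3,4,5,6,7,8] (zip p q)"

text \<open>The sums over ordered triples contain \<open>hsum\<close> 6 times and
  \<open>wsum\<close> 72 times. With the weights 9 and 60 of \<open>common_patterns_form\<close> the
  ratio is 60 * 72 / (9 * 6) = 80.\<close>

definition hw :: "((nat \<times> nat \<times> nat) \<times> (nat \<times> nat \<times> nat) \<times> (nat \<times> nat \<times> nat)) list \<Rightarrow> int" where
  "hw ts = hsum ts + 80 * wsum (signed ts)"

text \<open>The inequality behind \<open>common_patterns_form\<close>, for colourings \<open>p\<close> and \<open>q\<close> of sorted points. The constants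
  make the right hand side the exact value for all five kinds of pairs of partitions.\<close>

definition kernel_bound :: "nat list list \<Rightarrow> nat list \<Rightarrow> nat list \<Rightarrow> nat list \<Rightarrow> bool" where
  "kernel_bound ps p q w \<longleftrightarrow>
     20 * int (length (matches ps q w) * fact_counts w) \<ge>
     3 * ((if q!0 = q!1 \<and> q!1 = q!2 \<and> q!3 = q!4 \<and> q!4 = q!5 then 23040 else 0) - 576
       + hw (triples (tagged p q)))"

text \<open>A finite check that covers all pairs: by \<open>ex_sorting_labelling\<close>, sorting
  the points brings every pair of balanced colourings to one of these rows.\<close>

lemma kernel_bound_rows:
  "list_all (\<lambda>q. kernel_bound patterns [0,0,0,1,1,1,2,2,2] q (joint [0,0,0,1,1,1,2,2,2] q)) rows"
  by code_simp

lemma distinct_patterns: "distinct patterns"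
  by code_simp

lemma sort_patterns: "p \<in> set patterns \<Longrightarrow> sort p = [0,0,0,1,1,1,2,2,2]"
proof -
  have "\<forall>p\<in>set patterns. sort p = [0,0,0,1,1,1,2,2,2]" by code_simp
  then show "p \<in> set patterns \<Longrightarrow> sort p = [0,0,0,1,1,1,2,2,2]" by blast
qed

lemma balanced_lt: "balanced f A \<Longrightarrow> a \<in> A \<Longrightarrow> f a < 3"
proof -
  assume "balanced f A" "a \<in> A"
  then have "f a \<in># mset [0,0,0,1,1,1,2,2,2]" by (metis balanced_def elem_mset_set image_eqI set_image_mset)
  then show "f a < 3" by auto
qed

lemma sort_eq_imp_mset_eq: "sort xs = ys \<Longrightarrow> mset xs = mset ys"
  by (metis mset_sort)

lemma mset_patterns: "p \<in> set patterns \<Longrightarrow> mset p = mset [0,0,0,1,1,1,2,2,2]"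
  using sort_patterns sort_eq_imp_mset_eq by blast

lemma length_patterns: "p \<in> set patterns \<Longrightarrow> length p = 9"
  using mset_patterns[THEN arg_cong[of _ _ size]] by simp

lemma patterns_lt: "p \<in> set patterns \<Longrightarrow> a \<in> set p \<Longrightarrow> a < 3"
  using mset_patterns[THEN arg_cong[of _ _ set_mset]] by auto

lemma card_pattern:
  assumes "balanced f A" "p \<in> set patterns"
  shows "card {xs \<in> permutations_of_set A. map f xs = p} = 216"
proof -
  have "card {xs \<in> permutations_of_set A. map f xs = p} = (\<Prod>y\<in>{0,1,2}. fact (count (mset p) y))"
    using assms mset_patterns[OF assms(2)]
    by (intro card_coloured_permutations) (auto simp: balanced_def dest: arg_cong[of _ _ set_mset])
  then show ?thesis using mset_patterns[OF assms(2)] by (simp add: fact_numeral)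
qed

lemma card_labelling_pattern:
  assumes "balanced f A"
  shows "card {xs \<in> permutations_of_set A. map f xs \<in> set patterns} = 5184"
proof -
  have "{xs \<in> permutations_of_set A. map f xs \<in> set patterns} =
      (\<Union>p\<in>set patterns. {xs \<in> permutations_of_set A. map f xs = p})" by auto
  then have "card {xs \<in> permutations_of_set A. map f xs \<in> set patterns} =
      (\<Sum>p\<in>set patterns. card {xs \<in> permutations_of_set A. map f xs = p})"
    by (simp only:) (rule card_UN_disjoint, auto)
  also have "\<dots> = card (set patterns) * 216" using card_pattern[OF assms] by simp
  also have "card (set patterns) = 24"
    using distinct_card[OF distinct_patterns] by (simp add: patterns_def)
  finally show ?thesis by simp
qed

lemma pattern_triples:
  assumes "x < 3" "y < 3" "z < 3"
  shows "(\<Sum>p\<leftarrow>patterns. if take 3 p = [x,y,z] then \<Prod>c\<in>{0,1,2}. fact (count (mset (drop 3 p)) c) else 0)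
    = 3 * hcol x y z"
proof -
  have "x \<in> {0,1,2}" "y \<in> {0,1,2}" "z \<in> {0,1,2}" using assms by auto
  then show ?thesis by (elim insertE emptyE; simp add: patterns_def hcol_def fact_numeral)
qed

text \<open>Once the first three points are placed, a pattern leaves only the order of the other six
  points within their colours.\<close>

lemma card_labelling_pattern_triple:
  assumes f: "balanced f A" and abc: "a \<in> A" "b \<in> A" "c \<in> A" "distinct [a,b,c]"
  shows "int (card {xs \<in> permutations_of_set A. map f xs \<in> set patterns \<and> take 3 xs = [a,b,c]})
    = 3 * hcol (f a) (f b) (f c)"
proof -
  have finA: "finite A" using f by (simp add: balanced_def)
  define B where "B = A - {a,b,c}"
  have mA: "mset_set A = add_mset a (add_mset b (add_mset c (mset_set B)))"
  proof -
    have "mset_set (insert a (insert b (insert c B))) = add_mset a (add_mset b (add_mset c (mset_set B)))"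
      using abc(4) finA by (simp add: B_def)
    moreover have "insert a (insert b (insert c B)) = A" using abc by (auto simp: B_def)
    ultimately show ?thesis by simp
  qed
  have one: "int (card {xs \<in> permutations_of_set A. map f xs = p \<and> take 3 xs = [a,b,c]}) =
      (if take 3 p = [f a, f b, f c] then \<Prod>c\<in>{0,1,2}. fact (count (mset (drop 3 p)) c) else 0)"
    if p: "p \<in> set patterns" for p
  proof (cases "take 3 p = [f a, f b, f c]")
    case True
    have "{xs \<in> permutations_of_set A. map f xs = p \<and> take 3 xs = [a,b,c]} =
       (\<lambda>ys. [a,b,c] @ ys) ` {ys \<in> permutations_of_set B. map f ys = drop 3 p}" (is "?L = ?R")
    proof (intro equalityI subsetI)
      fix xs assume xs: "xs \<in> ?L"
      then have e: "xs = [a,b,c] @ drop 3 xs" by (metis (mono_tags, lifting) append_take_drop_id mem_Collect_eq)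
      moreover have "distinct ([a,b,c] @ drop 3 xs)" "set ([a,b,c] @ drop 3 xs) = A"
        using xs e by (auto dest: permutations_of_setD simp only:)
      then have "drop 3 xs \<in> permutations_of_set B" by (auto simp: permutations_of_set_def B_def)
      moreover have "map f (drop 3 xs) = drop 3 p" using xs by (auto simp flip: drop_map)
      ultimately show "xs \<in> ?R" by blast
    next
      fix xs assume "xs \<in> ?R"
      then obtain ys where ys: "xs = [a,b,c] @ ys" "ys \<in> permutations_of_set B" "map f ys = drop 3 p" by blast
      have "map f xs = take 3 p @ drop 3 p" using ys True by simp
      then show "xs \<in> ?L"
        using ys abc by (auto simp: permutations_of_set_def B_def)
    qed
    then have "card ?L = card {ys \<in> permutations_of_set B. map f ys = drop 3 p}"
      by (simp only:) (rule card_image, simp add: inj_on_def)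
    also have "\<dots> = (\<Prod>c\<in>{0,1,2}. fact (count (mset (drop 3 p)) c))"
    proof (rule card_coloured_permutations)
      show "finite B" using finA by (simp add: B_def)
      show "set (drop 3 p) \<subseteq> {0,1,2}" using patterns_lt[OF p] by (force dest: in_set_dropD)
      have "add_mset (f a) (add_mset (f b) (add_mset (f c) (image_mset f (mset_set B)))) = mset p"
        using f mset_patterns[OF p] mA by (simp add: balanced_def)
      also have "mset p = mset (take 3 p) + mset (drop 3 p)" by (metis append_take_drop_id mset_append)
      finally show "image_mset f (mset_set B) = mset (drop 3 p)" using True by simp
    qed simp
    finally show ?thesis using True by simp
  next
    case False
    have "take 3 (map f xs) = [f a, f b, f c]" if "take 3 xs = [a,b,c]" for xs
      using that by (simp add: take_map)
    then have "{xs \<in> permutations_of_set A. map f xs = p \<and> take 3 xs = [a,b,c]} = {}"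
      using False by auto
    then show ?thesis using False by (simp only: if_False card.empty of_nat_0)
  qed
  have "{xs \<in> permutations_of_set A. map f xs \<in> set patterns \<and> take 3 xs = [a,b,c]} =
      (\<Union>p\<in>set patterns. {xs \<in> permutations_of_set A. map f xs = p \<and> take 3 xs = [a,b,c]})" by auto
  then have "card {xs \<in> permutations_of_set A. map f xs \<in> set patterns \<and> take 3 xs = [a,b,c]} =
      (\<Sum>p\<in>set patterns. card {xs \<in> permutations_of_set A. map f xs = p \<and> take 3 xs = [a,b,c]})"
    by (simp only:) (rule card_UN_disjoint, auto)
  then have "int (card {xs \<in> permutations_of_set A. map f xs \<in> set patterns \<and> take 3 xs = [a,b,c]}) =
      (\<Sum>p\<in>set patterns. int (card {xs \<in> permutations_of_set A. map f xs = p \<and> take 3 xs = [a,b,c]}))" by simp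
  also have "\<dots> = (\<Sum>p\<in>set patterns. if take 3 p = [f a, f b, f c] then \<Prod>c\<in>{0,1,2}. fact (count (mset (drop 3 p)) c) else 0)"
    by (intro sum.cong refl one)
  also have "\<dots> = 3 * hcol (f a) (f b) (f c)"
    using pattern_triples[of "f a" "f b" "f c"] balanced_lt[OF f] abc distinct_patterns
    by (simp only: sum.distinct_set_conv_list)
  finally show ?thesis .
qed

text \<open>Renames the colours so that positions 3 and 4, which differ in every pattern, receive 0
  and 1. For patterns, equal normal forms then mean equal partitions of the positions.\<close>

definition normal_form :: "nat list \<Rightarrow> nat list" where
  "normal_form p = map (\<lambda>a. if a = p ! 3 then 0 else if a = p ! 4 then 1 else 2) p"

lemma normal_form_patterns:
  "p \<in> set patterns \<Longrightarrow> normal_form p \<in> normal_form ` set [[0,0,0,1,2,1,2,1,2],[0,1,2,0,1,2,0,1,2],[0,1,2,1,2,0,1,2,0],[0,1,2,2,0,1,2,0,1]] \<and> p ! 3 \<noteq> p ! 4"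
  by (auto simp: patterns_def normal_form_def)

lemma kernel_eq_if_normal_form_eq:
  assumes "p \<in> set patterns" "q \<in> set patterns" "normal_form p = normal_form q" "i < 9" "j < 9"
  shows "p ! i = p ! j \<longleftrightarrow> q ! i = q ! j"
proof -
  have ker: "p ! i = p ! j \<longleftrightarrow> normal_form p ! i = normal_form p ! j" if p: "p \<in> set patterns" for p
  proof -
    have "p ! k < 3" if "k < 9" for k using patterns_lt[OF p nth_mem] that length_patterns[OF p] by simp
    then have "p ! i < 3" "p ! j < 3" "p ! 3 < 3" "p ! 4 < 3" "p ! 3 \<noteq> p ! 4"
      using assms(4,5) normal_form_patterns[OF p] by auto
    then show ?thesis
      using assms(4,5) length_patterns[OF p] by (auto simp: normal_form_def)
  qed
  show ?thesis using ker[OF assms(1)] ker[OF assms(2)] assms(3) by simp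
qed

text \<open>Lets members of \<open>S\<close> stand for different partitions, so that
  \<open>card S\<close> counts partitions.\<close>

definition distinct_kernels :: "(nat \<Rightarrow> nat) set \<Rightarrow> nat set \<Rightarrow> bool" where
  "distinct_kernels S A \<longleftrightarrow> (\<forall>f\<in>S. \<forall>g\<in>S. (\<forall>a\<in>A. \<forall>b\<in>A. f a = f b \<longleftrightarrow> g a = g b) \<longrightarrow> f = g)"

text \<open>The normal form separates the partitions represented in \<open>S\<close>, and the 24
  patterns have only four normal forms.\<close>

lemma card_patterns_le_four:
  assumes S: "distinct_kernels S A" and xs: "xs \<in> permutations_of_set A" "card A = 9"
  shows "card {f \<in> S. map f xs \<in> set patterns} \<le> 4"
proof -
  let ?K = "{f \<in> S. map f xs \<in> set patterns}"
  let ?N = "normal_form ` set [[0,0,0,1,2,1,2,1,2],[0,1,2,0,1,2,0,1,2],[0,1,2,1,2,0,1,2,0],[0,1,2,2,0,1,2,0,1::nat]]"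
  have len: "length xs = 9" "set xs = A" using xs by (metis distinct_card permutations_of_setD)+
  have "inj_on (\<lambda>f. normal_form (map f xs)) ?K"
  proof (rule inj_onI)
    fix f g assume f: "f \<in> ?K" and g: "g \<in> ?K" and eq: "normal_form (map f xs) = normal_form (map g xs)"
    have "f a = f b \<longleftrightarrow> g a = g b" if ab: "a \<in> A" "b \<in> A" for a b
    proof -
      obtain i j where "i < 9" "j < 9" "a = xs ! i" "b = xs ! j" using ab len by (metis in_set_conv_nth)
      then show ?thesis using kernel_eq_if_normal_form_eq[of "map f xs" "map g xs" i j] f g eq len by simp
    qed
    then show "f = g" using S f g unfolding distinct_kernels_def by blast
  qed
  moreover have "(\<lambda>f. normal_form (map f xs)) ` ?K \<subseteq> ?N" using normal_form_patterns by auto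
  ultimately have "card ?K \<le> card ?N" by (rule card_inj_on_le) simp
  also have "\<dots> \<le> 4" using card_image_le[of "set [[0,0,0,1,2,1,2,1,2],[0,1,2,0,1,2,0,1,2],[0,1,2,1,2,0,1,2,0],[0,1,2,2,0,1,2,0,1::nat]]" normal_form] by simp
  finally show ?thesis .
qed

section \<open>The form counting common patterns\<close>

lemma mset_coloured: "balanced f A \<Longrightarrow> xs \<in> permutations_of_set A \<Longrightarrow> mset (map f xs) = mset [0,0,0,1,1,1,2,2,2]"
  using mset_map_permutation balanced_def by metis

lemma nth_joint: "length p = length q \<Longrightarrow> i < length p \<Longrightarrow> joint p q ! i = 3 * p ! i + q ! i"
  by (simp add: joint_def)

lemma joint_map: "joint (map f xs) (map g xs) = map (\<lambda>a. 3 * f a + g a) xs"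
  by (induction xs) (simp_all add: joint_def)

lemma joint_eq_iff:
  assumes "length p = length q" "length p' = length q'" "\<forall>a\<in>set q. a < 3" "\<forall>a\<in>set q'. a < 3"
  shows "joint p q = joint p' q' \<longleftrightarrow> p = p' \<and> q = q'"
proof
  assume eq: "joint p q = joint p' q'"
  have len: "length p = length p'" using arg_cong[OF eq, of length] assms by (simp add: joint_def)
  have "p ! i = p' ! i \<and> q ! i = q' ! i" if i: "i < length p" for i
  proof -
    have "3 * p ! i + q ! i = 3 * p' ! i + q' ! i"
      using arg_cong[OF eq, of "\<lambda>l. l ! i"] nth_joint i len assms by metis
    moreover have "q ! i < 3" "q' ! i < 3" using assms i len nth_mem by metis+
    ultimately show ?thesis by presburger
  qed
  then show "p = p' \<and> q = q'" using len assms by (metis nth_equalityI)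
qed simp

lemma sorted3I:
  assumes "a \<le> b" "b \<le> c" "c < 3"
  shows "[a, b, c] \<in> set sorted3"
proof -
  have "a \<in> {0,1,2}" "b \<in> {0,1,2}" "c \<in> {0,1,2}" using assms by auto
  then show ?thesis using assms by (elim insertE emptyE; simp add: sorted3_def)
qed

lemma sorted3_replicate:
  "c \<in> set sorted3 \<Longrightarrow> replicate (length (filter ((=) 0) c)) 0 @ replicate (length (filter ((=) 1) c)) 1 @
     replicate (length (filter ((=) 2) c)) 2 = c"
  by (auto simp: sorted3_def numeral_eq_Suc)

lemma count_filter: "length (filter ((=) y) xs) = count (mset xs) y"
  by (induction xs) auto

lemma rowsI:
  assumes "a \<in> set sorted3" "b \<in> set sorted3" "c \<in> set sorted3" "mset (a @ b @ c) = mset [0,0,0,1,1,1,2,2,2]"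
  shows "a @ b @ c \<in> set rows"
proof -
  have "length (filter ((=) y) (a @ b)) + length (filter ((=) y) c) = 3" if "y \<in> {0,1,2}" for y
    using that arg_cong[OF assms(4), of "\<lambda>M. count M y"] by (auto simp: count_filter)
  then have "length (filter ((=) 0) (a @ b)) + length (filter ((=) 0) c) = 3"
    "length (filter ((=) 1) (a @ b)) + length (filter ((=) 1) c) = 3"
    "length (filter ((=) 2) (a @ b)) + length (filter ((=) 2) c) = 3" by (blast intro: insertI1 insertI2)+
  then have cnt: "length (filter ((=) 0) (a @ b)) \<le> 3" "length (filter ((=) 1) (a @ b)) \<le> 3" "length (filter ((=) 2) (a @ b)) \<le> 3"
    "3 - length (filter ((=) 0) (a @ b)) = length (filter ((=) 0) c)"
    "3 - length (filter ((=) 1) (a @ b)) = length (filter ((=) 1) c)"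
    "3 - length (filter ((=) 2) (a @ b)) = length (filter ((=) 2) c)"
    by linarith+
  have "complete_row (a @ b) = [(a @ b) @ c]"
    unfolding complete_row_def Let_def
    using cnt(1-3) sorted3_replicate[OF assms(3)] by (simp only: cnt(4-6) if_True simp_thms)
  then have "a @ b @ c \<in> set (complete_row (a @ b))" by simp
  then show ?thesis using assms(1,2) unfolding rows_def by (simp, blast)
qed

text \<open>Sorting by \<open>3 * f a + g a\<close> is lexicographic: first by \<open>f\<close>,
  then by \<open>g\<close> within each class of \<open>f\<close>.\<close>

lemma ex_sorting_labelling:
  assumes f: "balanced f A" and g: "balanced g A"
  obtains xs where "xs \<in> permutations_of_set A" "map f xs = [0,0,0,1,1,1,2,2,2]" "map g xs \<in> set rows"
proof -
  let ?v = "\<lambda>a. 3 * f a + g a"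
  have finA: "finite A" and cA: "card A = 9" using f balanced_card by (auto simp: balanced_def)
  define w where "w = sorted_list_of_multiset (image_mset ?v (mset_set A))"
  obtain xs where xs: "xs \<in> permutations_of_set A" "map ?v xs = w"
    using ex_coloured_permutation[OF finA, of ?v w] by (auto simp: w_def)
  have len: "length xs = 9" "set xs = A" using xs(1) cA by (metis distinct_card permutations_of_setD)+
  have lt: "f a < 3" "g a < 3" if "a \<in> A" for a using that f g balanced_lt by auto
  have sorted: "?v (xs ! i) \<le> ?v (xs ! j)" if "i \<le> j" "j < 9" for i j
  proof -
    have "sorted w" by (simp add: w_def)
    then have "w ! i \<le> w ! j" using that len xs(2) by (metis length_map sorted_nth_mono)
    then show ?thesis using that len by (simp flip: xs(2))
  qed
  have mem: "xs ! i \<in> A" if "i < 9" for i using that len by (metis nth_mem)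
  have f_le: "f (xs ! i) \<le> f (xs ! j)" if "i \<le> j" "j < 9" for i j
    using sorted[OF that] lt[OF mem[of i]] lt[OF mem[of j]] that by linarith
  have "sorted (map f xs)"
    using f_le len by (auto simp: sorted_iff_nth_mono)
  moreover have "sorted [0,0,0,1,1,1,2,2,2::nat]" by simp
  ultimately have fxs: "map f xs = [0,0,0,1,1,1,2,2,2]"
    using mset_coloured[OF f xs(1)] by (metis properties_for_sort)
  have fi: "f (xs ! i) = [0,0,0,1,1,1,2,2,2] ! i" if "i < 9" for i
    using that fxs len by (metis nth_map)
  have g_le: "g (xs ! i) \<le> g (xs ! j)" if "i \<le> j" "j < 9" "f (xs ! i) = f (xs ! j)" for i j
    using sorted[OF that(1,2)] that(3) by simp
  let ?g = "\<lambda>i. g (xs ! i)"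
  have "xs = [xs!0, xs!1, xs!2, xs!3, xs!4, xs!5, xs!6, xs!7, xs!8]"
  proof -
    have "[0..<9] = [0,1,2,3,4,5,6,7,8]" by (simp add: upt_rec)
    then show ?thesis using map_nth[of xs] len(1) by (simp del: upt_Suc)
  qed
  then have "map g xs = map g [xs!0, xs!1, xs!2, xs!3, xs!4, xs!5, xs!6, xs!7, xs!8]" by metis
  then have gxs: "map g xs = [?g 0, ?g 1, ?g 2] @ [?g 3, ?g 4, ?g 5] @ [?g 6, ?g 7, ?g 8]" by simp
  have "[?g 0, ?g 1, ?g 2] @ [?g 3, ?g 4, ?g 5] @ [?g 6, ?g 7, ?g 8] \<in> set rows"
  proof (rule rowsI)
    show "mset ([?g 0, ?g 1, ?g 2] @ [?g 3, ?g 4, ?g 5] @ [?g 6, ?g 7, ?g 8]) = mset [0,0,0,1,1,1,2,2,2]"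
      using mset_coloured[OF g xs(1)] gxs by metis
    show "[?g 0, ?g 1, ?g 2] \<in> set sorted3"
      using lt[OF mem[of 2]] by (intro sorted3I g_le) (simp_all add: fi)
    show "[?g 3, ?g 4, ?g 5] \<in> set sorted3"
      using lt[OF mem[of 5]] by (intro sorted3I g_le) (simp_all add: fi)
    show "[?g 6, ?g 7, ?g 8] \<in> set sorted3"
      using lt[OF mem[of 8]] by (intro sorted3I g_le) (simp_all add: fi)
  qed
  then show ?thesis using that xs(1) fxs gxs by metis
qed

lemma distinct_matches: "distinct (matches patterns q w)"
proof -
  have d: "distinct (take 6 patterns)" "distinct (drop 6 patterns)"
    using distinct_patterns by (auto intro: distinct_take distinct_drop)
  have "set (take 6 patterns) \<inter> set (drop 6 patterns) = {}"
    by (rule set_take_disj_set_drop_if_distinct[OF distinct_patterns]) simp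
  then have "distinct (List.product (take 6 patterns) (drop 6 patterns) @ List.product (drop 6 patterns) (take 6 patterns))"
    using d by (auto simp: distinct_product)
  moreover have "distinct (map (\<lambda>p. (p, partner q p)) patterns)"
    using distinct_patterns by (simp add: distinct_map inj_on_def)
  ultimately show ?thesis unfolding matches_def by (intro distinct_filter) simp
qed

lemma matchesD:
  assumes "(p, p') \<in> set (matches patterns q w)"
  shows "p \<in> set patterns" "p' \<in> set patterns" "sort (joint p p') = w"
  using assms unfolding matches_def
  by (auto simp: List.member_iff split: if_splits dest: in_set_takeD in_set_dropD)

lemma fact_counts_eq: "fact_counts w = (\<Prod>y\<in>{0,1,2,3,4,5,6,7,8}. fact (count (mset w) y))"
  by (simp add: fact_counts_def count_filter)

text \<open>Each match \<open>(p, p')\<close> is realised by exactly \<open>fact_counts w\<close>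
  labellings, because \<open>joint p p'\<close> is a rearrangement of the joint colours; different
  matches have different labellings.\<close>

lemma card_common_patterns_ge:
  assumes f: "balanced f A" and g: "balanced g A" and ys: "ys \<in> permutations_of_set A"
  defines "w \<equiv> joint (map f ys) (map g ys)"
  shows "length (matches patterns q w) * fact_counts w \<le>
    card {xs \<in> permutations_of_set A. map f xs \<in> set patterns \<and> map g xs \<in> set patterns}"
proof -
  let ?M = "set (matches patterns q w)"
  let ?v = "\<lambda>a. 3 * f a + g a"
  let ?X = "\<lambda>(p, p'). {xs \<in> permutations_of_set A. map f xs = p \<and> map g xs = p'}"
  have finA: "finite A" using f by (simp add: balanced_def)
  have each: "card (?X m) = fact_counts w" if m: "m \<in> ?M" for m
  proof -
    obtain p p' where m': "m = (p, p')" by fastforce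
    note pp = matchesD[OF m[unfolded m']]
    have ms: "mset (joint p p') = mset w" using pp(3) mset_sort by metis
    have "?X m = {xs \<in> permutations_of_set A. map ?v xs = joint p p'}"
      unfolding m' prod.case
    proof (rule Collect_cong, rule conj_cong[OF refl])
      fix xs assume xs: "xs \<in> permutations_of_set A"
      have "map ?v xs = joint p p' \<longleftrightarrow> joint (map f xs) (map g xs) = joint p p'" by (simp add: joint_map)
      also have "\<dots> \<longleftrightarrow> map f xs = p \<and> map g xs = p'"
      proof (rule joint_eq_iff)
        show "length p = length p'" using length_patterns pp by simp
        show "\<forall>a\<in>set p'. a < 3" using patterns_lt pp by blast
        show "\<forall>a\<in>set (map g xs). a < 3" using balanced_lt[OF g] permutations_of_setD(1)[OF xs] by simp
      qed simp
      finally show "(map f xs = p \<and> map g xs = p') = (map ?v xs = joint p p')" by simp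
    qed
    also have "card \<dots> = (\<Prod>y\<in>{0,1,2,3,4,5,6,7,8}. fact (count (mset (joint p p')) y))"
    proof (rule card_coloured_permutations[OF finA])
      have wm: "mset w = image_mset ?v (mset_set A)"
        unfolding w_def joint_map by (rule mset_map_permutation[OF ys])
      then show "image_mset ?v (mset_set A) = mset (joint p p')" using ms by simp
      have nine: "n < 9 \<Longrightarrow> n \<in> {0,1,2,3,4,5,6,7,8}" for n :: nat by auto
      have "?v a < 9" if "a \<in> A" for a
        using balanced_lt[OF f that] balanced_lt[OF g that] by linarith
      then have "?v ` A \<subseteq> {0,1,2,3,4,5,6,7,8}" by (intro image_subsetI nine)
      moreover have "set (joint p p') = ?v ` A"
        using arg_cong[OF wm, of set_mset] arg_cong[OF ms, of set_mset] finA by simp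
      ultimately show "set (joint p p') \<subseteq> {0,1,2,3,4,5,6,7,8}" by (simp only:)
    qed simp
    finally show ?thesis using ms by (simp only: fact_counts_eq)
  qed
  have "length (matches patterns q w) * fact_counts w = (\<Sum>m\<in>?M. card (?X m))"
    using distinct_card[OF distinct_matches] each by simp
  also have "\<dots> = card (\<Union>m\<in>?M. ?X m)"
    by (rule card_UN_disjoint[symmetric]) (auto split: prod.splits)
  also have "\<dots> \<le> card {xs \<in> permutations_of_set A. map f xs \<in> set patterns \<and> map g xs \<in> set patterns}"
    using matchesD by (intro card_mono) auto
  finally show ?thesis .
qed

section \<open>Sums over triples, evaluated on lists\<close>

lemma sum_pairs:
  assumes "distinct L" "\<And>x y. G x y = G y x" "\<And>x. G x x = (0::int)"
  shows "(\<Sum>x\<in>set L. \<Sum>y\<in>set L. G x y) = 2 * (\<Sum>(x,y)\<leftarrow>pairs L. G x y)"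
  using assms(1)
proof (induction L)
  case (Cons e L)
  have "(\<Sum>x\<in>set (e # L). \<Sum>y\<in>set (e # L). G x y) =
     (\<Sum>y\<in>set L. G e y) + (\<Sum>x\<in>set L. G x e) + (\<Sum>x\<in>set L. \<Sum>y\<in>set L. G x y)"
    using Cons.prems assms(3) by (simp add: sum.distrib)
  also have "(\<Sum>x\<in>set L. G x e) = (\<Sum>y\<in>set L. G e y)" by (intro sum.cong refl assms(2))
  also have "(\<Sum>y\<in>set L. G e y) = (\<Sum>y\<leftarrow>L. G e y)" using Cons.prems by (simp add: sum.distinct_set_conv_list)
  finally show ?case using Cons by (simp add: o_def)
qed simp

text \<open>A symmetric summand that vanishes when two arguments coincide is counted 3! times for
  each unordered triple.\<close>

lemma sum_triples:
  assumes "distinct L" "\<And>x y z. G x y z = G y x z" "\<And>x y z. G x y z = G x z y" "\<And>x y. G x x y = (0::int)"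
  shows "(\<Sum>x\<in>set L. \<Sum>y\<in>set L. \<Sum>z\<in>set L. G x y z) = 6 * (\<Sum>(x,y,z)\<leftarrow>triples L. G x y z)"
  using assms(1)
proof (induction L)
  case (Cons e L)
  have z1: "G x y x = 0" and z2: "G x y y = 0" for x y using assms(2-4) by metis+
  let ?L = "set L"
  let ?P = "\<Sum>y\<in>?L. \<Sum>z\<in>?L. G e y z"
  have "(\<Sum>x\<in>set (e # L). \<Sum>y\<in>set (e # L). \<Sum>z\<in>set (e # L). G x y z) =
     ?P + (\<Sum>x\<in>?L. \<Sum>z\<in>?L. G x e z) + (\<Sum>x\<in>?L. \<Sum>y\<in>?L. G x y e) + (\<Sum>x\<in>?L. \<Sum>y\<in>?L. \<Sum>z\<in>?L. G x y z)"
    using Cons.prems by (simp add: sum.distrib assms(4) z1 z2)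
  also have "(\<Sum>x\<in>?L. \<Sum>z\<in>?L. G x e z) = ?P" by (intro sum.cong refl) (metis assms(2))
  also have "(\<Sum>x\<in>?L. \<Sum>y\<in>?L. G x y e) = ?P" by (intro sum.cong refl) (metis assms(2,3))
  also have "?P = 2 * (\<Sum>(y,z)\<leftarrow>pairs L. G e y z)"
    by (rule sum_pairs, use Cons.prems in simp, rule assms(3), rule z2)
  also have "(\<Sum>x\<in>?L. \<Sum>y\<in>?L. \<Sum>z\<in>?L. G x y z) = 6 * (\<Sum>(x,y,z)\<leftarrow>triples L. G x y z)"
    by (rule Cons.IH) (use Cons.prems in simp)
  also have "2 * (\<Sum>(y,z)\<leftarrow>pairs L. G e y z) + 2 * (\<Sum>(y,z)\<leftarrow>pairs L. G e y z) + 2 * (\<Sum>(y,z)\<leftarrow>pairs L. G e y z)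
      + 6 * (\<Sum>(x,y,z)\<leftarrow>triples L. G x y z) = 6 * (\<Sum>(x,y,z)\<leftarrow>triples (e # L). G x y z)"
    by (simp add: o_def split_def)
  finally show ?case .
qed simp

lemma hcol_commute: "hcol a b c = hcol b a c" "hcol a b c = hcol a c b"
  by (auto simp: hcol_def)

lemma cmp_swap: "cmp b a = - cmp a b"
  by (simp add: cmp_def)

lemma esgn_swap: "esgn b a c = - esgn a b c" "esgn a c b = - esgn a b c" "esgn a a c = 0"
proof -
  show "esgn b a c = - esgn a b c" unfolding esgn_def by (subst cmp_swap) simp
  show "esgn a c b = - esgn a b c" unfolding esgn_def by (subst (2) cmp_swap) simp
  show "esgn a a c = 0" by (simp add: esgn_def cmp_def)
qed

lemma disj3_irrefl: "\<not> disj3 t t"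
  and disj3_sym: "disj3 s t = disj3 t s"
  by (auto simp: disj3_def split: prod.splits)

text \<open>\<open>disj3\<close> is symmetric and irreflexive, so \<open>wsum\<close> meets every
  unordered pair once.\<close>

lemma wsum_double: "(\<Sum>(e,s)\<leftarrow>es. e * (\<Sum>(e',t)\<leftarrow>es. if disj3 s t then e' else 0)) = 2 * wsum es"
proof (induction es)
  case (Cons x es)
  obtain e s where x: "x = (e, s)" by (cases x)
  have "(\<Sum>(e',t)\<leftarrow>es. e' * (\<Sum>(e'',u)\<leftarrow>x # es. if disj3 t u then e'' else 0)) =
     (\<Sum>(e',t)\<leftarrow>es. e * (if disj3 s t then e' else 0)) + (\<Sum>(e',t)\<leftarrow>es. e' * (\<Sum>(e'',u)\<leftarrow>es. if disj3 t u then e'' else 0))"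
    by (auto simp: x split_def sum_list_addf[symmetric] algebra_simps disj3_sym[of s] intro!: arg_cong[of _ _ sum_list] map_cong)
  then show ?case using Cons by (simp add: x disj3_irrefl split_def sum_list_const_mult)
qed simp

lemma sum_list_filter_nonzero:
  "(\<Sum>(e,t)\<leftarrow>filter (\<lambda>(e,_). e \<noteq> 0) xs. e * F t) = (\<Sum>(e,t)\<leftarrow>xs. e * F t :: int)"
  by (induction xs) auto

lemma pairs_mem: "(x, y) \<in> set (pairs L) \<Longrightarrow> x \<in> set L \<and> y \<in> set L"
  by (induction L) auto

lemma pairs_distinct: "distinct (map h L) \<Longrightarrow> (x, y) \<in> set (pairs L) \<Longrightarrow> h x \<noteq> h y"
  by (induction L) auto

lemma triples_distinct:
  "distinct (map h L) \<Longrightarrow> (x, y, z) \<in> set (triples L) \<Longrightarrow> h x \<noteq> h y \<and> h x \<noteq> h z \<and> h y \<noteq> h z"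
  by (induction L) (auto dest: pairs_distinct pairs_mem)

lemma sum_triples_hcol:
  fixes L :: "(nat \<times> nat \<times> nat) list"
  assumes "distinct (map fst L)"
  shows "(\<Sum>x\<in>set L. \<Sum>y\<in>set L. \<Sum>z\<in>set L. if fst x = fst y \<or> fst x = fst z \<or> fst y = fst z then 0
      else hcol (fst (snd x)) (fst (snd y)) (fst (snd z)) * hcol (snd (snd x)) (snd (snd y)) (snd (snd z)))
    = 6 * hsum (triples L)" (is "?S = _")
proof -
  have "?S = 6 * (\<Sum>(x,y,z)\<leftarrow>triples L. if fst x = fst y \<or> fst x = fst z \<or> fst y = fst z then 0
      else hcol (fst (snd x)) (fst (snd y)) (fst (snd z)) * hcol (snd (snd x)) (snd (snd y)) (snd (snd z)))"
  proof (rule sum_triples, goal_cases)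
    case 1
    then show ?case using assms by (simp add: distinct_map)
  next
    case (2 x y z)
    then show ?case by (intro if_cong arg_cong2[of _ _ _ _ "(*)"] hcol_commute refl) auto
  next
    case (3 x y z)
    then show ?case by (intro if_cong arg_cong2[of _ _ _ _ "(*)"] hcol_commute refl) auto
  qed simp
  also have "(\<Sum>(x,y,z)\<leftarrow>triples L. if fst x = fst y \<or> fst x = fst z \<or> fst y = fst z then 0
      else hcol (fst (snd x)) (fst (snd y)) (fst (snd z)) * hcol (snd (snd x)) (snd (snd y)) (snd (snd z))) = hsum (triples L)"
    unfolding hsum_def
  proof (intro arg_cong[of _ _ sum_list] map_cong refl, goal_cases)
    case (1 t)
    obtain x y z where "t = (x, y, z)" by (metis prod_cases3)
    then show ?case using 1 triples_distinct[OF assms, of x y z] by (auto split: prod.splits)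
  qed
  finally show ?thesis .
qed

definition esgn2 :: "nat \<times> nat \<times> nat \<Rightarrow> nat \<times> nat \<times> nat \<Rightarrow> nat \<times> nat \<times> nat \<Rightarrow> int" where
  "esgn2 x y z = esgn (fst (snd x)) (fst (snd y)) (fst (snd z)) * esgn (snd (snd x)) (snd (snd y)) (snd (snd z))"

text \<open>The product of two alternating functions is symmetric, as \<open>sum_triples\<close>
  requires.\<close>

lemma esgn2_commute: "esgn2 x y z = esgn2 y x z" "esgn2 x y z = esgn2 x z y" "esgn2 x x z = 0"
proof -
  show "esgn2 x y z = esgn2 y x z"
    unfolding esgn2_def esgn_swap(1)[of "fst (snd y)" "fst (snd x)"] esgn_swap(1)[of "snd (snd y)" "snd (snd x)"] by simp
  show "esgn2 x y z = esgn2 x z y"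
    unfolding esgn2_def esgn_swap(2)[of _ "fst (snd y)" "fst (snd z)"] esgn_swap(2)[of _ "snd (snd y)" "snd (snd z)"] by simp
  show "esgn2 x x z = 0" by (simp add: esgn2_def esgn_swap(3))
qed

text \<open>72 = 6 * 6 * 2: the orders of the points within either triple and of the two
  triples.\<close>

lemma sum_triples_esgn:
  fixes L :: "(nat \<times> nat \<times> nat) list"
  assumes "distinct L"
  shows "(\<Sum>x\<in>set L. \<Sum>y\<in>set L. \<Sum>z\<in>set L. esgn2 x y z * (\<Sum>u\<in>set L. \<Sum>v\<in>set L. \<Sum>w\<in>set L.
      if disj3 (fst x, fst y, fst z) (fst u, fst v, fst w) then esgn2 u v w else 0)) = 72 * wsum (signed (triples L))"
    (is "?S = _")
proof -
  define F where "F t = (\<Sum>(u,v,w)\<leftarrow>triples L. if disj3 t (fst u, fst v, fst w) then esgn2 u v w else 0)" for t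
  have disj_perm: "disj3 t (a, b, c) = disj3 t (b, a, c)" "disj3 t (a, b, c) = disj3 t (a, c, b)"
    "disj3 (a, b, c) t = disj3 (b, a, c) t" "disj3 (a, b, c) t = disj3 (a, c, b) t" for t a b c
    by (auto simp: disj3_def split: prod.splits)
  have inner: "(\<Sum>u\<in>set L. \<Sum>v\<in>set L. \<Sum>w\<in>set L. if disj3 t (fst u, fst v, fst w) then esgn2 u v w else 0) = 6 * F t" for t
    unfolding F_def
  proof (rule sum_triples[OF assms])
    fix u v w :: "nat \<times> nat \<times> nat"
    show "(if disj3 t (fst u, fst v, fst w) then esgn2 u v w else 0) = (if disj3 t (fst v, fst u, fst w) then esgn2 v u w else 0)"
      by (simp only: disj_perm(1)[of t "fst u" "fst v" "fst w"] esgn2_commute(1)[of u v w])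
    show "(if disj3 t (fst u, fst v, fst w) then esgn2 u v w else 0) = (if disj3 t (fst u, fst w, fst v) then esgn2 u w v else 0)"
      by (simp only: disj_perm(2)[of t "fst u" "fst v" "fst w"] esgn2_commute(2)[of u v w])
    show "(if disj3 t (fst u, fst u, fst v) then esgn2 u u v else 0) = 0"
      by (simp add: esgn2_commute(3))
  qed
  have Fperm: "F (a, b, c) = F (b, a, c)" "F (a, b, c) = F (a, c, b)" for a b c
    by (simp only: F_def disj_perm(3)[of a b c]) (simp only: F_def disj_perm(4)[of a b c])
  have "?S = (\<Sum>x\<in>set L. \<Sum>y\<in>set L. \<Sum>z\<in>set L. esgn2 x y z * (6 * F (fst x, fst y, fst z)))"
    by (simp only: inner)
  also have "\<dots> = 6 * (\<Sum>(x,y,z)\<leftarrow>triples L. esgn2 x y z * (6 * F (fst x, fst y, fst z)))"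
    by (rule sum_triples[OF assms]) (metis Fperm esgn2_commute, metis Fperm esgn2_commute, simp add: esgn2_commute)
  also have "\<dots> = 36 * (\<Sum>(x,y,z)\<leftarrow>triples L. esgn2 x y z * F (fst x, fst y, fst z))"
    by (simp add: split_def sum_list_const_mult[symmetric] algebra_simps)
  finally have S: "?S = 36 * (\<Sum>(x,y,z)\<leftarrow>triples L. esgn2 x y z * F (fst x, fst y, fst z))" .
  define es where "es = map (\<lambda>(x,y,z). (esgn2 x y z, fst x, fst y, fst z)) (triples L)"
  have sg: "signed (triples L) = filter (\<lambda>(e,_). e \<noteq> 0) es"
    unfolding signed_def es_def
    by (intro arg_cong[of _ _ "filter _"] map_cong refl) (auto simp: esgn2_def split: prod.splits)
  have F_es: "F t = (\<Sum>(e',s)\<leftarrow>es. if disj3 t s then e' else 0)" for t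
    by (simp add: F_def es_def o_def split_def cong: if_cong)
  have F_sg: "F t = (\<Sum>(e',s)\<leftarrow>signed (triples L). if disj3 t s then e' else 0)" for t
  proof -
    have "F t = (\<Sum>(e',s)\<leftarrow>es. e' * (if disj3 t s then 1 else 0))"
      unfolding F_es by (intro arg_cong[of _ _ sum_list] map_cong) auto
    also have "\<dots> = (\<Sum>(e',s)\<leftarrow>signed (triples L). e' * (if disj3 t s then 1 else 0))"
      unfolding sg by (rule sum_list_filter_nonzero[symmetric])
    also have "\<dots> = (\<Sum>(e',s)\<leftarrow>signed (triples L). if disj3 t s then e' else 0)"
      by (intro arg_cong[of _ _ sum_list] map_cong) auto
    finally show ?thesis .
  qed
  have "(\<Sum>(x,y,z)\<leftarrow>triples L. esgn2 x y z * F (fst x, fst y, fst z)) = (\<Sum>(e,t)\<leftarrow>es. e * F t)"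
    by (simp add: es_def o_def split_def)
  also have "\<dots> = (\<Sum>(e,t)\<leftarrow>signed (triples L). e * F t)"
    unfolding sg by (rule sum_list_filter_nonzero[symmetric])
  also have "\<dots> = 2 * wsum (signed (triples L))"
    unfolding F_sg by (rule wsum_double)
  finally show ?thesis using S by simp
qed

lemma tagged_map:
  assumes "length ys = 9"
  shows "tagged (map f ys) (map g ys) = map (\<lambda>i. (i, f (ys ! i), g (ys ! i))) [0..<9]"
proof (rule nth_equalityI)
  have eq: "[0,1,2,3,4,5,6,7,8] = [0..<9]" by (simp add: upt_rec)
  show "length (tagged (map f ys) (map g ys)) = length (map (\<lambda>i. (i, f (ys ! i), g (ys ! i))) [0..<9])"
    using assms by (simp add: tagged_def)
  fix i assume "i < length (tagged (map f ys) (map g ys))"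
  then have "i < 9" using assms by (simp add: tagged_def)
  then show "tagged (map f ys) (map g ys) ! i = map (\<lambda>i. (i, f (ys ! i), g (ys ! i))) [0..<9] ! i"
    using assms unfolding tagged_def eq by simp
qed

definition hmass :: "(nat \<Rightarrow> nat) \<Rightarrow> nat \<times> nat \<times> nat \<Rightarrow> int" where
  "hmass f = (\<lambda>(a,b,c). hcol (f a) (f b) (f c))"

definition esign :: "(nat \<Rightarrow> nat) \<Rightarrow> nat \<times> nat \<times> nat \<Rightarrow> int" where
  "esign f = (\<lambda>(a,b,c). esgn (f a) (f b) (f c))"

definition ordered_triples :: "nat set \<Rightarrow> (nat \<times> nat \<times> nat) set" where
  "ordered_triples A = {(a,b,c). a \<in> A \<and> b \<in> A \<and> c \<in> A \<and> a \<noteq> b \<and> a \<noteq> c \<and> b \<noteq> c}"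

text \<open>Entries within one triple may coincide; \<open>esign\<close> vanishes there.\<close>

definition disjoint_triples :: "nat set \<Rightarrow> ((nat \<times> nat \<times> nat) \<times> (nat \<times> nat \<times> nat)) set" where
  "disjoint_triples A = {(s,t). s \<in> A \<times> A \<times> A \<and> t \<in> A \<times> A \<times> A \<and> disj3 s t}"

lemma sum_cart3: "(\<Sum>t\<in>A \<times> A \<times> A. F t) = (\<Sum>a\<in>A. \<Sum>b\<in>A. \<Sum>c\<in>A. F (a,b,c))"
  by (simp add: sum.cartesian_product split_def)

lemma sum_ordered_triples:
  assumes "finite A"
  shows "(\<Sum>t\<in>ordered_triples A. F t) =
    (\<Sum>a\<in>A. \<Sum>b\<in>A. \<Sum>c\<in>A. if a = b \<or> a = c \<or> b = c then 0 else F (a,b,c) :: int)"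
proof -
  have "(\<Sum>t\<in>ordered_triples A. F t) =
      (\<Sum>t\<in>A \<times> A \<times> A. if fst t = fst (snd t) \<or> fst t = snd (snd t) \<or> fst (snd t) = snd (snd t) then 0 else F t)"
    using assms by (intro sum.mono_neutral_cong_left) (auto simp: ordered_triples_def)
  then show ?thesis by (simp add: sum_cart3)
qed

lemma sum_disjoint_triples:
  assumes "finite A"
  shows "(\<Sum>(s,t)\<in>disjoint_triples A. F s * F t) =
    (\<Sum>a\<in>A. \<Sum>b\<in>A. \<Sum>c\<in>A. F (a,b,c) * (\<Sum>d\<in>A. \<Sum>e\<in>A. \<Sum>k\<in>A. if disj3 (a,b,c) (d,e,k) then F (d,e,k) else 0 :: int))"
proof -
  have "(\<Sum>(s,t)\<in>disjoint_triples A. F s * F t) =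
      (\<Sum>(s,t)\<in>(A \<times> A \<times> A) \<times> (A \<times> A \<times> A). F s * (if disj3 s t then F t else 0))"
    using assms by (intro sum.mono_neutral_cong_left) (auto simp: disjoint_triples_def split: if_splits)
  also have "\<dots> = (\<Sum>s\<in>A \<times> A \<times> A. F s * (\<Sum>t\<in>A \<times> A \<times> A. if disj3 s t then F t else 0))"
    by (simp add: sum.cartesian_product[symmetric] sum_distrib_left del: sum.cartesian_product)
  finally show ?thesis by (simp add: sum_cart3)
qed

text \<open>The number of elements of type \<open>(3,6)\<close> preserving two colourings, as a form in the pair of
  colourings, exceeds a multiple of the identity by positive semidefinite forms and a constant.\<close>

lemma common_patterns_form:
  assumes f: "balanced f A" and g: "balanced g A"
  shows "360 * int (card {xs \<in> permutations_of_set A. map f xs \<in> set patterns \<and> map g xs \<in> set patterns})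
    \<ge> 54 * ((if f = g then 23040 else 0) - 576) + 9 * (\<Sum>t\<in>ordered_triples A. hmass f t * hmass g t)
      + 60 * (\<Sum>(s,t)\<in>disjoint_triples A. (esign f s * esign g s) * (esign f t * esign g t))"
proof -
  obtain ys where ys: "ys \<in> permutations_of_set A" "map f ys = [0,0,0,1,1,1,2,2,2]" "map g ys \<in> set rows"
    using ex_sorting_labelling[OF f g] .
  have finA: "finite A" and cA: "card A = 9" using f balanced_card by (auto simp: balanced_def)
  have len: "length ys = 9" "set ys = A" "distinct ys" using ys(1) cA by (metis distinct_card permutations_of_setD)+
  define L where "L = tagged (map f ys) (map g ys)"
  have L: "L = map (\<lambda>i. (i, f (ys ! i), g (ys ! i))) [0..<9]" unfolding L_def by (rule tagged_map[OF len(1)])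
  have dL: "distinct (map fst L)" by (simp add: L o_def)
  then have dL': "distinct L" by (simp add: distinct_map)
  have tr: "(\<Sum>a\<in>A. F a) = (\<Sum>x\<in>set L. F (ys ! fst x))" for F :: "nat \<Rightarrow> int"
  proof -
    have "(\<Sum>x\<in>set L. F (ys ! fst x)) = (\<Sum>i<9. F (ys ! i))"
      unfolding L set_map by (subst sum.reindex) (auto simp: inj_on_def lessThan_atLeast0)
    then show ?thesis using sum_permutation[OF ys(1), of F] cA by simp
  qed
  have col: "f (ys ! fst x) = fst (snd x)" "g (ys ! fst x) = snd (snd x)" if "x \<in> set L" for x
    using that by (auto simp: L)
  have inj: "ys ! fst x = ys ! fst y \<longleftrightarrow> fst x = fst y" if "x \<in> set L" "y \<in> set L" for x y
    using that len by (auto simp: L nth_eq_iff_index_eq)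
  have H: "(\<Sum>t\<in>ordered_triples A. hmass f t * hmass g t) = 6 * hsum (triples L)"
    unfolding sum_ordered_triples[OF finA] tr sum_triples_hcol[OF dL, symmetric] hmass_def
    by (intro sum.cong refl) (simp add: col inj)
  have dj: "disj3 (ys ! fst x, ys ! fst y, ys ! fst z) (ys ! fst u, ys ! fst v, ys ! fst w) =
      disj3 (fst x, fst y, fst z) (fst u, fst v, fst w)"
    if "x \<in> set L" "y \<in> set L" "z \<in> set L" "u \<in> set L" "v \<in> set L" "w \<in> set L" for x y z u v w
    using that by (simp add: disj3_def inj)
  have W: "(\<Sum>(s,t)\<in>disjoint_triples A. (esign f s * esign g s) * (esign f t * esign g t)) = 72 * wsum (signed (triples L))"
    unfolding sum_disjoint_triples[OF finA, of "\<lambda>s. esign f s * esign g s"] tr sum_triples_esgn[OF dL', symmetric]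
    by (intro sum.cong refl arg_cong2[of _ _ _ _ "(*)"]) (simp_all add: col dj esign_def esgn2_def)
  let ?w = "joint (map f ys) (map g ys)"
  let ?M = "length (matches patterns (map g ys) ?w) * fact_counts ?w"
  have kb: "kernel_bound patterns (map f ys) (map g ys) ?w"
    using kernel_bound_rows ys unfolding list_all_iff by simp
  \<comment> \<open>Division by 18 leads to \<open>kernel_bound\<close>, since 60 * 72 = 54 *
    80.\<close>
  have "54 * ((if f = g then 23040 else 0) - 576) + 9 * (6 * hsum (triples L)) + 60 * (72 * wsum (signed (triples L)))
      \<le> 360 * int ?M"
  proof -
    have "3 * ((if f = g then 23040 else 0) - 576 + hw (triples L)) \<le> 20 * int ?M"
    proof (cases "f = g")
      case True
      then show ?thesis using kb ys(2) unfolding kernel_bound_def L_def by simp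
    next
      \<comment> \<open>If \<open>f\<close> and \<open>g\<close> name the same partition
        differently, \<open>kernel_bound\<close> gives even more than is claimed.\<close>
      case False
      then show ?thesis using kb unfolding kernel_bound_def L_def by (simp split: if_splits)
    qed
    then show ?thesis unfolding hw_def by (simp split: if_splits)
  qed
  moreover have "int ?M \<le> int (card {xs \<in> permutations_of_set A. map f xs \<in> set patterns \<and> map g xs \<in> set patterns})"
    using card_common_patterns_ge[OF f g ys(1)] by (simp only: of_nat_le_iff)
  ultimately show ?thesis unfolding H W by linarith
qed

section \<open>The counting inequality\<close>

text \<open>Cauchy-Schwarz against the constant function, obtained from the sum of all squared
  differences.\<close>

lemma sum_square_le:
  fixes y :: "'a \<Rightarrow> int"
  assumes "finite I"
  shows "(\<Sum>i\<in>I. y i)\<^sup>2 \<le> int (card I) * (\<Sum>i\<in>I. (y i)\<^sup>2)"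
proof -
  have "0 \<le> (\<Sum>i\<in>I. \<Sum>j\<in>I. (y i - y j)\<^sup>2)" by (intro sum_nonneg) auto
  also have "\<dots> = (\<Sum>i\<in>I. \<Sum>j\<in>I. (y i)\<^sup>2 + (y j)\<^sup>2 - 2 * (y i * y j))"
    by (intro sum.cong refl) (simp add: power2_diff)
  also have "\<dots> = 2 * (int (card I) * (\<Sum>i\<in>I. (y i)\<^sup>2)) - 2 * (\<Sum>i\<in>I. \<Sum>j\<in>I. y i * y j)"
    by (simp add: sum.distrib sum_subtractf flip: sum_distrib_left)
  also have "(\<Sum>i\<in>I. \<Sum>j\<in>I. y i * y j) = (\<Sum>i\<in>I. y i)\<^sup>2"
    by (simp add: power2_eq_square sum_product)
  finally show ?thesis by simp
qed

text \<open>Makes positive semidefiniteness explicit: a kernel of Gram form, summed over all pairs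
  from \<open>S\<close>, is a sum of squares.\<close>

lemma sum_gram:
  fixes \<phi> :: "'f \<Rightarrow> 'i \<Rightarrow> int"
  shows "(\<Sum>f\<in>S. \<Sum>g\<in>S. \<Sum>i\<in>I. \<phi> f i * \<phi> g i) = (\<Sum>i\<in>I. (\<Sum>f\<in>S. \<phi> f i)\<^sup>2)"
proof -
  have "(\<Sum>f\<in>S. \<Sum>g\<in>S. \<Sum>i\<in>I. \<phi> f i * \<phi> g i) = (\<Sum>f\<in>S. \<Sum>i\<in>I. \<Sum>g\<in>S. \<phi> f i * \<phi> g i)"
    by (intro sum.cong refl sum.swap)
  also have "\<dots> = (\<Sum>i\<in>I. \<Sum>f\<in>S. \<Sum>g\<in>S. \<phi> f i * \<phi> g i)" by (rule sum.swap)
  finally show ?thesis by (simp add: power2_eq_square sum_product)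
qed

definition first_three :: "nat list \<Rightarrow> nat \<times> nat \<times> nat" where
  "first_three xs = (xs ! 0, xs ! 1, xs ! 2)"

definition support3 :: "nat \<times> nat \<times> nat \<Rightarrow> nat set" where
  "support3 = (\<lambda>(a,b,c). {a,b,c})"

lemma list_of_length_nine:
  assumes "length p = 9" obtains a b c d e f g h i where "p = [a,b,c,d,e,f,g,h,i]"
proof (rule that)
  have "[0..<9] = [0,1,2,3,4,5,6,7,8]" by (simp add: upt_rec)
  then show "p = [p!0, p!1, p!2, p!3, p!4, p!5, p!6, p!7, p!8]"
    using map_nth[of p] assms by (simp del: upt_Suc)
qed

lemma take_three: "length xs = 9 \<Longrightarrow> take 3 xs = [xs ! 0, xs ! 1, xs ! 2]"
  by (erule list_of_length_nine) simp

lemma card_first_three: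
  assumes "card A = 9" "t \<in> ordered_triples A"
  shows "card {xs \<in> permutations_of_set A. first_three xs = t} = 720"
proof -
  obtain a b c where t: "t = (a, b, c)" "a \<in> A" "b \<in> A" "c \<in> A" "a \<noteq> b" "a \<noteq> c" "b \<noteq> c"
    using assms(2) by (auto simp: ordered_triples_def)
  have finA: "finite A" using assms(1) by (metis card.infinite zero_neq_numeral)
  have "{xs \<in> permutations_of_set A. first_three xs = t} = (\<lambda>ys. a # b # c # ys) ` permutations_of_set (A - {a,b,c})" (is "?L = ?R")
  proof (intro equalityI subsetI)
    fix xs assume xs: "xs \<in> ?L"
    then have "length xs = 9" using labelling_nine(2)[OF assms(1)] by simp
    then have "xs = a # b # c # drop 3 xs"
      using xs t take_three[of xs] append_take_drop_id[of 3 xs] by (simp add: first_three_def)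
    then obtain ys where ys: "xs = a # b # c # ys" by blast
    then have "set (a # b # c # ys) = A" "distinct (a # b # c # ys)" using xs by (auto dest: permutations_of_setD simp only:)
    then have "ys \<in> permutations_of_set (A - {a,b,c})" by (auto simp: permutations_of_set_def)
    then show "xs \<in> ?R" using ys by blast
  next
    fix xs assume "xs \<in> ?R"
    then obtain ys where ys: "xs = a # b # c # ys" "set ys = A - {a,b,c}" "distinct ys"
      by (auto dest: permutations_of_setD)
    have "set xs = A" using ys(1,2) t(2-4) by auto
    moreover have "distinct xs" using ys t(5-7) by simp
    ultimately show "xs \<in> ?L" by (simp add: permutations_of_set_def first_three_def ys(1) t(1))
  qed
  then have "card ?L = card (permutations_of_set (A - {a,b,c}))"
    by (simp only:) (rule card_image, simp add: inj_on_def)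
  also have "\<dots> = fact (card (A - {a,b,c}))" using finA by simp
  also have "card (A - {a,b,c}) = 6" using t finA assms(1) by (subst card_Diff_subset) auto
  finally show ?thesis by (simp add: fact_numeral)
qed

lemma card_support3_eq:
  assumes "T \<subseteq> A" "card T = 3"
  shows "card {t \<in> ordered_triples A. support3 t = T} = 6"
proof -
  have finT: "finite T" using assms(2) by (metis card.infinite zero_neq_numeral)
  have "(\<lambda>(a,b,c). [a,b,c]) ` {t \<in> ordered_triples A. support3 t = T} = permutations_of_set T" (is "?f ` ?L = _")
  proof (intro equalityI subsetI)
    fix xs assume "xs \<in> ?f ` ?L"
    then obtain a b c where "xs = [a,b,c]" "a \<noteq> b" "a \<noteq> c" "b \<noteq> c" "T = {a,b,c}"
      by (auto simp: ordered_triples_def support3_def)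
    then show "xs \<in> permutations_of_set T" by (simp add: permutations_of_set_def)
  next
    fix xs assume xs: "xs \<in> permutations_of_set T"
    then have "length xs = 3" using length_labelling assms(2) by metis
    then obtain a b c where abc: "xs = [a,b,c]" by (auto simp: numeral_3_eq_3 length_Suc_conv)
    have "T = {a,b,c}" "a \<noteq> b" "a \<noteq> c" "b \<noteq> c"
      using permutations_of_setD[OF xs] unfolding abc by auto
    then have "(a,b,c) \<in> ?L"
      using assms(1) by (simp add: ordered_triples_def support3_def)
    then show "xs \<in> ?f ` ?L" using abc by (intro image_eqI[of _ _ "(a,b,c)"]) auto
  qed
  moreover have "card (?f ` ?L) = card ?L" by (rule card_image) (auto simp: inj_on_def)
  ultimately have "card ?L = card (permutations_of_set T)" by simp
  then show ?thesis using finT assms(2) by (simp add: fact_numeral)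
qed

text \<open>With \<open>k\<close> the number of colourings in \<open>S\<close> that a labelling sends to a pattern, \<open>x\<close> the indicator of
  its first three points lying in \<open>X\<close>, and \<open>c\<close> the remaining weight, one sums
  \<open>(4 - k) * (k + x + c - 1) \<ge> 0\<close> over all labellings.\<close>

lemma weighted_covering_inequality:
  fixes S :: "(nat \<Rightarrow> nat) set" and X :: "nat set set" and c :: "nat list \<Rightarrow> nat"
  assumes A: "card A = 9" and finS: "finite S" and S: "\<And>f. f \<in> S \<Longrightarrow> balanced f A" "distinct_kernels S A"
    and X: "\<And>T. T \<in> X \<Longrightarrow> T \<subseteq> A \<and> card T = 3"
    and cover: "\<And>xs. xs \<in> permutations_of_set A \<Longrightarrow>
      (\<exists>f\<in>S. map f xs \<in> set patterns) \<or> support3 (first_three xs) \<in> X \<or> 1 \<le> c xs"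
    and c: "(\<Sum>xs\<in>permutations_of_set A. c xs) \<le> 2160 * z"
  shows "(288 * int (card S) + 60 * int (card X))\<^sup>2 \<le>
    10080 * (1248 * int (card S) + 990 * int (card X) + 480 * int z - 80640) + 48384 * (int (card S))\<^sup>2"
proof -
  have finA: "finite A" using A by (metis card.infinite zero_neq_numeral)
  let ?P = "permutations_of_set A" and ?T = "ordered_triples A"
  let ?s = "int (card S)" and ?x = "int (card X)"
  have finP: "finite ?P" using finA by simp
  have finT: "finite ?T" by (rule finite_subset[of _ "A \<times> A \<times> A"]) (use finA in \<open>auto simp: ordered_triples_def\<close>)
  have finX: "finite X" by (rule finite_subset[of _ "Pow A"]) (use X finA in auto)
  have len: "length xs = 9" if "xs \<in> ?P" for xs
    using labelling_nine(2)[OF A that] .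
  have ft: "first_three xs \<in> ?T" if "xs \<in> ?P" for xs
  proof -
    note lab = labelling_nine[OF A that]
    have "xs ! 0 \<in> A" "xs ! 1 \<in> A" "xs ! 2 \<in> A"
      using nth_mem[of 0 xs] nth_mem[of 1 xs] nth_mem[of 2 xs] lab by simp_all
    moreover have "xs ! 0 \<noteq> xs ! 1" "xs ! 0 \<noteq> xs ! 2" "xs ! 1 \<noteq> xs ! 2"
      using lab by (simp_all add: nth_eq_iff_index_eq)
    ultimately show ?thesis by (simp add: ordered_triples_def first_three_def)
  qed
  have group: "(\<Sum>xs\<in>?P. F xs) = (\<Sum>t\<in>?T. \<Sum>xs\<in>{xs \<in> ?P. first_three xs = t}. F xs)" for F :: "nat list \<Rightarrow> int"
    using sum.group[OF finP finT image_subsetI[OF ft], where h = F] by simp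
  define k where "k xs = int (card {f \<in> S. map f xs \<in> set patterns})" for xs
  define \<xi> where "\<xi> t = (if support3 t \<in> X then 1 else 0 :: int)" for t
  \<comment> \<open>By \<open>KT\<close> below, \<open>3 * \<kappa> t\<close> is the sum of
    \<open>k\<close> over the labellings that begin with \<open>t\<close>.\<close>
  define \<kappa> where "\<kappa> t = (\<Sum>f\<in>S. hmass f t)" for t
  have k_sum: "k xs = (\<Sum>f\<in>S. if map f xs \<in> set patterns then 1 else 0)" for xs
    unfolding k_def using finS by (simp add: sum.If_cases Int_def)
  have cardP: "card ?P = 362880" using finA A by (simp add: fact_numeral)
  have K1: "(\<Sum>xs\<in>?P. k xs) = 5184 * ?s"
  proof -
    have "(\<Sum>xs\<in>?P. k xs) = (\<Sum>f\<in>S. \<Sum>xs\<in>?P. if map f xs \<in> set patterns then 1 else 0)"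
      unfolding k_sum by (rule sum.swap)
    also have "\<dots> = (\<Sum>f\<in>S. 5184)"
      using finP card_labelling_pattern[OF S(1)] by (intro sum.cong refl) (simp add: sum.If_cases Int_def)
    finally show ?thesis by simp
  qed
  have KT: "(\<Sum>xs\<in>{xs \<in> ?P. first_three xs = t}. k xs) = 3 * \<kappa> t" if t: "t \<in> ?T" for t
  proof -
    obtain a b d where abd: "t = (a, b, d)" "a \<in> A" "b \<in> A" "d \<in> A" "distinct [a, b, d]"
      using t by (auto simp: ordered_triples_def)
    have "(\<Sum>xs\<in>{xs \<in> ?P. first_three xs = t}. k xs) =
        (\<Sum>f\<in>S. \<Sum>xs\<in>{xs \<in> ?P. first_three xs = t}. if map f xs \<in> set patterns then 1 else 0)"
      unfolding k_sum by (rule sum.swap)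
    also have "\<dots> = (\<Sum>f\<in>S. 3 * hmass f t)"
    proof (intro sum.cong refl)
      fix f assume f: "f \<in> S"
      have "(\<Sum>xs\<in>{xs \<in> ?P. first_three xs = t}. if map f xs \<in> set patterns then 1 else 0) =
          int (card ({xs \<in> ?P. first_three xs = t} \<inter> {xs. map f xs \<in> set patterns}))"
        using finP by (simp add: sum.If_cases)
      also have "{xs \<in> ?P. first_three xs = t} \<inter> {xs. map f xs \<in> set patterns} =
          {xs \<in> ?P. map f xs \<in> set patterns \<and> take 3 xs = [a, b, d]}"
        using len take_three by (auto simp: abd(1) first_three_def)
      also have "int (card \<dots>) = 3 * hmass f t"
        using card_labelling_pattern_triple[OF S(1)[OF f] abd(2-5)] by (simp add: hmass_def abd(1))
      finally show "(\<Sum>xs\<in>{xs \<in> ?P. first_three xs = t}. if map f xs \<in> set patterns then 1 else 0) = 3 * hmass f t" .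
    qed
    finally show ?thesis by (simp add: \<kappa>_def sum_distrib_left)
  qed
  have sum\<kappa>: "(\<Sum>t\<in>?T. \<kappa> t) = 1728 * ?s"
  proof -
    have "5184 * ?s = (\<Sum>t\<in>?T. 3 * \<kappa> t)" using K1 KT unfolding group[of k] by simp
    then show ?thesis by (simp add: sum_distrib_left[symmetric])
  qed
  have cardT: "int (card ?T) = 504"
  proof -
    have "(\<Sum>xs\<in>?P. 1) = (\<Sum>t\<in>?T. 720 :: int)"
      unfolding group using card_first_three[OF A] by (intro sum.cong refl) simp
    then show ?thesis using cardP by simp
  qed
  have sum\<xi>: "(\<Sum>t\<in>?T. \<xi> t) = 6 * ?x"
  proof -
    have "(\<Sum>t\<in>?T. \<xi> t) = (\<Sum>t\<in>{t \<in> ?T. support3 t \<in> X}. 1)"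
      unfolding \<xi>_def using finT by (simp add: sum.If_cases Int_def)
    also have "\<dots> = (\<Sum>U\<in>X. \<Sum>t\<in>{t \<in> {t \<in> ?T. support3 t \<in> X}. support3 t = U}. 1)"
      using finT finX by (intro sum.group[symmetric]) auto
    also have "\<dots> = (\<Sum>U\<in>X. 6)"
    proof (intro sum.cong refl)
      fix U assume U: "U \<in> X"
      then have "{t \<in> {t \<in> ?T. support3 t \<in> X}. support3 t = U} = {t \<in> ?T. support3 t = U}" by auto
      then show "(\<Sum>t\<in>{t \<in> {t \<in> ?T. support3 t \<in> X}. support3 t = U}. 1) = (6 :: int)"
        using card_support3_eq[of U A] X[OF U] by simp
    qed
    finally show ?thesis by simp
  qed
  have X1: "(\<Sum>xs\<in>?P. \<xi> (first_three xs)) = 4320 * ?x"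
  proof -
    have "(\<Sum>xs\<in>?P. \<xi> (first_three xs)) = (\<Sum>t\<in>?T. \<Sum>xs\<in>{xs \<in> ?P. first_three xs = t}. \<xi> t)"
      unfolding group by (intro sum.cong refl) auto
    also have "\<dots> = (\<Sum>t\<in>?T. 720 * \<xi> t)" using card_first_three[OF A] by (intro sum.cong refl) simp
    finally show ?thesis using sum\<xi> by (simp add: sum_distrib_left[symmetric])
  qed
  have KX: "(\<Sum>xs\<in>?P. k xs * \<xi> (first_three xs)) = 3 * (\<Sum>t\<in>?T. \<kappa> t * \<xi> t)"
  proof -
    have "(\<Sum>xs\<in>?P. k xs * \<xi> (first_three xs)) = (\<Sum>t\<in>?T. \<Sum>xs\<in>{xs \<in> ?P. first_three xs = t}. k xs * \<xi> t)"
      unfolding group by (intro sum.cong refl) auto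
    also have "\<dots> = (\<Sum>t\<in>?T. 3 * (\<kappa> t * \<xi> t))"
      using KT by (intro sum.cong refl) (simp add: sum_distrib_right[symmetric])
    finally show ?thesis by (simp add: sum_distrib_left)
  qed
  define M where "M f g = int (card {xs \<in> ?P. map f xs \<in> set patterns \<and> map g xs \<in> set patterns})" for f g
  have K2: "(\<Sum>xs\<in>?P. (k xs)\<^sup>2) = (\<Sum>f\<in>S. \<Sum>g\<in>S. M f g)"
  proof -
    have "(\<Sum>xs\<in>?P. (k xs)\<^sup>2) = (\<Sum>f\<in>S. \<Sum>g\<in>S. \<Sum>xs\<in>?P.
        (if map f xs \<in> set patterns then 1 else 0) * (if map g xs \<in> set patterns then 1 else 0))"
      unfolding k_sum by (rule sum_gram[symmetric])
    also have "\<dots> = (\<Sum>f\<in>S. \<Sum>g\<in>S. M f g)"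
    proof (intro sum.cong refl)
      fix f g
      have "(\<Sum>xs\<in>?P. (if map f xs \<in> set patterns then 1 else 0) * (if map g xs \<in> set patterns then 1 else 0)) =
        (\<Sum>xs\<in>?P. if map f xs \<in> set patterns \<and> map g xs \<in> set patterns then 1 else 0 :: int)"
        by (intro sum.cong refl) simp
      then show "(\<Sum>xs\<in>?P. (if map f xs \<in> set patterns then 1 else 0) * (if map g xs \<in> set patterns then 1 else 0)) = M f g"
        unfolding M_def using finP by (simp add: sum.If_cases Int_def)
    qed
    finally show ?thesis .
  qed
  \<comment> \<open>\<open>common_patterns_form\<close> summed over all pairs from \<open>S\<close>:
    the constants give \<open>23040 * ?s\<close> on the diagonal and -576 for every pair, the form
    in \<open>hmass\<close> gives the squares of \<kappa>, and the form in \<open>esign\<close> is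
    discarded as nonnegative.\<close>
  have K2_ge: "54 * (23040 * ?s - 576 * ?s\<^sup>2) + 9 * (\<Sum>t\<in>?T. (\<kappa> t)\<^sup>2) \<le> 360 * (\<Sum>xs\<in>?P. (k xs)\<^sup>2)"
  proof -
    have "54 * (23040 * ?s - 576 * ?s\<^sup>2) = (\<Sum>f\<in>S. \<Sum>g\<in>S. 54 * ((if f = g then 23040 else 0) - 576))"
      using finS by (simp add: sum_distrib_left[symmetric] sum_subtractf power2_eq_square algebra_simps)
    moreover have "9 * (\<Sum>t\<in>?T. (\<kappa> t)\<^sup>2) = (\<Sum>f\<in>S. \<Sum>g\<in>S. 9 * (\<Sum>t\<in>?T. hmass f t * hmass g t))"
      unfolding \<kappa>_def sum_gram[symmetric] by (simp add: sum_distrib_left)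
    moreover have "0 \<le> (\<Sum>f\<in>S. \<Sum>g\<in>S. 60 * (\<Sum>(s,t)\<in>disjoint_triples A. (esign f s * esign g s) * (esign f t * esign g t)))"
    proof -
      \<comment> \<open>Regrouping the four signs by colouring instead of by triple exhibits a Gram
        form.\<close>
      have "(\<Sum>f\<in>S. \<Sum>g\<in>S. 60 * (\<Sum>(s,t)\<in>disjoint_triples A. (esign f s * esign g s) * (esign f t * esign g t))) =
        60 * (\<Sum>f\<in>S. \<Sum>g\<in>S. \<Sum>i\<in>disjoint_triples A. (esign f (fst i) * esign f (snd i)) * (esign g (fst i) * esign g (snd i)))"
        by (simp add: sum_distrib_left split_def algebra_simps)
      also have "\<dots> = 60 * (\<Sum>i\<in>disjoint_triples A. (\<Sum>f\<in>S. esign f (fst i) * esign f (snd i))\<^sup>2)"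
        by (simp only: sum_gram)
      finally show ?thesis by (simp add: sum_nonneg)
    qed
    moreover have "(\<Sum>f\<in>S. \<Sum>g\<in>S. 54 * ((if f = g then 23040 else 0) - 576)) +
        (\<Sum>f\<in>S. \<Sum>g\<in>S. 9 * (\<Sum>t\<in>?T. hmass f t * hmass g t)) +
        (\<Sum>f\<in>S. \<Sum>g\<in>S. 60 * (\<Sum>(s,t)\<in>disjoint_triples A. (esign f s * esign g s) * (esign f t * esign g t))) \<le>
        (\<Sum>f\<in>S. \<Sum>g\<in>S. 360 * M f g)"
      unfolding sum.distrib[symmetric] M_def using S(1) common_patterns_form
      by (intro sum_mono) auto
    ultimately show ?thesis unfolding K2 by (simp add: sum_distrib_left)
  qed
  have point: "0 \<le> - (k xs)\<^sup>2 + 5 * k xs - 4 - k xs * \<xi> (first_three xs) + 4 * \<xi> (first_three xs) + 4 * int (c xs)"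
    if xs: "xs \<in> ?P" for xs
  proof -
    have k4: "k xs \<le> 4" "0 \<le> k xs" unfolding k_def using card_patterns_le_four[OF S(2) xs A] by auto
    have "1 \<le> k xs + \<xi> (first_three xs) + int (c xs)"
    proof -
      have k1: "1 \<le> k xs" if "\<exists>f\<in>S. map f xs \<in> set patterns"
      proof -
        have "card {f \<in> S. map f xs \<in> set patterns} \<noteq> 0" using that finS by auto
        then show ?thesis unfolding k_def by linarith
      qed
      have "0 \<le> \<xi> (first_three xs)" by (simp add: \<xi>_def)
      moreover have "support3 (first_three xs) \<in> X \<Longrightarrow> \<xi> (first_three xs) = 1" by (simp add: \<xi>_def)
      ultimately show ?thesis using cover[OF xs] k1 k4(2) by linarith
    qed
    \<comment> \<open>Expansion leaves the term \<open>- k xs * int (c xs)\<close>, which is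
      discarded by its sign.\<close>
    then have "0 \<le> (4 - k xs) * (k xs + \<xi> (first_three xs) + int (c xs) - 1)"
      using k4 by (intro mult_nonneg_nonneg) auto
    moreover have "0 \<le> k xs * int (c xs)" using k4 by simp
    ultimately show ?thesis by (simp add: algebra_simps power2_eq_square)
  qed
  have "0 \<le> (\<Sum>xs\<in>?P. - (k xs)\<^sup>2 + 5 * k xs - 4 - k xs * \<xi> (first_three xs) + 4 * \<xi> (first_three xs) + 4 * int (c xs))"
    by (intro sum_nonneg point)
  also have "\<dots> = - (\<Sum>xs\<in>?P. (k xs)\<^sup>2) + 5 * (\<Sum>xs\<in>?P. k xs) - 4 * 362880
      - (\<Sum>xs\<in>?P. k xs * \<xi> (first_three xs)) + 4 * (\<Sum>xs\<in>?P. \<xi> (first_three xs)) + 4 * (\<Sum>xs\<in>?P. int (c xs))"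
    using cardP by (simp add: sum.distrib sum_subtractf sum_negf sum_distrib_left)
  finally have main: "(\<Sum>xs\<in>?P. (k xs)\<^sup>2) + 3 * (\<Sum>t\<in>?T. \<kappa> t * \<xi> t) \<le>
      25920 * ?s - 1451520 + 17280 * ?x + 4 * (\<Sum>xs\<in>?P. int (c xs))"
    unfolding K1 KX X1 by simp
  have "(\<Sum>xs\<in>?P. int (c xs)) \<le> 2160 * int z" using c by (simp flip: of_nat_sum)
  then have main2: "9 * (\<Sum>t\<in>?T. (\<kappa> t)\<^sup>2) + 1080 * (\<Sum>t\<in>?T. \<kappa> t * \<xi> t) \<le>
      8087040 * ?s - 522547200 + 6220800 * ?x + 3110400 * int z + 31104 * ?s\<^sup>2"
    using main K2_ge by simp
  \<comment> \<open>The square is completed, using that \<xi> is 0 or 1, so that Cauchy-Schwarz over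
    the 504 ordered triples applies to \<open>\<kappa> + 60 * \<xi>\<close>, whose sum is
    known.\<close>
  have "(\<Sum>t\<in>?T. (\<kappa> t + 60 * \<xi> t)\<^sup>2) = (\<Sum>t\<in>?T. (\<kappa> t)\<^sup>2 + 120 * (\<kappa> t * \<xi> t) + 3600 * \<xi> t)"
    by (intro sum.cong refl) (simp add: power2_eq_square \<xi>_def algebra_simps)
  also have "\<dots> = (\<Sum>t\<in>?T. (\<kappa> t)\<^sup>2) + 120 * (\<Sum>t\<in>?T. \<kappa> t * \<xi> t) + 3600 * (\<Sum>t\<in>?T. \<xi> t)"
    by (simp add: sum.distrib sum_distrib_left)
  finally have sq: "9 * (\<Sum>t\<in>?T. (\<kappa> t + 60 * \<xi> t)\<^sup>2) \<le>
      8087040 * ?s - 522547200 + 6415200 * ?x + 3110400 * int z + 31104 * ?s\<^sup>2"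
    using main2 sum\<xi> by simp
  define q where "q = 288 * ?s + 60 * ?x"
  have "(\<Sum>t\<in>?T. \<kappa> t + 60 * \<xi> t) = 6 * q"
    using sum\<kappa> sum\<xi> by (simp add: q_def sum.distrib sum_distrib_left[symmetric])
  then have "36 * q\<^sup>2 \<le> 504 * (\<Sum>t\<in>?T. (\<kappa> t + 60 * \<xi> t)\<^sup>2)"
    using sum_square_le[OF finT, of "\<lambda>t. \<kappa> t + 60 * \<xi> t"] unfolding cardT by (simp add: power_mult_distrib)
  have "q\<^sup>2 \<le> 10080 * (1248 * ?s + 990 * ?x + 480 * int z - 80640) + 48384 * ?s\<^sup>2"
  proof -
    have le: "9 * q2 \<le> 14 * R" if "36 * q2 \<le> 504 * E" "9 * E \<le> R" for q2 E R :: int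
      using that by linarith
    let ?R = "8087040 * ?s - 522547200 + 6415200 * ?x + 3110400 * int z + 31104 * ?s\<^sup>2"
    have "9 * q\<^sup>2 \<le> 14 * ?R" by (rule le[OF \<open>36 * q\<^sup>2 \<le> _\<close> sq])
    also have "14 * ?R = 9 * (10080 * (1248 * ?s + 990 * ?x + 480 * int z - 80640) + 48384 * ?s\<^sup>2)"
      by (simp add: algebra_simps)
    finally show ?thesis by (simp only: mult_le_cancel_left_pos zero_less_numeral)
  qed
  then show ?thesis by (simp only: q_def)
qed

section \<open>The members of a cover\<close>

context perm_group
begin

text \<open>Without transitivity, an orbit or its complement has at most four of the nine points.
  The translates of a block have equal size, which divides 9 and is therefore 3.\<close>

lemma primitive_on_if_no_invariants:
  assumes card: "card \<Omega> = 9"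
    and inv: "\<And>Y. Y \<subseteq> \<Omega> \<Longrightarrow> 1 \<le> card Y \<Longrightarrow> card Y \<le> 4 \<Longrightarrow> \<exists>h\<in>H. h ` Y \<noteq> Y"
    and part: "\<And>P. partition_on \<Omega> P \<Longrightarrow> \<forall>D\<in>P. card D = 3 \<Longrightarrow> \<exists>h\<in>H. \<exists>D\<in>P. h ` D \<notin> P"
  shows "primitive_on \<Omega>"
proof -
  have trans: "\<exists>h\<in>H. h a = b" if ab: "a \<in> \<Omega>" "b \<in> \<Omega>" for a b
  proof (rule ccontr)
    assume no: "\<not> (\<exists>h\<in>H. h a = b)"
    define O' where "O' = (\<lambda>h. h a) ` H"
    have sub: "O' \<subseteq> \<Omega>" using ab apply_mem by (auto simp: O'_def)
    have finO: "finite O'" using sub finite_points finite_subset by blast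
    have a: "a \<in> O'" unfolding O'_def by (rule image_eqI[OF _ id_mem]) simp
    have b: "b \<notin> O'" using no by (auto simp: O'_def)
    have im: "h ` O' = O'" if h: "h \<in> H" for h
    proof (rule card_subset_eq[OF finO])
      show "h ` O' \<subseteq> O'"
      proof
        fix y assume "y \<in> h ` O'"
        then obtain g where "g \<in> H" "y = (h \<circ> g) a" by (auto simp: O'_def)
        then show "y \<in> O'" unfolding O'_def using comp_mem[OF h] by blast
      qed
    qed (rule card_image_mem[OF h])
    have im': "h ` (\<Omega> - O') = \<Omega> - O'" if h: "h \<in> H" for h
      using image_set_diff[OF inj_mem[OF h], of \<Omega> O'] im[OF h] image_points[OF h] by simp
    have sum: "card O' + card (\<Omega> - O') = 9"
      using card_Diff_subset[OF finO sub] card_mono[OF finite_points sub] card by simp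
    have "1 \<le> card O'" using a finO by (auto simp: Suc_le_eq card_gt_0_iff)
    moreover have "1 \<le> card (\<Omega> - O')" using b ab finite_points by (auto simp: Suc_le_eq card_gt_0_iff)
    ultimately show False
      using inv[of O'] inv[of "\<Omega> - O'"] im im' sub sum by (cases "card O' \<le> 4") auto
  qed
  show ?thesis unfolding primitive_on_def supported_all
  proof (intro conjI ballI allI impI)
    fix a b assume "a \<in> \<Omega>" "b \<in> \<Omega>" then show "\<exists>h\<in>H. h a = b" by (rule trans)
  next
    fix \<Delta> assume \<Delta>: "\<Delta> \<subseteq> \<Omega>" "2 \<le> card \<Delta>" "\<Delta> \<noteq> \<Omega>"
    show "\<exists>h\<in>H. h ` \<Delta> \<inter> \<Delta> \<noteq> {} \<and> h ` \<Delta> \<noteq> \<Delta>"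
    proof (rule ccontr)
      assume block: "\<not> ?thesis"
      define P where "P = (\<lambda>h. h ` \<Delta>) ` H"
      obtain a where a: "a \<in> \<Delta>" using \<Delta>(2) by fastforce
      have un: "\<Union>P = \<Omega>"
      proof (intro equalityI subsetI)
        fix x assume "x \<in> \<Union>P" then show "x \<in> \<Omega>" using \<Delta>(1) apply_mem by (auto simp: P_def)
      next
        fix x assume "x \<in> \<Omega>"
        then obtain h where "h \<in> H" "h a = x" using trans a \<Delta>(1) by blast
        then show "x \<in> \<Union>P" using a by (auto simp: P_def)
      qed
      have disj: "C = D" if CD: "C \<in> P" "D \<in> P" "C \<inter> D \<noteq> {}" for C D
      proof -
        obtain g h where gh: "g \<in> H" "C = g ` \<Delta>" "h \<in> H" "D = h ` \<Delta>" using CD by (auto simp: P_def)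
        obtain x y where xy: "x \<in> \<Delta>" "y \<in> \<Delta>" "g x = h y" using CD(3) gh by blast
        have k: "inv' g \<circ> h \<in> H" using gh comp_mem inv_mem by blast
        have "(inv' g \<circ> h) y = x" using xy(3) gh by (simp add: inv_eq_iff)
        then have "(inv' g \<circ> h) ` \<Delta> \<inter> \<Delta> \<noteq> {}" using xy by (metis disjoint_iff imageI)
        then have "(inv' g \<circ> h) ` \<Delta> = \<Delta>" using block k by blast
        then have "g ` ((inv' g \<circ> h) ` \<Delta>) = g ` \<Delta>" by simp
        moreover have "g ` ((inv' g \<circ> h) ` \<Delta>) = h ` \<Delta>" unfolding image_comp using gh by (intro image_cong) auto
        ultimately show ?thesis using gh by simp
      qed
      have cardD: "card D = card \<Delta>" if "D \<in> P" for D using that card_image_mem by (auto simp: P_def)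
      have "card \<Delta> dvd card (\<Union>P)"
        using un finite_points cardD disj by (intro dvd_partition) (simp, simp, blast)
      then obtain m where m: "9 = card \<Delta> * m" using un card by (auto simp: dvd_def)
      have "card \<Delta> < 9" using \<Delta> card finite_points psubset_card_mono[of \<Omega> \<Delta>] by auto
      then have "card \<Delta> \<in> {2,3,4,5,6,7,8}" using \<Delta>(2) by auto
      then have "card \<Delta> = 3" using m by (elim insertE emptyE; simp; presburger)
      then have "\<forall>D\<in>P. card D = 3" using cardD by simp
      moreover have "partition_on \<Omega> P"
      proof (rule partition_onI)
        show "{} \<notin> P" using a by (auto simp: P_def)
        show "\<Union>P = \<Omega>" by (rule un)
        show "\<And>p q. p \<in> P \<Longrightarrow> q \<in> P \<Longrightarrow> p \<noteq> q \<Longrightarrow> disjnt p q" using disj by (auto simp: disjnt_def)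
      qed
      moreover have "h ` D \<in> P" if hD: "h \<in> H" "D \<in> P" for h D
      proof -
        obtain g where "g \<in> H" "D = g ` \<Delta>" using hD by (auto simp: P_def)
        then have "h ` D = (h \<circ> g) ` \<Delta>" "h \<circ> g \<in> H" using comp_mem hD by (auto simp: image_comp)
        then show ?thesis unfolding P_def by blast
      qed
      ultimately show False using part by blast
    qed
  qed
qed

end

text \<open>The long cycle has at least five points, so \<open>Y\<close> cannot meet it and must be
  the whole short cycle.\<close>

lemma two_cycles_invariant:
  assumes xs: "distinct xs" "length xs = 9" and r: "r \<le> 4"
    and Y: "Y \<subseteq> set xs" "Y \<noteq> {}" "card Y \<le> 4" "two_cycles r xs ` Y = Y"
  shows "r \<noteq> 0 \<and> Y = set (take r xs)"
proof -
  have finY: "finite Y" using Y(1) finite_subset by blast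
  have pow: "(two_cycles r xs ^^ n) y \<in> Y" if "y \<in> Y" for n y
    using that Y(4) by (induction n) auto
  have low: "i < r" if i: "i < 9" "xs ! i \<in> Y" for i
  proof (rule ccontr)
    assume ir: "\<not> i < r"
    have "xs ! j \<in> Y" if j: "r \<le> j" "j < 9" for j
    proof -
      \<comment> \<open>The exponent leads from position \<open>i\<close> to \<open>j\<close> within
        the long cycle; a full turn \<open>9 - r\<close> is added so that the subtraction does not
        truncate.\<close>
      have e: "i - r + (9 - r + (j - r) - (i - r)) = (j - r) + (9 - r)" using i ir j by simp
      have "two_cycles_index r 9 (9 - r + (j - r) - (i - r)) i = r + ((j - r) + (9 - r)) mod (9 - r)"
        using ir e by (simp only: two_cycles_index_def if_False)
      also have "((j - r) + (9 - r)) mod (9 - r) = j - r" unfolding mod_add_self2 using j by simp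
      finally have "two_cycles_index r 9 (9 - r + (j - r) - (i - r)) i = j" using j by simp
      then show ?thesis
        using pow[OF i(2), of "9 - r + (j - r) - (i - r)"] two_cycles_funpow_nth[of xs r i] xs r i by simp
    qed
    then have "(!) xs ` {r..<9} \<subseteq> Y" by auto
    then have "card ((!) xs ` {r..<9}) \<le> card Y" by (rule card_mono[OF finY])
    moreover have "card ((!) xs ` {r..<9}) = 9 - r"
      using card_image[OF inj_on_nth[of xs "{r..<9}"]] xs by simp
    ultimately show False using r Y(3) by linarith
  qed
  obtain i where i: "i < 9" "xs ! i \<in> Y" using Y(1,2) xs by (metis ex_in_conv in_set_conv_nth subsetD)
  have ir: "i < r" using low[OF i] .
  have "xs ! j \<in> Y" if j: "j < r" for j
  proof -
    have "two_cycles_index r 9 (r + j - i) i = j"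
      using ir j by (simp add: two_cycles_index_def)
    then show ?thesis
      using pow[OF i(2), of "r + j - i"] two_cycles_funpow_nth[of xs r i] xs r i by simp
  qed
  then have "set (take r xs) \<subseteq> Y" by (auto simp: in_set_conv_nth)
  moreover have "Y \<subseteq> set (take r xs)"
  proof
    fix y assume y: "y \<in> Y"
    then obtain j where j: "j < 9" "y = xs ! j" using Y(1) xs by (metis in_set_conv_nth subsetD)
    then have "j < r" using low y by blast
    then show "y \<in> set (take r xs)" using j xs by (auto simp: in_set_conv_nth)
  qed
  ultimately show ?thesis using ir by auto
qed

section \<open>Parity, and colourings preserved by elements with two cycles\<close>

lemma evenperm_cycle_of_list: "distinct cs \<Longrightarrow> evenperm (cycle_of_list cs) \<longleftrightarrow> cs = [] \<or> odd (length cs)"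
proof (induction cs rule: cycle_of_list.induct)
  case (1 i j cs)
  have "evenperm (cycle_of_list (i # j # cs)) \<longleftrightarrow> \<not> evenperm (cycle_of_list (j # cs))"
    using 1(2) by (simp add: evenperm_comp permutation_swap_id permutation_of_cycle evenperm_swap)
  then show ?case using 1 by (simp del: cycle_of_list.simps)
qed (simp_all add: evenperm_id[unfolded id_def] id_def)

text \<open>The lengths r and 9 - r have different parity, so for positive \<open>r\<close> exactly
  one cycle is odd. For \<open>r = 0\<close> the empty cycle is the identity.\<close>

lemma evenperm_two_cycles:
  assumes "distinct xs" "length xs = 9" "r < 9"
  shows "evenperm (two_cycles r xs) \<longleftrightarrow> r = 0"
proof -
  have "evenperm (two_cycles r xs) \<longleftrightarrow> evenperm (cycle_of_list (take r xs)) = evenperm (cycle_of_list (drop r xs))"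
    unfolding two_cycles_def by (rule evenperm_comp[OF permutation_of_cycle permutation_of_cycle])
  then show ?thesis using assms by (auto simp: evenperm_cycle_of_list)
qed

text \<open>Invariance of the partition of the positions: the colours themselves may be
  permuted.\<close>

definition preserved_by_cycles :: "nat \<Rightarrow> nat list \<Rightarrow> bool" where
  "preserved_by_cycles r p \<longleftrightarrow> (\<forall>i<9. \<forall>j<9. p ! i = p ! j \<longleftrightarrow>
     p ! two_cycles_index r 9 1 i = p ! two_cycles_index r 9 1 j)"

lemma preserved_by_cyclesD:
  "preserved_by_cycles r p \<Longrightarrow> i < 9 \<Longrightarrow> j < 9 \<Longrightarrow> p ! i = p ! j \<longleftrightarrow>
     p ! two_cycles_index r 9 1 i = p ! two_cycles_index r 9 1 j"
  unfolding preserved_by_cycles_def by blast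

lemma balanced_list_lt: "mset p = mset [0,0,0,1,1,1,2,2,2] \<Longrightarrow> a \<in> set p \<Longrightarrow> a \<in> {0,1,2::nat}"
  by (drule arg_cong[of _ _ set_mset]) auto

text \<open>Position 0 is fixed and the others form one cycle, so the colour class of position 0
  would have 1 or 9 elements.\<close>

lemma not_preserved_by_cycles_one:
  assumes "mset p = mset [0,0,0,1,1,1,2,2,2::nat]" "preserved_by_cycles 1 p" shows False
proof -
  have "length p = 9" using arg_cong[OF assms(1), of size] by simp
  then obtain a b c d e f g h i where p: "p = [a,b,c,d,e,f,g,h,i]" by (rule list_of_length_nine)
  note K = preserved_by_cyclesD[OF assms(2), of 0, unfolded p]
  have "a = b \<longleftrightarrow> a = c" "a = c \<longleftrightarrow> a = d" "a = d \<longleftrightarrow> a = e" "a = e \<longleftrightarrow> a = f" "a = f \<longleftrightarrow> a = g" "a = g \<longleftrightarrow> a = h" "a = h \<longleftrightarrow> a = i"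
    using K[of 1] K[of 2] K[of 3] K[of 4] K[of 5] K[of 6] K[of 7] by (simp_all add: two_cycles_index_def)
  moreover have "count (mset p) a = 3"
    using balanced_list_lt[OF assms(1), of a] unfolding assms(1) by (auto simp: p)
  ultimately show False unfolding p by (cases "a = b") auto
qed

text \<open>As 2 and 7 are coprime, all pairs with one position in either cycle are equivalent. So
  the class of position 0 contains the whole 7-cycle or stays within the 2-cycle.\<close>

lemma not_preserved_by_cycles_two:
  assumes "mset p = mset [0,0,0,1,1,1,2,2,2::nat]" "preserved_by_cycles 2 p" shows False
proof -
  have "length p = 9" using arg_cong[OF assms(1), of size] by simp
  then obtain a b c d e f g h i where p: "p = [a,b,c,d,e,f,g,h,i]" by (rule list_of_length_nine)
  note K = preserved_by_cyclesD[OF assms(2), unfolded p]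
  have chain: "a = c \<longleftrightarrow> b = d" "b = d \<longleftrightarrow> a = e" "a = e \<longleftrightarrow> b = f" "b = f \<longleftrightarrow> a = g" "a = g \<longleftrightarrow> b = h" "b = h \<longleftrightarrow> a = i"
    "a = i \<longleftrightarrow> b = c" "b = c \<longleftrightarrow> a = d" "a = d \<longleftrightarrow> b = e" "b = e \<longleftrightarrow> a = f" "a = f \<longleftrightarrow> b = g" "b = g \<longleftrightarrow> a = h" "a = h \<longleftrightarrow> b = i"
    using K[of 0 2] K[of 1 3] K[of 0 4] K[of 1 5] K[of 0 6] K[of 1 7] K[of 0 8] K[of 1 2] K[of 0 3] K[of 1 4] K[of 0 5] K[of 1 6] K[of 0 7]
    by (simp_all add: two_cycles_index_def)
  have "count (mset p) a = 3"
    using balanced_list_lt[OF assms(1), of a] unfolding assms(1) by (auto simp: p)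
  moreover have "a = c \<and> a = d \<and> a = e \<and> a = f \<or> a \<noteq> c \<and> a \<noteq> d \<and> a \<noteq> e \<and> a \<noteq> f \<and> a \<noteq> g \<and> a \<noteq> h \<and> a \<noteq> i"
    using chain by argo
  ultimately show False unfolding p by (auto split: if_splits)
qed

text \<open>As for type (2,7), no class can meet both cycles; but then the 4-cycle would be a union
  of classes of size 3.\<close>

lemma not_preserved_by_cycles_four:
  assumes "mset p = mset [0,0,0,1,1,1,2,2,2::nat]" "preserved_by_cycles 4 p" shows False
proof -
  have "length p = 9" using arg_cong[OF assms(1), of size] by simp
  then obtain a b c d e f g h i where p: "p = [a,b,c,d,e,f,g,h,i]" by (rule list_of_length_nine)
  note K = preserved_by_cyclesD[OF assms(2), unfolded p]
  have chain: "a = e \<longleftrightarrow> b = f" "b = f \<longleftrightarrow> c = g" "c = g \<longleftrightarrow> d = h" "d = h \<longleftrightarrow> a = i" "a = i \<longleftrightarrow> b = e" "b = e \<longleftrightarrow> c = f" "c = f \<longleftrightarrow> d = g"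
    "d = g \<longleftrightarrow> a = h" "a = h \<longleftrightarrow> b = i" "b = i \<longleftrightarrow> c = e" "c = e \<longleftrightarrow> d = f" "d = f \<longleftrightarrow> a = g" "a = g \<longleftrightarrow> b = h" "b = h \<longleftrightarrow> c = i"
    "c = i \<longleftrightarrow> d = e" "d = e \<longleftrightarrow> a = f" "a = f \<longleftrightarrow> b = g" "b = g \<longleftrightarrow> c = h" "c = h \<longleftrightarrow> d = i"
    using K[of 0 4] K[of 1 5] K[of 2 6] K[of 3 7] K[of 0 8] K[of 1 4] K[of 2 5] K[of 3 6] K[of 0 7] K[of 1 8] K[of 2 4] K[of 3 5]
      K[of 0 6] K[of 1 7] K[of 2 8] K[of 3 4] K[of 0 5] K[of 1 6] K[of 2 7]
    by (simp_all add: two_cycles_index_def)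
  have cnt: "count (mset p) x = 3" if "x \<in> set p" for x
    using balanced_list_lt[OF assms(1) that] unfolding assms(1) by auto
  show False
  proof (cases "a = e")
    case True
    then have "a = e" "a = f" "a = g" "a = h" "a = i" using chain by simp_all
    then show False using cnt[of a] unfolding p by (simp split: if_splits)
  next
    case False
    then have ne: "a \<noteq> e" "a \<noteq> f" "a \<noteq> g" "a \<noteq> h" "a \<noteq> i" "b \<noteq> e" "b \<noteq> f" "b \<noteq> g" "b \<noteq> h" "b \<noteq> i"
      "c \<noteq> e" "c \<noteq> f" "c \<noteq> g" "c \<noteq> h" "c \<noteq> i" "d \<noteq> e" "d \<noteq> f" "d \<noteq> g" "d \<noteq> h" "d \<noteq> i"
      using chain by simp_all
    then show False using cnt[of a] cnt[of b] cnt[of c] cnt[of d] unfolding p by (auto split: if_splits)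
  qed
qed

text \<open>Either the 3-cycle is a colour class, and then the other two colours alternate on the
  6-cycle, or it has all three colours, and then the first colour on the 6-cycle determines the
  rest.\<close>

lemma pattern_if_preserved_by_cycles_three:
  assumes m: "mset p = mset [0,0,0,1,1,1,2,2,2::nat]" and "preserved_by_cycles 3 p" shows "p \<in> set patterns"
proof -
  have "length p = 9" using arg_cong[OF m, of size] by simp
  then obtain a b c d e f g h i where p: "p = [a,b,c,d,e,f,g,h,i]" by (rule list_of_length_nine)
  note K = preserved_by_cyclesD[OF assms(2), unfolded p]
  have abc: "a = b \<longleftrightarrow> b = c" "b = c \<longleftrightarrow> c = a"
    using K[of 0 1] K[of 1 2] by (simp_all add: two_cycles_index_def)
  have cross: "a = d \<longleftrightarrow> b = e" "b = e \<longleftrightarrow> c = f" "c = f \<longleftrightarrow> a = g" "a = g \<longleftrightarrow> b = h" "b = h \<longleftrightarrow> c = i"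
    "b = d \<longleftrightarrow> c = e" "c = e \<longleftrightarrow> a = f" "a = f \<longleftrightarrow> b = g" "b = g \<longleftrightarrow> c = h" "c = h \<longleftrightarrow> a = i"
    "c = d \<longleftrightarrow> a = e" "a = e \<longleftrightarrow> b = f" "b = f \<longleftrightarrow> c = g" "c = g \<longleftrightarrow> a = h" "a = h \<longleftrightarrow> b = i"
    using K[of 0 3] K[of 1 4] K[of 2 5] K[of 0 6] K[of 1 7] K[of 1 3] K[of 2 4] K[of 0 5] K[of 1 6] K[of 2 7]
      K[of 2 3] K[of 0 4] K[of 1 5] K[of 2 6] K[of 0 7]
    by (simp_all add: two_cycles_index_def)
  have six: "d = e \<longleftrightarrow> e = f" "e = f \<longleftrightarrow> f = g" "f = g \<longleftrightarrow> g = h" "g = h \<longleftrightarrow> h = i"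
    using K[of 3 4] K[of 4 5] K[of 5 6] K[of 6 7] by (simp_all add: two_cycles_index_def)
  have v: "a \<in> {0,1,2}" "b \<in> {0,1,2}" "c \<in> {0,1,2}" "d \<in> {0,1,2}" "e \<in> {0,1,2}" "f \<in> {0,1,2}" "g \<in> {0,1,2}" "h \<in> {0,1,2}" "i \<in> {0,1,2}"
    using balanced_list_lt[OF m] by (simp_all add: p)
  have cnt: "count (mset p) x = 3" if "x \<in> set p" for x
    using balanced_list_lt[OF m that] unfolding m by auto
  show ?thesis
  proof (cases "a = b")
    case True
    then have eq: "b = a" "c = a" using abc by auto
    have "a \<noteq> d" using cnt[of a] cross eq by (auto simp: p)
    then have ne: "d \<noteq> a" "e \<noteq> a" "f \<noteq> a" "g \<noteq> a" "h \<noteq> a" "i \<noteq> a" using cross eq by auto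
    have "d \<noteq> e" using cnt[of d] six ne eq by (auto simp: p)
    then have ne2: "e \<noteq> d" "f \<noteq> e" "g \<noteq> f" "h \<noteq> g" "i \<noteq> h" using six by auto
    have third: "z = x" if "x \<in> {0,1,2}" "y \<in> {0,1,2}" "z \<in> {0,1,2}" "u \<in> {0,1,2}" "x \<noteq> u" "y \<noteq> u" "z \<noteq> u" "y \<noteq> x" "z \<noteq> y" for x y z u :: nat
      using that by auto
    have "f = d" "g = e" "h = f" "i = g"
      using third[OF v(4,5,6,1)] third[OF v(5,6,7,1)] third[OF v(6,7,8,1)] third[OF v(7,8,9,1)] ne ne2 by auto
    then have "p = [a,a,a,d,e,d,e,d,e]" by (simp add: p eq)
    moreover have "a \<noteq> d" "a \<noteq> e" "d \<noteq> e" using ne ne2 by auto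
    ultimately show ?thesis using v(1,4,5) by (elim insertE emptyE) (simp_all add: patterns_def)
  next
    case False
    then have ne: "a \<noteq> b" "b \<noteq> c" "a \<noteq> c" using abc by auto
    have "d = a \<or> d = b \<or> d = c" using v(1-4) ne by auto
    then consider "e = b" "f = c" "g = a" "h = b" "i = c" "d = a" | "e = c" "f = a" "g = b" "h = c" "i = a" "d = b"
      | "e = a" "f = b" "g = c" "h = a" "i = b" "d = c"
      using cross by metis
    then have "p = [a,b,c,a,b,c,a,b,c] \<or> p = [a,b,c,b,c,a,b,c,a] \<or> p = [a,b,c,c,a,b,c,a,b]"
      by cases (simp_all add: p)
    then show ?thesis using v(1-3) ne by (elim insertE emptyE) (simp_all add: patterns_def, (elim disjE; simp)+)
  qed
qed

text \<open>The six colourings of the partition of the positions into residues modulo 3.\<close>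

definition periodic_patterns :: "nat list set" where
  "periodic_patterns = (\<lambda>q. q @ q @ q) ` permutations_of_set {0,1,2}"

text \<open>If two positions at distance 1, or at distance 2, had equal colours, all nine would,
  since 1 and 2 generate the integers modulo 9. So three consecutive colours are distinct and
  determine the next one.\<close>

lemma periodic_if_preserved_by_cycles_zero:
  assumes m: "mset p = mset [0,0,0,1,1,1,2,2,2::nat]" and "preserved_by_cycles 0 p" shows "p \<in> periodic_patterns"
proof -
  have "length p = 9" using arg_cong[OF m, of size] by simp
  then obtain a b c d e f g h i where p: "p = [a,b,c,d,e,f,g,h,i]" by (rule list_of_length_nine)
  note K = preserved_by_cyclesD[OF assms(2), unfolded p]
  have one: "a = b \<longleftrightarrow> b = c" "b = c \<longleftrightarrow> c = d" "c = d \<longleftrightarrow> d = e" "d = e \<longleftrightarrow> e = f" "e = f \<longleftrightarrow> f = g" "f = g \<longleftrightarrow> g = h" "g = h \<longleftrightarrow> h = i"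
    using K[of 0 1] K[of 1 2] K[of 2 3] K[of 3 4] K[of 4 5] K[of 5 6] K[of 6 7] by (simp_all add: two_cycles_index_def)
  have two: "a = c \<longleftrightarrow> b = d" "b = d \<longleftrightarrow> c = e" "c = e \<longleftrightarrow> d = f" "d = f \<longleftrightarrow> e = g" "e = g \<longleftrightarrow> f = h" "f = h \<longleftrightarrow> g = i" "g = i \<longleftrightarrow> h = a"
    using K[of 0 2] K[of 1 3] K[of 2 4] K[of 3 5] K[of 4 6] K[of 5 7] K[of 6 8] by (simp_all add: two_cycles_index_def)
  have v: "a \<in> {0,1,2}" "b \<in> {0,1,2}" "c \<in> {0,1,2}" "d \<in> {0,1,2}" "e \<in> {0,1,2}" "f \<in> {0,1,2}" "g \<in> {0,1,2}" "h \<in> {0,1,2}" "i \<in> {0,1,2}"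
    using balanced_list_lt[OF m] by (simp_all add: p)
  have cnt: "count (mset p) x = 3" if "x \<in> set p" for x
    using balanced_list_lt[OF m that] unfolding m by auto
  have "a \<noteq> b" using cnt[of a] one by (auto simp: p)
  then have ne: "a \<noteq> b" "b \<noteq> c" "c \<noteq> d" "d \<noteq> e" "e \<noteq> f" "f \<noteq> g" "g \<noteq> h" "h \<noteq> i" using one by auto
  have "a \<noteq> c" using two cnt[of a] by (auto simp: p)
  then have ne2: "a \<noteq> c" "b \<noteq> d" "c \<noteq> e" "d \<noteq> f" "e \<noteq> g" "f \<noteq> h" "g \<noteq> i" using two by auto
  have third: "u = x" if "x \<in> {0,1,2}" "y \<in> {0,1,2}" "z \<in> {0,1,2}" "u \<in> {0,1,2}" "x \<noteq> y" "y \<noteq> z" "x \<noteq> z" "z \<noteq> u" "y \<noteq> u" for x y z u :: nat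
    using that by auto
  have "d = a" "e = b" "f = c" "g = d" "h = e" "i = f"
    using third[OF v(1,2,3,4)] third[OF v(2,3,4,5)] third[OF v(3,4,5,6)] third[OF v(4,5,6,7)] third[OF v(5,6,7,8)] third[OF v(6,7,8,9)] ne ne2
    by auto
  then have "p = [a,b,c] @ [a,b,c] @ [a,b,c]" by (simp add: p)
  moreover have "[a,b,c] \<in> permutations_of_set {0,1,2}"
    using v(1-3) ne ne2 by (auto simp: permutations_of_set_def)
  ultimately show ?thesis unfolding periodic_patterns_def by blast
qed

lemma card_labelling_periodic:
  assumes "balanced f A"
  shows "card {xs \<in> permutations_of_set A. map f xs \<in> periodic_patterns} \<le> 1296"
proof -
  have fin: "finite periodic_patterns" unfolding periodic_patterns_def by simp
  have "card periodic_patterns \<le> card (permutations_of_set {0,1,2::nat})"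
    unfolding periodic_patterns_def by (rule card_image_le) simp
  then have six: "card periodic_patterns \<le> 6" by (simp add: fact_numeral)
  have each: "card {xs \<in> permutations_of_set A. map f xs = p} \<le> 216" if p: "p \<in> periodic_patterns" for p
  proof -
    obtain q where q: "p = q @ q @ q" "q \<in> permutations_of_set {0,1,2}" using p by (auto simp: periodic_patterns_def)
    have mq: "mset q = {#0,1,2#}"
    proof -
      have "mset q = mset_set {0,1,2}" using permutations_of_setD[OF q(2)] mset_set_set by metis
      then show ?thesis by simp
    qed
    have mp: "mset p = mset [0,0,0,1,1,1,2,2,2]" by (simp add: q(1) mq)
    have "card {xs \<in> permutations_of_set A. map f xs = p} = (\<Prod>y\<in>{0,1,2}. fact (count (mset p) y))"
    proof (rule card_coloured_permutations)
      show "finite A" "image_mset f (mset_set A) = mset p" using assms mp by (simp_all add: balanced_def)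
      show "set p \<subseteq> {0,1,2}" using arg_cong[OF mp, of set_mset] by simp
    qed simp
    then show ?thesis unfolding mp by (simp add: fact_numeral)
  qed
  have "{xs \<in> permutations_of_set A. map f xs \<in> periodic_patterns} =
      (\<Union>p\<in>periodic_patterns. {xs \<in> permutations_of_set A. map f xs = p})" by auto
  then have "card {xs \<in> permutations_of_set A. map f xs \<in> periodic_patterns} \<le>
      (\<Sum>p\<in>periodic_patterns. card {xs \<in> permutations_of_set A. map f xs = p})"
    by (simp only:) (rule card_UN_le[OF fin])
  also have "\<dots> \<le> (\<Sum>p\<in>periodic_patterns. 216)" by (intro sum_mono each)
  finally show ?thesis using six by simp
qed

lemma subgroup_perm_group:
  assumes "subgroup H (sym_group 9)" shows "perm_group {1..9} H"
proof
  interpret subgroup H "sym_group 9" by (rule assms)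
  show "finite {1..9::nat}" by simp
  show perm: "h permutes {1..9}" if "h \<in> H" for h using that mem_carrier by (simp add: sym_group_carrier)
  show "id \<in> H" using one_closed by (simp add: sym_group_one)
  show "g \<circ> h \<in> H" if "g \<in> H" "h \<in> H" for g h using m_closed[OF that] by (simp add: sym_group_mult)
  show "inv' h \<in> H" if "h \<in> H" for h
    using m_inv_closed[OF that] mem_carrier[OF that] by simp
qed

lemma colouring_of_partition:
  assumes A: "card A = 9" and P: "partition_on A P" "\<forall>D\<in>P. card D = 3"
  obtains f where "balanced f A" "\<And>a b. a \<in> A \<Longrightarrow> b \<in> A \<Longrightarrow> f a = f b \<longleftrightarrow> (\<exists>D\<in>P. a \<in> D \<and> b \<in> D)"
proof -
  have finA: "finite A" using A by (metis card.infinite zero_neq_numeral)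
  have un: "\<Union>P = A" and disj: "\<And>C D. C \<in> P \<Longrightarrow> D \<in> P \<Longrightarrow> C \<noteq> D \<Longrightarrow> C \<inter> D = {}"
    using P(1) by (auto simp: partition_on_def disjoint_def)
  have finP: "finite P" using finA un finite_UnionD by blast
  have "3 * card P = card (\<Union>P)"
    using finP finA un P(2) disj by (intro card_partition) auto
  then have "card P = 3" using un A by simp
  then obtain D0 D1 D2 where D: "P = {D0, D1, D2}" "D0 \<noteq> D1" "D1 \<noteq> D2" "D0 \<noteq> D2" by (metis card_3_iff)
  have dj: "D0 \<inter> D1 = {}" "D0 \<inter> D2 = {}" "D1 \<inter> D2 = {}" using disj D by auto
  have eq: "A = D0 \<union> (D1 \<union> D2)" using un D by auto
  have fin: "finite D0" "finite D1" "finite D2" using finA eq by auto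
  have cD: "card D0 = 3" "card D1 = 3" "card D2 = 3" using P(2) D by auto
  define f where "f a = (if a \<in> D0 then 0 else if a \<in> D1 then 1 else 2 :: nat)" for a
  have im: "image_mset f (mset_set D) = replicate_mset 3 c" if "finite D" "card D = 3" "\<And>a. a \<in> D \<Longrightarrow> f a = c" for D c
  proof -
    have "image_mset f (mset_set D) = image_mset (\<lambda>_. c) (mset_set D)"
      using that by (intro image_mset_cong) auto
    then show ?thesis using that by (simp add: image_mset_const_eq)
  qed
  have "mset_set (D1 \<union> D2) = mset_set D1 + mset_set D2" by (rule mset_set_Union[OF fin(2,3) dj(3)])
  moreover have "mset_set (D0 \<union> (D1 \<union> D2)) = mset_set D0 + mset_set (D1 \<union> D2)"
    using fin dj by (intro mset_set_Union) auto
  ultimately have "image_mset f (mset_set A) =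
      image_mset f (mset_set D0) + (image_mset f (mset_set D1) + image_mset f (mset_set D2))"
    unfolding eq by simp
  also have "image_mset f (mset_set D0) = replicate_mset 3 0" by (rule im[OF fin(1) cD(1)]) (simp add: f_def)
  also have "image_mset f (mset_set D1) = replicate_mset 3 1"
    using dj(1) by (intro im[OF fin(2) cD(2)]) (auto simp: f_def)
  also have "image_mset f (mset_set D2) = replicate_mset 3 2"
    using dj(2,3) by (intro im[OF fin(3) cD(3)]) (auto simp: f_def)
  finally have "image_mset f (mset_set A) = replicate_mset 3 0 + (replicate_mset 3 1 + replicate_mset 3 2)" .
  then have "balanced f A" using finA by (simp add: balanced_def numeral_3_eq_3)
  moreover have "f a = f b \<longleftrightarrow> (\<exists>D\<in>P. a \<in> D \<and> b \<in> D)" if "a \<in> A" "b \<in> A" for a b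
    using that dj unfolding D(1) eq f_def by auto
  ultimately show ?thesis using that by blast
qed

text \<open>Up to four points suffice, because a set and its complement have the same
  stabiliser.\<close>

definition fixes_small_set :: "(nat \<Rightarrow> nat) set \<Rightarrow> nat set \<Rightarrow> bool" where
  "fixes_small_set H Y \<longleftrightarrow> Y \<subseteq> {1..9} \<and> 1 \<le> card Y \<and> card Y \<le> 4 \<and> (\<forall>h\<in>H. h ` Y = Y)"

definition preserves_colouring :: "(nat \<Rightarrow> nat) set \<Rightarrow> (nat \<Rightarrow> nat) \<Rightarrow> bool" where
  "preserves_colouring H f \<longleftrightarrow> balanced f {1..9} \<and>
     (\<forall>h\<in>H. \<forall>a\<in>{1..9}. \<forall>b\<in>{1..9}. f a = f b \<longleftrightarrow> f (h a) = f (h b))"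

lemma primitive_on_points:
  assumes H: "perm_group {1..9} H" and "\<And>Y. \<not> fixes_small_set H Y" "\<And>f. \<not> preserves_colouring H f"
  shows "perm_group.primitive_on H {1..9}"
proof -
  interpret perm_group "{1..9}" H by (rule H)
  show ?thesis
  proof (rule primitive_on_if_no_invariants)
    show "card {1..9::nat} = 9" by simp
    show "\<exists>h\<in>H. h ` Y \<noteq> Y" if "Y \<subseteq> {1..9}" "1 \<le> card Y" "card Y \<le> 4" for Y
      using assms(2)[of Y] that by (auto simp: fixes_small_set_def)
    show "\<exists>h\<in>H. \<exists>D\<in>P. h ` D \<notin> P" if P: "partition_on {1..9} P" "\<forall>D\<in>P. card D = 3" for P
    proof (rule ccontr)
      assume "\<not> ?thesis"
      then have inv: "h ` D \<in> P" if "h \<in> H" "D \<in> P" for h D using that by blast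
      obtain f where f: "balanced f {1..9}"
        "\<And>a b. a \<in> {1..9} \<Longrightarrow> b \<in> {1..9} \<Longrightarrow> f a = f b \<longleftrightarrow> (\<exists>D\<in>P. a \<in> D \<and> b \<in> D)"
        using colouring_of_partition[OF _ P] by auto
      have "f a = f b \<longleftrightarrow> f (h a) = f (h b)" if h: "h \<in> H" and ab: "a \<in> {1..9}" "b \<in> {1..9}" for h a b
      proof -
        have hab: "h a \<in> {1..9}" "h b \<in> {1..9}" using apply_mem[OF h] ab by blast+
        have "(\<exists>D\<in>P. a \<in> D \<and> b \<in> D) \<longleftrightarrow> (\<exists>D\<in>P. h a \<in> D \<and> h b \<in> D)"
        proof
          assume "\<exists>D\<in>P. a \<in> D \<and> b \<in> D"
          then show "\<exists>D\<in>P. h a \<in> D \<and> h b \<in> D" using inv[OF h] by blast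
        next
          assume "\<exists>D\<in>P. h a \<in> D \<and> h b \<in> D"
          then obtain D where D: "D \<in> P" "h a \<in> D" "h b \<in> D" by blast
          then have "inv' h (h a) \<in> inv' h ` D" "inv' h (h b) \<in> inv' h ` D" by blast+
          then show "\<exists>D\<in>P. a \<in> D \<and> b \<in> D" using inv[OF inv_mem[OF h] D(1)] inv_apply(1)[OF h] by auto
        qed
        then show ?thesis using f(2)[OF ab] f(2)[OF hab] by simp
      qed
      then have "preserves_colouring H f" using f(1) by (simp add: preserves_colouring_def)
      then show False using assms(3) by blast
    qed
  qed
qed

lemma preserves_colouring_two_cycles:
  assumes f: "preserves_colouring H f" and xs: "xs \<in> permutations_of_set {1..9}" and r: "r \<le> 4" "two_cycles r xs \<in> H"
  shows "r = 0 \<and> map f xs \<in> periodic_patterns \<or> r = 3 \<and> map f xs \<in> set patterns"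
proof -
  have lab: "distinct xs" "length xs = 9" "set xs = {1..9}" using labelling_nine[OF _ xs] by auto
  have lt: "two_cycles_index r 9 1 i < 9" if "i < 9" for i
    using that r(1) mod_less_divisor[of r "i + 1"] mod_less_divisor[of "9 - r" "i - r + 1"]
    by (auto simp: two_cycles_index_def simp del: mod_less_divisor)
  have p: "preserved_by_cycles r (map f xs)"
    unfolding preserved_by_cycles_def
  proof (intro allI impI)
    fix i j :: nat assume ij: "i < 9" "j < 9"
    have "xs ! i \<in> {1..9}" "xs ! j \<in> {1..9}" using ij lab nth_mem by metis+
    then have "f (xs ! i) = f (xs ! j) \<longleftrightarrow> f (two_cycles r xs (xs ! i)) = f (two_cycles r xs (xs ! j))"
      using f r(2) unfolding preserves_colouring_def by blast
    then show "(map f xs ! i = map f xs ! j) = (map f xs ! two_cycles_index r 9 1 i = map f xs ! two_cycles_index r 9 1 j)"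
      using ij lab r(1) lt[OF ij(1)] lt[OF ij(2)] two_cycles_nth[OF lab(1), of r i] two_cycles_nth[OF lab(1), of r j] by simp
  qed
  have m: "mset (map f xs) = mset [0,0,0,1,1,1,2,2,2]"
    using mset_coloured[OF _ xs] f by (auto simp: preserves_colouring_def)
  have "r = 0 \<or> r = 1 \<or> r = 2 \<or> r = 3 \<or> r = 4" using r(1) by arith
  then show ?thesis
    using m p not_preserved_by_cycles_one not_preserved_by_cycles_two not_preserved_by_cycles_four
      pattern_if_preserved_by_cycles_three periodic_if_preserved_by_cycles_zero by blast
qed

section \<open>The lower bound for the number of members\<close>

lemma ex_labelling:
  assumes "finite A" "Y \<subseteq> A"
  obtains xs where "xs \<in> permutations_of_set A" "set (take (card Y) xs) = Y"
proof -
  have "finite Y" "finite (A - Y)" using assms finite_subset by auto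
  then obtain ys zs where "set ys = Y" "distinct ys" "set zs = A - Y" "distinct zs"
    using finite_distinct_list by metis
  moreover from this have "length ys = card Y" by (metis distinct_card)
  ultimately show ?thesis using assms(2) by (intro that[of "ys @ zs"]) (auto simp: permutations_of_set_def)
qed

lemma card_labelling_head:
  assumes "finite A" "a \<in> A"
  shows "card {xs \<in> permutations_of_set A. xs ! 0 = a} = fact (card A - 1)"
proof -
  have "{xs \<in> permutations_of_set A. xs ! 0 = a} = (#) a ` permutations_of_set (A - {a})" (is "?L = ?R")
  proof (intro equalityI subsetI)
    fix xs assume xs: "xs \<in> ?L"
    then have "xs \<noteq> []" using assms(2) by (auto dest: permutations_of_setD)
    then obtain ys where ys: "xs = a # ys" using xs by (cases xs) auto
    then have "set (a # ys) = A" "distinct (a # ys)" using xs by (auto dest: permutations_of_setD simp only:)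
    then have "ys \<in> permutations_of_set (A - {a})" by (auto simp: permutations_of_set_def)
    then show "xs \<in> ?R" using ys by blast
  next
    fix xs assume "xs \<in> ?R"
    then obtain ys where "xs = a # ys" "set ys = A - {a}" "distinct ys" by (auto dest: permutations_of_setD)
    then show "xs \<in> ?L" using assms(2) by (simp add: permutations_of_set_def insert_absorb)
  qed
  then have "card ?L = card (permutations_of_set (A - {a}))" by (simp only:) (rule card_image, simp)
  then show ?thesis using assms by (simp add: card_Diff_subset)
qed

text \<open>There are \<open>s\<close> partitions, \<open>x\<close> triples, \<open>z\<close>
  primitive members with odd elements and \<open>u\<close> remaining members of even permutations,
  and \<open>j\<close> singletons are missing. The 84 in \<open>le\<close> is 255 - 171, where 171 =
  36 + 126 + 9.\<close>

lemma final_arithmetic: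
  fixes s x z u j :: int
  assumes nonneg: "0 \<le> s" "0 \<le> x" "0 \<le> z" "0 \<le> u"
    and le: "x + s + z + u \<le> 84 + j" and j: "10 * j \<le> 3 * z"
    and u: "u = 0 \<Longrightarrow> 362880 \<le> 1296 * s + 13608 * z"
    and core: "(288 * s + 60 * x)\<^sup>2 \<le> 10080 * (1248 * s + 990 * x + 480 * z - 80640) + 48384 * s\<^sup>2"
  shows False
proof -
  \<comment> \<open>The shortfall of partitions and triples from 84. For \<open>r = z = 0\<close>,
    \<open>core\<close> says merely that \<open>5 * x * (84 - x)\<close> is nonnegative, so a
    positive shortfall has to be forced.\<close>
  define r where "r = 84 - s - x"
  have s: "s = 84 - x - r" by (simp add: r_def)
  have r: "7 * z + 10 * u \<le> 10 * r" using le j by (simp add: r_def)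
  have "0 \<le> 720 * (5 * x * (84 - x) + 6720 * z - r * (9408 + 48 * x) - 48 * r\<^sup>2)"
    using core unfolding s by (simp add: algebra_simps power2_eq_square)
  then have E: "0 \<le> 5 * x * (84 - x) + 6720 * z - r * (9408 + 48 * x) - 48 * r\<^sup>2" by simp
  moreover have "6720 * z \<le> 9600 * r - 9600 * u" using r by simp
  ultimately have E': "0 \<le> 420 * x - 5 * x\<^sup>2 + 192 * r - 48 * (x * r) - 48 * r\<^sup>2 - 9600 * u"
    by (simp add: algebra_simps power2_eq_square)
  show False
  proof (cases "u = 0")
    case True
    \<comment> \<open>Here the 9-cycles need so many primitive members that the shortfall reaches
      10, and then 48 x r and 48 r^2 outweigh 420 x and 192 r.\<close>
    have "362880 \<le> 1296 * s + 13608 * z" using u True by simp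
    then have "10 \<le> r" using r True nonneg s by linarith
    then have "0 \<le> x * (r - 10)" "0 \<le> r * (r - 10)" using nonneg by auto
    then have "10 * x \<le> x * r" "10 * r \<le> r\<^sup>2" by (simp_all add: algebra_simps power2_eq_square)
    moreover have "0 \<le> x\<^sup>2" by simp
    ultimately show False using E' True \<open>10 \<le> r\<close> nonneg by linarith
  next
    case False
    then have "1 \<le> r" using r nonneg by linarith
    then have "0 \<le> x * (r - 1)" using nonneg by simp
    then have "x \<le> x * r" by (simp add: algebra_simps)
    \<comment> \<open>Since \<open>r \<ge> 1\<close>, the terms with \<open>x\<close> are at most
      372 x - 5 x^2, which peaks at x = 186/5 with value 34596/5; those with \<open>r\<close> alone
      are at most 192. Together they stay below 9600.\<close>
    moreover have "0 \<le> (5 * x - 186)\<^sup>2" "0 \<le> (r - 2)\<^sup>2" by simp_all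
    then have "1860 * x - 25 * x\<^sup>2 \<le> 34596" "4 * r - r\<^sup>2 \<le> 4" by (simp_all add: algebra_simps power2_eq_square)
    moreover have "1 \<le> u" using False nonneg by simp
    ultimately show False using E' by linarith
  qed
qed

lemma group_cover_card_ge:
  assumes cover: "group_cover (sym_group 9) \<A>"
  shows "256 \<le> card \<A>"
proof (rule ccontr)
  assume small: "\<not> 256 \<le> card \<A>"
  let ?\<Omega> = "{1..9::nat}"
  let ?P = "permutations_of_set ?\<Omega>"
  have sub: "subgroup H (sym_group 9)" "H \<noteq> {p. p permutes ?\<Omega>}" if "H \<in> \<A>" for H
    using cover that by (auto simp: group_cover_def sym_group_def)
  have finA: "finite \<A>" and covers: "\<Union>\<A> = {p. p permutes ?\<Omega>}"
    using cover by (auto simp: group_cover_def sym_group_def)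
  have pg: "perm_group ?\<Omega> H" if "H \<in> \<A>" for H using subgroup_perm_group[OF sub(1)[OF that]] .
  have c9: "card ?\<Omega> = 9" and fin\<Omega>: "finite ?\<Omega>" by simp_all
  note lab = labelling_nine[OF c9]
  have member: "\<exists>H\<in>\<A>. two_cycles r xs \<in> H" if "xs \<in> ?P" for r xs
    using two_cycles_permutes[of r xs] lab(3)[OF that] covers by auto
  \<comment> \<open>Each member is put into the first kind that applies, and the primitive ones are
    split by parity, so the four numbers add up.\<close>
  define A1 where "A1 = {H \<in> \<A>. \<exists>Y. fixes_small_set H Y}"
  define A2 where "A2 = {H \<in> \<A>. (\<forall>Y. \<not> fixes_small_set H Y) \<and> (\<exists>f. preserves_colouring H f)}"
  define A3 where "A3 = {H \<in> \<A>. (\<forall>Y. \<not> fixes_small_set H Y) \<and> (\<forall>f. \<not> preserves_colouring H f) \<and> (\<exists>h\<in>H. \<not> evenperm h)}"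
  define A4 where "A4 = {H \<in> \<A>. (\<forall>Y. \<not> fixes_small_set H Y) \<and> (\<forall>f. \<not> preserves_colouring H f) \<and> (\<forall>h\<in>H. evenperm h)}"
  have split: "H \<in> A1 \<or> H \<in> A2 \<or> H \<in> A3 \<or> H \<in> A4" if "H \<in> \<A>" for H
    using that by (auto simp: A1_def A2_def A3_def A4_def)
  have finAi: "finite A1" "finite A2" "finite A3" "finite A4" using finA by (simp_all add: A1_def A2_def A3_def A4_def)
  have total: "card A1 + card A2 + card A3 + card A4 \<le> 255"
  proof -
    have "card A1 + card A2 + card A3 + card A4 = card (A1 \<union> A2 \<union> A3 \<union> A4)"
      using finAi by (subst card_Un_disjoint, simp, simp, force simp: A1_def A2_def A3_def A4_def)+ simp
    also have "\<dots> \<le> card \<A>" using finA by (intro card_mono) (auto simp: A1_def A2_def A3_def A4_def)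
    finally show ?thesis using small by simp
  qed
  have prim: "primitive_nine ?\<Omega> H" if "H \<in> A3" for H
  proof -
    have H: "H \<in> \<A>" "\<exists>h\<in>H. \<not> evenperm h" using that by (auto simp: A3_def)
    show ?thesis
      by (rule primitive_nine.intro[OF pg[OF H(1)]], unfold_locales)
        (use H sub(2)[OF H(1)] primitive_on_points[OF pg[OF H(1)]] that in \<open>auto simp: A3_def\<close>)
  qed

  define Y where "Y H = (SOME Y. fixes_small_set H Y)" for H
  have Y: "fixes_small_set H (Y H)" if "H \<in> A1" for H
    using that unfolding A1_def Y_def by (auto intro: someI)
  define \<Y> where "\<Y> = Y ` A1"
  have \<Y>_sub: "T \<subseteq> ?\<Omega>" if "T \<in> \<Y>" for T using that Y by (auto simp: \<Y>_def fixes_small_set_def)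

  \<comment> \<open>\<open>canon\<close> selects a colouring that depends on the partition alone, so
    that members for which the same partition is chosen contribute one colouring.\<close>
  define ker where "ker f = {(a, b). a \<in> ?\<Omega> \<and> b \<in> ?\<Omega> \<and> f a = f b}" for f :: "nat \<Rightarrow> nat"
  define canon where "canon \<kappa> = (SOME f. balanced f ?\<Omega> \<and> ker f = \<kappa>)" for \<kappa>
  define f0 where "f0 H = (SOME f. preserves_colouring H f)" for H
  define F where "F H = canon (ker (f0 H))" for H
  have f0: "preserves_colouring H (f0 H)" if H: "H \<in> A2" for H
  proof -
    obtain f where "preserves_colouring H f" using H by (auto simp: A2_def)
    then show ?thesis unfolding f0_def by (rule someI[of "preserves_colouring H"])
  qed
  have canon: "balanced (F H) ?\<Omega> \<and> ker (F H) = ker (f0 H)" if "H \<in> A2" for H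
    unfolding F_def canon_def
    by (rule someI[of "\<lambda>f. balanced f ?\<Omega> \<and> ker f = ker (f0 H)" "f0 H"])
      (use f0[OF that] in \<open>simp add: preserves_colouring_def\<close>)
  have ker_eq: "f a = f b \<longleftrightarrow> g a = g b" if "ker f = ker g" "a \<in> ?\<Omega>" "b \<in> ?\<Omega>" for f g a b
  proof -
    have "(a, b) \<in> ker f \<longleftrightarrow> (a, b) \<in> ker g" using that by simp
    then show ?thesis using that by (simp add: ker_def)
  qed
  have F: "preserves_colouring H (F H)" if H: "H \<in> A2" for H
    unfolding preserves_colouring_def
  proof (intro conjI ballI)
    show "balanced (F H) ?\<Omega>" using canon[OF H] by blast
    fix h a b assume h: "h \<in> H" and ab: "a \<in> ?\<Omega>" "b \<in> ?\<Omega>"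
    have "H \<in> \<A>" using H by (simp add: A2_def)
    then have hab: "h a \<in> ?\<Omega>" "h b \<in> ?\<Omega>" using perm_group.apply_mem[OF pg h] ab by blast+
    have "f0 H a = f0 H b \<longleftrightarrow> f0 H (h a) = f0 H (h b)"
      using f0[OF H] h ab unfolding preserves_colouring_def by blast
    then show "F H a = F H b \<longleftrightarrow> F H (h a) = F H (h b)"
      using ker_eq[OF conjunct2[OF canon[OF H]] ab] ker_eq[OF conjunct2[OF canon[OF H]] hab] by simp
  qed
  define S where "S = F ` A2"
  have S: "balanced f ?\<Omega>" if "f \<in> S" for f using that canon by (auto simp: S_def)
  have S_ker: "distinct_kernels S ?\<Omega>"
    unfolding distinct_kernels_def
  proof (intro ballI impI)
    fix f g assume "f \<in> S" "g \<in> S" and eq: "\<forall>a\<in>?\<Omega>. \<forall>b\<in>?\<Omega>. f a = f b \<longleftrightarrow> g a = g b"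
    then obtain H K where HK: "H \<in> A2" "f = F H" "K \<in> A2" "g = F K" by (auto simp: S_def)
    have "ker f = ker g" using eq by (auto simp: ker_def)
    then have "ker (f0 H) = ker (f0 K)" using canon[OF HK(1)] canon[OF HK(3)] HK by simp
    then show "f = g" using HK by (simp add: F_def)
  qed
  have finS: "finite S" and cardS: "card S \<le> card A2"
    using finAi(2) card_image_le by (auto simp: S_def)

  \<comment> \<open>The facts \<open>type1\<close> to \<open>type4\<close> restrict which elements
    of type (r, 9 - r) each kind of member can contain.\<close>
  have type1: "r \<noteq> 0 \<and> set (take r xs) \<in> \<Y>" if "H \<in> A1" "two_cycles r xs \<in> H" "xs \<in> ?P" "r \<le> 4" for H r xs
  proof -
    note Y1 = Y[OF that(1), unfolded fixes_small_set_def]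
    have "Y H \<noteq> {}" using Y1 by auto
    then have "r \<noteq> 0 \<and> Y H = set (take r xs)"
      using two_cycles_invariant[of xs r "Y H"] lab[OF that(3)] Y1 that by auto
    then show ?thesis using that(1) by (auto simp: \<Y>_def)
  qed
  have type2: "r = 0 \<and> (\<exists>f\<in>S. map f xs \<in> periodic_patterns) \<or> r = 3 \<and> (\<exists>f\<in>S. map f xs \<in> set patterns)"
    if "H \<in> A2" "two_cycles r xs \<in> H" "xs \<in> ?P" "r \<le> 4" for H r xs
    using preserves_colouring_two_cycles[OF F[OF that(1)] that(3,4,2)] that(1) by (auto simp: S_def)
  have type3: "r \<noteq> 2" "r \<noteq> 4" if "H \<in> A3" "two_cycles r xs \<in> H" "xs \<in> ?P" for H r xs
    using primitive_nine.no_two_seven[OF prim[OF that(1)] that(3)]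
      primitive_nine.no_four_five[OF prim[OF that(1)] that(3)] that(2) by auto
  have type4: "r = 0" if "H \<in> A4" "two_cycles r xs \<in> H" "xs \<in> ?P" "r \<le> 4" for H r xs
    using that evenperm_two_cycles[of xs r] lab[OF that(3)] by (auto simp: A4_def)

  \<comment> \<open>A labelling that begins with \<open>T\<close> gives an element with short cycle
    \<open>T\<close>, and for lengths 2 and 4 only members in \<open>A1\<close> can contain
    it.\<close>
  have even_sets: "T \<in> \<Y>" if T: "T \<subseteq> ?\<Omega>" "card T = 2 \<or> card T = 4" for T
  proof -
    obtain xs where xs: "xs \<in> ?P" "set (take (card T) xs) = T" using ex_labelling[OF fin\<Omega> T(1)] .
    obtain H where H: "H \<in> \<A>" "two_cycles (card T) xs \<in> H" using member[OF xs(1)] by blast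
    have "card T \<le> 4" "card T \<noteq> 0" "card T \<noteq> 3" using T(2) by auto
    then have "H \<in> A1" using split[OF H(1)] type2[OF _ H(2) xs(1)] type3[OF _ H(2) xs(1)] type4[OF _ H(2) xs(1)] T(2) by auto
    then show ?thesis using type1[OF _ H(2) xs(1)] xs(2) \<open>card T \<le> 4\<close> by simp
  qed
  define X where "X = {T \<in> \<Y>. card T = 3}"
  define J where "J = {a \<in> ?\<Omega>. {a} \<notin> \<Y>}"
  have fin\<Y>: "finite \<Y>" using finAi(1) by (simp add: \<Y>_def)
  \<comment> \<open>171 = 36 + 126 + 9: all sets of 2 and 4 points are present, and all singletons
    except those counted by \<open>J\<close>.\<close>
  have card\<Y>: "card X + 171 \<le> card A1 + card J"
  proof -
    let ?U2 = "{T. T \<subseteq> ?\<Omega> \<and> card T = 2}" and ?U4 = "{T. T \<subseteq> ?\<Omega> \<and> card T = 4}" and ?U1 = "(\<lambda>a. {a}) ` (?\<Omega> - J)"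
    have c2: "card ?U2 = 36" "card ?U4 = 126"
      using n_subsets[OF fin\<Omega>, of 2] n_subsets[OF fin\<Omega>, of 4] by (simp_all add: numeral_eq_Suc)
    have c1: "card ?U1 + card J = 9"
    proof -
      have "card ?U1 = card (?\<Omega> - J)" by (rule card_image) simp
      moreover have "J \<subseteq> ?\<Omega>" by (auto simp: J_def)
      ultimately show ?thesis using card_Diff_subset[of J ?\<Omega>] card_mono[OF fin\<Omega>, of J] finite_subset[OF _ fin\<Omega>] by simp
    qed
    have fin: "finite ?U2" "finite ?U4" "finite ?U1" "finite X"
      using fin\<Y> by (simp_all add: X_def)
    have "card ((?U2 \<union> ?U4) \<union> (?U1 \<union> X)) = card (?U2 \<union> ?U4) + card (?U1 \<union> X)"
      using fin by (intro card_Un_disjoint) (auto simp: X_def)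
    also have "card (?U2 \<union> ?U4) = card ?U2 + card ?U4" using fin by (intro card_Un_disjoint) auto
    also have "card (?U1 \<union> X) = card ?U1 + card X" using fin by (intro card_Un_disjoint) (auto simp: X_def)
    finally have "card ((?U2 \<union> ?U4) \<union> (?U1 \<union> X)) + card J = card X + 171" using c1 c2 by simp
    moreover have "card ((?U2 \<union> ?U4) \<union> (?U1 \<union> X)) \<le> card \<Y>"
      using even_sets by (intro card_mono[OF fin\<Y>]) (auto simp: J_def X_def)
    moreover have "card \<Y> \<le> card A1" unfolding \<Y>_def using finAi(1) by (rule card_image_le)
    ultimately show ?thesis by simp
  qed

  \<comment> \<open>An 8-cycle whose fixed point lies in \<open>J\<close> is left to
    \<open>A3\<close>. Each such point has 8! labellings, and a member with at most 1512 odd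
    elements accounts for at most 8 * 1512.\<close>
  have eight: "40320 * card J \<le> 12096 * card A3"
  proof -
    have finJ: "finite J" by (simp add: J_def)
    have "{xs \<in> ?P. xs ! 0 \<in> J} = (\<Union>a\<in>J. {xs \<in> ?P. xs ! 0 = a})" by auto
    then have "card {xs \<in> ?P. xs ! 0 \<in> J} = (\<Sum>a\<in>J. card {xs \<in> ?P. xs ! 0 = a})"
      by (simp only:) (rule card_UN_disjoint, use finJ in auto)
    also have "\<dots> = (\<Sum>a\<in>J. 40320)"
      using card_labelling_head[OF fin\<Omega>] by (intro sum.cong refl) (simp add: J_def fact_numeral)
    finally have "40320 * card J = card {xs \<in> ?P. xs ! 0 \<in> J}" by simp
    also have "\<dots> \<le> card (\<Union>H\<in>A3. {xs \<in> ?P. two_cycles 1 xs \<in> {h \<in> H. \<not> evenperm h}})"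
    proof (rule card_mono)
      show "finite (\<Union>H\<in>A3. {xs \<in> ?P. two_cycles 1 xs \<in> {h \<in> H. \<not> evenperm h}})"
        using finAi(3) by simp
      show "{xs \<in> ?P. xs ! 0 \<in> J} \<subseteq> (\<Union>H\<in>A3. {xs \<in> ?P. two_cycles 1 xs \<in> {h \<in> H. \<not> evenperm h}})"
      proof
        fix xs assume "xs \<in> {xs \<in> ?P. xs ! 0 \<in> J}"
        then have xs: "xs \<in> ?P" "{xs ! 0} \<notin> \<Y>" by (auto simp: J_def)
        obtain H where H: "H \<in> \<A>" "two_cycles 1 xs \<in> H" using member[OF xs(1)] by blast
        have "take 1 xs = [xs ! 0]" using lab(2)[OF xs(1)] by (cases xs) auto
        then have "H \<notin> A1" using type1[OF _ H(2) xs(1)] xs(2) by auto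
        then have "H \<in> A3" using split[OF H(1)] type2[OF _ H(2) xs(1)] type4[OF _ H(2) xs(1)] by auto
        moreover have "\<not> evenperm (two_cycles 1 xs)" using evenperm_two_cycles[of xs 1] lab[OF xs(1)] by simp
        ultimately show "xs \<in> (\<Union>H\<in>A3. {xs \<in> ?P. two_cycles 1 xs \<in> {h \<in> H. \<not> evenperm h}})" using H xs by blast
      qed
    qed
    also have "\<dots> \<le> (\<Sum>H\<in>A3. card {xs \<in> ?P. two_cycles 1 xs \<in> {h \<in> H. \<not> evenperm h}})"
      by (rule card_UN_le[OF finAi(3)])
    also have "\<dots> \<le> (\<Sum>H\<in>A3. 12096)"
    proof (rule sum_mono)
      fix H assume H: "H \<in> A3"
      interpret primitive_nine ?\<Omega> H by (rule prim[OF H])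
      have "card {xs \<in> ?P. two_cycles 1 xs \<in> {h \<in> H. \<not> evenperm h}} \<le> 8 * card {h \<in> H. \<not> evenperm h}"
        using finite_group by (intro card_eight_cycles_le[OF c9]) simp
      then show "card {xs \<in> ?P. two_cycles 1 xs \<in> {h \<in> H. \<not> evenperm h}} \<le> 12096" using card_parity by simp
    qed
    finally show ?thesis by simp
  qed

  \<comment> \<open>Without \<open>A4\<close>, the 9-cycles are left to partitions, with at most 6 *
    216 labellings each, and to \<open>A3\<close>, with at most 9 * 1512 each.\<close>
  have nine: "362880 \<le> 1296 * card S + 13608 * card A3" if A4: "A4 = {}"
  proof -
    have "362880 = card ?P" by (simp add: fact_numeral)
    also have "\<dots> \<le> card ((\<Union>f\<in>S. {xs \<in> ?P. map f xs \<in> periodic_patterns}) \<union>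
        (\<Union>H\<in>A3. {xs \<in> ?P. two_cycles 0 xs \<in> {h \<in> H. evenperm h}}))"
    proof (rule card_mono)
      show "finite ((\<Union>f\<in>S. {xs \<in> ?P. map f xs \<in> periodic_patterns}) \<union>
        (\<Union>H\<in>A3. {xs \<in> ?P. two_cycles 0 xs \<in> {h \<in> H. evenperm h}}))"
        using finAi(3) finS by simp
      show "?P \<subseteq> (\<Union>f\<in>S. {xs \<in> ?P. map f xs \<in> periodic_patterns}) \<union>
        (\<Union>H\<in>A3. {xs \<in> ?P. two_cycles 0 xs \<in> {h \<in> H. evenperm h}})"
      proof
        fix xs assume xs: "xs \<in> ?P"
        obtain H where H: "H \<in> \<A>" "two_cycles 0 xs \<in> H" using member[OF xs] by blast
        have "H \<notin> A1" using type1[OF _ H(2) xs] by auto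
        then have "H \<in> A2 \<or> H \<in> A3" using split[OF H(1)] A4 by auto
        moreover have "evenperm (two_cycles 0 xs)" using evenperm_two_cycles[of xs 0] lab[OF xs] by simp
        ultimately show "xs \<in> (\<Union>f\<in>S. {xs \<in> ?P. map f xs \<in> periodic_patterns}) \<union>
          (\<Union>H\<in>A3. {xs \<in> ?P. two_cycles 0 xs \<in> {h \<in> H. evenperm h}})"
          using type2[OF _ H(2) xs] H xs by auto
      qed
    qed
    also have "\<dots> \<le> card (\<Union>f\<in>S. {xs \<in> ?P. map f xs \<in> periodic_patterns}) +
        card (\<Union>H\<in>A3. {xs \<in> ?P. two_cycles 0 xs \<in> {h \<in> H. evenperm h}})"
      by (rule card_Un_le)
    also have "\<dots> \<le> (\<Sum>f\<in>S. card {xs \<in> ?P. map f xs \<in> periodic_patterns}) +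
        (\<Sum>H\<in>A3. card {xs \<in> ?P. two_cycles 0 xs \<in> {h \<in> H. evenperm h}})"
      by (intro add_mono card_UN_le finS finAi(3))
    also have "\<dots> \<le> (\<Sum>f\<in>S. 1296) + (\<Sum>H\<in>A3. 13608)"
    proof (intro add_mono sum_mono)
      show "card {xs \<in> ?P. map f xs \<in> periodic_patterns} \<le> 1296" if "f \<in> S" for f
        using card_labelling_periodic[OF S[OF that]] .
      fix H assume H: "H \<in> A3"
      interpret primitive_nine ?\<Omega> H by (rule prim[OF H])
      have "card {xs \<in> ?P. two_cycles 0 xs \<in> {h \<in> H. evenperm h}} \<le> 9 * card {h \<in> H. evenperm h}"
        using finite_group by (intro card_nine_cycles_le[OF c9]) simp
      then show "card {xs \<in> ?P. two_cycles 0 xs \<in> {h \<in> H. evenperm h}} \<le> 13608" using card_parity by simp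
    qed
    finally show ?thesis by simp
  qed

  define c where "c xs = card {H \<in> A3. two_cycles 3 xs \<in> H}" for xs
  have c_sum: "(\<Sum>xs\<in>?P. c xs) \<le> 2160 * card A3"
  proof -
    have "(\<Sum>xs\<in>?P. c xs) = (\<Sum>xs\<in>?P. \<Sum>H\<in>A3. if two_cycles 3 xs \<in> H then 1 else 0)"
      unfolding c_def using finAi(3) by (simp add: sum.If_cases Int_def)
    also have "\<dots> = (\<Sum>H\<in>A3. \<Sum>xs\<in>?P. if two_cycles 3 xs \<in> H then 1 else 0)" by (rule sum.swap)
    also have "\<dots> = (\<Sum>H\<in>A3. card {xs \<in> ?P. two_cycles 3 xs \<in> H})"
      by (simp add: sum.If_cases Int_def)
    also have "\<dots> \<le> (\<Sum>H\<in>A3. 2160)"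
      using primitive_nine.card_three_six[OF prim] by (intro sum_mono) blast
    finally show ?thesis by simp
  qed
  have core: "(288 * int (card S) + 60 * int (card X))\<^sup>2 \<le>
    10080 * (1248 * int (card S) + 990 * int (card X) + 480 * int (card A3) - 80640) + 48384 * (int (card S))\<^sup>2"
  proof (rule weighted_covering_inequality[OF c9 finS S S_ker _ _ c_sum])
    show "T \<subseteq> ?\<Omega> \<and> card T = 3" if "T \<in> X" for T using that \<Y>_sub by (auto simp: X_def)
    fix xs assume xs: "xs \<in> ?P"
    obtain H where H: "H \<in> \<A>" "two_cycles 3 xs \<in> H" using member[OF xs] by blast
    have "support3 (first_three xs) = set (take 3 xs)"
      unfolding take_three[OF lab(2)[OF xs]] by (simp add: support3_def first_three_def)
    moreover have "card (set (take 3 xs)) = 3"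
      using lab[OF xs] by (subst distinct_card) simp_all
    ultimately have supp: "support3 (first_three xs) = set (take 3 xs)" "card (set (take 3 xs)) = 3" .
    have "H \<in> A1 \<or> H \<in> A2 \<or> H \<in> A3" using split[OF H(1)] type4[OF _ H(2) xs] by auto
    then show "(\<exists>f\<in>S. map f xs \<in> set patterns) \<or> support3 (first_three xs) \<in> X \<or> 1 \<le> c xs"
    proof (elim disjE)
      assume "H \<in> A1"
      then show ?thesis using type1[OF _ H(2) xs] supp by (simp add: X_def)
    next
      assume "H \<in> A2"
      then show ?thesis using type2[OF _ H(2) xs] by simp
    next
      assume "H \<in> A3"
      then have "H \<in> {H \<in> A3. two_cycles 3 xs \<in> H}" using H by simp
      then have "c xs \<noteq> 0" unfolding c_def using finAi(3) by (auto simp: card_eq_0_iff)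
      then show ?thesis by simp
    qed
  qed
  show False
  proof (rule final_arithmetic[OF _ _ _ _ _ _ _ core])
    show "int (card X) + int (card S) + int (card A3) + int (card A4) \<le> 84 + int (card J)"
      using total card\<Y> cardS by simp
    show "10 * int (card J) \<le> 3 * int (card A3)" using eight by simp
    show "362880 \<le> 1296 * int (card S) + 13608 * int (card A3)" if "int (card A4) = 0"
      using nine that finAi(4) by simp
  qed simp_all
qed

section \<open>The covering number\<close>

lemma sym_group_subgroupI:
  assumes "\<And>p. p \<in> H \<Longrightarrow> p permutes {1..n}" "id \<in> H"
    "\<And>p. p \<in> H \<Longrightarrow> inv' p \<in> H" "\<And>p q. p \<in> H \<Longrightarrow> q \<in> H \<Longrightarrow> p \<circ> q \<in> H"
  shows "subgroup H (sym_group n)"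
proof (rule group.subgroupI[OF sym_group_is_group])
  show "H \<subseteq> carrier (sym_group n)" using assms(1) by (auto simp: sym_group_carrier)
  show "H \<noteq> {}" using assms(2) by blast
  show "inv\<^bsub>sym_group n\<^esub> p \<in> H" if "p \<in> H" for p
    using assms(1,3) that by (simp add: sym_group_carrier)
  show "p \<otimes>\<^bsub>sym_group n\<^esub> q \<in> H" if "p \<in> H" "q \<in> H" for p q
    using assms(4) that by (simp add: sym_group_mult)
qed

lemma evenperm_funpow:
  assumes "permutation p" shows "evenperm (p ^^ n) \<longleftrightarrow> even n \<or> evenperm p"
proof (induction n)
  case (Suc n)
  have "permutation (p ^^ n)"
  proof (induction n)
    case 0 then show ?case by (simp only: funpow.simps permutation_id)
  next
    case (Suc n) then show ?case unfolding funpow.simps using assms by (rule permutation_compose[rotated])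
  qed
  then show ?case unfolding funpow.simps using Suc assms by (simp only: evenperm_comp) auto
qed (simp only: funpow.simps evenperm_id even_zero simp_thms)

text \<open>Unless the orbit of 1 is everything, it or its complement has between 1 and 4 points. A
  full orbit would give \<open>p ^^ 9 = id\<close>, but odd powers of an odd permutation are
  odd.\<close>

lemma odd_permutation_fixes_small_set:
  assumes p: "p permutes {1..9::nat}" and odd: "\<not> evenperm p"
  obtains Y where "Y \<subseteq> {1..9}" "1 \<le> card Y" "card Y \<le> 4" "p ` Y = Y"
proof -
  have perm: "permutation p" using p permutation_permutes by blast
  let ?O = "range (\<lambda>i. (p ^^ i) 1)"
  have inj: "inj p" using p permutes_inj by blast
  have sub: "?O \<subseteq> {1..9}" 
  proof
    fix x assume "x \<in> ?O"
    then obtain i where "x = (p ^^ i) 1" by blast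
    moreover have "(p ^^ i) 1 \<in> {1..9}"
    proof (induction i)
      case (Suc i) then show ?case using permutes_in_image[OF p, of "(p ^^ i) 1"] by simp
    qed simp
    ultimately show "x \<in> {1..9}" by simp
  qed
  have fin: "finite ?O" using sub finite_subset by blast
  have im: "p ` ?O = ?O"
  proof (rule card_subset_eq[OF fin])
    show "p ` ?O \<subseteq> ?O"
    proof
      fix x assume "x \<in> p ` ?O"
      then obtain i where "x = (p ^^ Suc i) 1" by auto
      then show "x \<in> ?O" by (rule image_eqI) simp
    qed
    show "card (p ` ?O) = card ?O" using inj by (meson card_image inj_on_subset subset_UNIV)
  qed
  have im': "p ` ({1..9} - ?O) = {1..9} - ?O"
    using image_set_diff[OF inj, of "{1..9}" ?O] im permutes_image[OF p] by simp
  have pos: "1 \<le> card ?O" using fin by (auto simp: Suc_le_eq card_gt_0_iff)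
  have sum: "card ?O + card ({1..9} - ?O) = 9"
    using card_Diff_subset[OF fin sub] card_mono[OF _ sub] by simp
  have "card ?O \<noteq> 9"
  proof
    assume nine: "card ?O = 9"
    then have all: "?O = {1..9}" using card_subset_eq[OF _ sub] by simp
    define n where "n = least_power p 1"
    have n: "(p ^^ n) 1 = 1" "n > 0" unfolding n_def using least_power_of_permutation[OF perm] by auto
    have "?O \<subseteq> (\<lambda>i. (p ^^ i) 1) ` {..<n}"
    proof
      fix x assume "x \<in> ?O"
      then obtain i where i: "x = (p ^^ i) 1" by blast
      have "(p ^^ i) 1 = (p ^^ (i mod n)) ((p ^^ (n * (i div n))) 1)"
        by (simp flip: comp_apply[of "p ^^ _" "p ^^ _"] funpow_add)
      also have "(p ^^ (n * (i div n))) 1 = 1"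
        using funpow_fixed[of "p ^^ n" 1 "i div n"] n(1) by (simp add: funpow_mult)
      finally show "x \<in> (\<lambda>i. (p ^^ i) 1) ` {..<n}" using i n(2) by simp
    qed
    then have "9 \<le> n" using nine surj_card_le[of "{..<n}" ?O] by simp
    have "distinct (support p 1)" by (rule cycle_of_permutation[OF perm])
    then have d: "distinct (map (\<lambda>i. (p ^^ i) 1) [0..<n])" by (simp add: n_def)
    have "n = card (set (map (\<lambda>i. (p ^^ i) 1) [0..<n]))" using distinct_card[OF d] by simp
    also have "\<dots> \<le> card ?O" using fin by (intro card_mono) auto
    finally have "n = 9" using nine \<open>9 \<le> n\<close> by simp
    have "p ^^ 9 = id"
    proof
      fix x show "(p ^^ 9) x = id x"
      proof (cases "x \<in> {1..9}")
        case True
        then obtain i where i: "x = (p ^^ i) 1" using all by blast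
        have "(p ^^ 9) x = (p ^^ i) ((p ^^ 9) 1)"
          unfolding i by (metis add.commute comp_apply funpow_add)
        then show ?thesis using n(1) \<open>n = 9\<close> i by simp
      next
        case False
        then have "p x = x" using p by (simp add: permutes_def)
        then show ?thesis by (simp add: funpow_fixed)
      qed
    qed
    then show False using evenperm_funpow[OF perm, of 9] odd evenperm_id by auto
  qed
  then show ?thesis
    using that[OF sub pos _ im] that[of "{1..9} - ?O"] im' sum pos by (cases "card ?O \<le> 4") auto
qed

lemma ex_group_cover: "\<exists>\<A>. group_cover (sym_group 9) \<A> \<and> card \<A> \<le> 256"
proof -
  let ?\<Omega> = "{1..9::nat}"
  define stab where "stab Y = {p. p permutes ?\<Omega> \<and> p ` Y = Y}" for Y
  define alt where "alt = {p. p permutes ?\<Omega> \<and> evenperm p}"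
  define \<Y> where "\<Y> = (\<Union>k\<in>{1,2,3,4}. {Y. Y \<subseteq> ?\<Omega> \<and> card Y = k})"
  have \<Y>_iff: "Y \<in> \<Y> \<longleftrightarrow> Y \<subseteq> ?\<Omega> \<and> 1 \<le> card Y \<and> card Y \<le> 4" for Y by (auto simp: \<Y>_def)
  have fin\<Y>: "finite \<Y>" by (simp add: \<Y>_def)
  have "card \<Y> \<le> (\<Sum>k\<in>{1,2,3,4}. card {Y. Y \<subseteq> ?\<Omega> \<and> card Y = k})"
    unfolding \<Y>_def by (rule card_UN_le) simp
  also have "\<dots> = (\<Sum>k\<in>{1,2,3,4}. 9 choose k)"
    by (intro sum.cong refl) (simp add: n_subsets)
  also have "\<dots> = 255" by (simp add: numeral_eq_Suc)
  finally have card\<Y>: "card \<Y> \<le> 255" .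
  let ?\<A> = "insert alt (stab ` \<Y>)"
  have "card ?\<A> \<le> Suc (card (stab ` \<Y>))" using fin\<Y> by (simp add: card_insert_if)
  also have "card (stab ` \<Y>) \<le> card \<Y>" by (rule card_image_le[OF fin\<Y>])
  finally have card: "card ?\<A> \<le> 256" using card\<Y> by simp
  have perm: "permutation p" if "p permutes ?\<Omega>" for p using that permutation_permutes by blast
  have alt: "subgroup alt (sym_group 9)" "alt \<noteq> carrier (sym_group 9)"
  proof -
    show "subgroup alt (sym_group 9)"
      by (rule sym_group_subgroupI)
        (auto simp: alt_def permutes_inv evenperm_inv evenperm_comp perm evenperm_id permutes_id[unfolded id_def] permutes_compose)
    have "transpose 1 2 permutes ?\<Omega>" by (rule permutes_swap_id) auto
    moreover have "\<not> evenperm (transpose 1 (2::nat))" by (simp add: evenperm_swap)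
    ultimately show "alt \<noteq> carrier (sym_group 9)" by (auto simp: alt_def sym_group_carrier set_eq_iff)
  qed
  have stab: "subgroup (stab Y) (sym_group 9)" "stab Y \<noteq> carrier (sym_group 9)" if Y: "Y \<in> \<Y>" for Y
  proof -
    show "subgroup (stab Y) (sym_group 9)"
    proof (rule sym_group_subgroupI)
      show "inv' p \<in> stab Y" if "p \<in> stab Y" for p
      proof -
        have p: "p permutes ?\<Omega>" "p ` Y = Y" using that by (auto simp: stab_def)
        have "inv' p ` p ` Y = Y" using p(1) by (simp add: image_comp permutes_inv_o)
        then show ?thesis using p permutes_inv[OF p(1)] by (simp add: stab_def)
      qed
      show "p \<circ> q \<in> stab Y" if "p \<in> stab Y" "q \<in> stab Y" for p q
      proof -
        have "p permutes ?\<Omega>" "q permutes ?\<Omega>" "p ` Y = Y" "q ` Y = Y" using that by (auto simp: stab_def)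
        moreover from this have "(p \<circ> q) ` Y = Y" by (metis image_comp)
        ultimately show ?thesis using permutes_compose[of q ?\<Omega> p] by (simp add: stab_def)
      qed
    qed (auto simp: stab_def permutes_id[unfolded id_def])
    have "Y \<noteq> {}" using Y by (auto simp: \<Y>_iff)
    then obtain a where a: "a \<in> Y" by blast
    have "Y \<noteq> ?\<Omega>" using Y by (auto simp: \<Y>_iff)
    moreover have "Y \<subseteq> ?\<Omega>" using Y by (simp only: \<Y>_iff)
    ultimately obtain b where b: "b \<in> ?\<Omega>" "b \<notin> Y" by blast
    have "a \<in> ?\<Omega>" using a Y by (auto simp: \<Y>_iff)
    then have "transpose a b permutes ?\<Omega>" using b(1) by (rule permutes_swap_id)
    moreover have "transpose a b ` Y \<noteq> Y"
    proof
      assume "transpose a b ` Y = Y"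
      then have "transpose a b a \<in> Y" using a by blast
      then show False using b by simp
    qed
    ultimately show "stab Y \<noteq> carrier (sym_group 9)" by (auto simp: stab_def sym_group_carrier set_eq_iff)
  qed
  have "\<Union>?\<A> = carrier (sym_group 9)"
  proof (intro equalityI subsetI)
    fix p assume "p \<in> \<Union>?\<A>"
    then show "p \<in> carrier (sym_group 9)" by (auto simp: alt_def stab_def sym_group_carrier)
  next
    fix p assume "p \<in> carrier (sym_group 9)"
    then have p: "p permutes ?\<Omega>" by (simp add: sym_group_carrier)
    show "p \<in> \<Union>?\<A>"
    proof (cases "evenperm p")
      case True then show ?thesis using p by (simp add: alt_def)
    next
      case False
      then obtain Y where "Y \<subseteq> ?\<Omega>" "1 \<le> card Y" "card Y \<le> 4" "p ` Y = Y"
        using odd_permutation_fixes_small_set[OF p] by blast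
      then have "Y \<in> \<Y>" "p \<in> stab Y" using p by (auto simp: \<Y>_iff stab_def)
      then show ?thesis by blast
    qed
  qed
  then have "group_cover (sym_group 9) ?\<A>"
    unfolding group_cover_def using fin\<Y> alt stab by auto
  then show ?thesis using card by blast
qed

theorem theorem3p1:
  shows "covering_number (sym_group 9) = 256"
proof (rule antisym)
  obtain \<A> where \<A>: "group_cover (sym_group 9) \<A>" "card \<A> \<le> 256" using ex_group_cover by blast
  have "covering_number (sym_group 9) \<le> enat (card \<A>)"
    unfolding covering_number_def using \<A>(1) by (intro INF_lower) simp
  also have "\<dots> \<le> 256" using \<A>(2) by (simp add: numeral_eq_enat)
  finally show "covering_number (sym_group 9) \<le> 256" .
  show "256 \<le> covering_number (sym_group 9)"
    unfolding covering_number_def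
    by (rule INF_greatest) (use group_cover_card_ge in \<open>auto simp: numeral_eq_enat\<close>)
qed

end
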